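(* Let $G$ be a compact group, let $g_0\in G$, and let $C_0=\{xg_0x^{-1} : x\in G\}$ be the conjugacy class of $g_0$. Then the class operator $\lambda(C_0)$ of the group algebra $L^2(G)$ based on $C_0$, i.e. the operator on $L^2(G)$ defined by $\lambda(C_0)=\int_G \lambda(xg_0x^{-1})\,dx$, is given by $$\lambda(C_0)=\sum_{\alpha\in\widehat{G}}\frac{1}{n^\alpha}\,\chi^\alpha(C_0)\,P^\alpha ,$$ where $\chi^\alpha(C_0)$ denotes the common value of the character $\chi^\alpha$ on the elements of $C_0$.
   Context: $G$ is a compact group with Haar measure $dx$ normalized by $\int_G dx=1$. $\widehat{G}$ is the set of equivalence classes of irreducible unitary representations of $G$; for $\alpha\in\widehat{G}$, $n^\alpha$ is its dimension and $\chi^\alpha$ its character. The group algebra of $G$ is $L^2(G)$ with convolution as multiplication. The left regular representation $\lambda$ of $G$ on $L^2(G)$ is $\lambda(g)f(y)=f(g^{-1}y)$. The integral defining $\lambda(C_0)$ is taken in the strong operator sense, so that $\lambda(C_0)f(y)=\int_G f(xg_0^{-1}x^{-1}y)\,dx$ for $f\in L^2(G)$. $P^\alpha$ is the orthogonal projection of $L^2(G)$ onto the isotypic component $L^2(G)^\alpha$ of type $\alpha$ of the representation $\lambda$, i.e. $P^\alpha=n^\alpha\int_G\overline{\chi^\alpha(g)}\,\lambda(g)\,dg$; equivalently, $L^2(G)^\alpha$ is the span of the complex conjugates of the matrix elements of a unitary representation in the class $\alpha$. The sum over $\widehat{G}$ is understood in the strong operator sense. *)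

theory Defs
  imports "HOL-Analysis.Analysis" "Jordan_Normal_Form.Schur_Decomposition"
begin

(* Groups are types of class topological_group_add, the library's class of topological groups.
   It is not commutative; the group law is written additively, so x g x^-1 reads x + g - x and
   g^-1 y reads - g + y. *)

section \<open>Haar measure and the space of square integrable functions\<close>

(* Regularity is part of the notion: G need not be metrizable, so a finite Borel measure
   on G is not automatically regular. *)
definition normalized_haar :: "'g::{topological_group_add, t2_space} measure \<Rightarrow> bool" where
  "normalized_haar \<mu> \<longleftrightarrow>
     sets \<mu> = sets borel \<and>
     emeasure \<mu> UNIV = 1 \<and>
     (\<forall>g. \<forall>A\<in>sets borel. emeasure \<mu> ((\<lambda>x. g + x) ` A) = emeasure \<mu> A) \<and>
     (\<forall>A\<in>sets borel. emeasure \<mu> A = (INF U\<in>{U. open U \<and> A \<subseteq> U}. emeasure \<mu> U)) \<and>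
     (\<forall>U. open U \<longrightarrow> emeasure \<mu> U = (SUP K\<in>{K. compact K \<and> K \<subseteq> U}. emeasure \<mu> K))"

(* Elements of L2 are functions; equality in L^2(G) is equality almost everywhere. *)
definition L2 :: "'g::topological_space measure \<Rightarrow> ('g \<Rightarrow> complex) set" where
  "L2 \<mu> = {f. f \<in> borel_measurable \<mu> \<and> integrable \<mu> (\<lambda>x. (cmod (f x))\<^sup>2)}"

definition L2_inner :: "'g measure \<Rightarrow> ('g \<Rightarrow> complex) \<Rightarrow> ('g \<Rightarrow> complex) \<Rightarrow> complex" where
  "L2_inner \<mu> f h = (\<integral>x. f x * cnj (h x) \<partial>\<mu>)"

definition L2_norm :: "'g measure \<Rightarrow> ('g \<Rightarrow> complex) \<Rightarrow> real" where
  "L2_norm \<mu> f = sqrt (\<integral>x. (cmod (f x))\<^sup>2 \<partial>\<mu>)"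

definition orthogonal_projection ::
    "'g measure \<Rightarrow> ('g \<Rightarrow> complex) set \<Rightarrow> ('g \<Rightarrow> complex) \<Rightarrow> ('g \<Rightarrow> complex)" where
  "orthogonal_projection \<mu> S f =
     (SOME p. p \<in> S \<and> (\<forall>h\<in>S. L2_inner \<mu> (\<lambda>x. f x - p x) h = 0))"

(* T is the sum of the operators A i, i in I, in the strong operator topology: for every f the
   finite partial sums, directed by inclusion, converge to T f in L^2(G). Membership in L2 is
   required explicitly because L2_norm is meaningful only there. *)
definition has_strong_operator_sum ::
    "'g::topological_space measure \<Rightarrow> ('i \<Rightarrow> ('g \<Rightarrow> complex) \<Rightarrow> 'g \<Rightarrow> complex) \<Rightarrow> 'i set
      \<Rightarrow> (('g \<Rightarrow> complex) \<Rightarrow> 'g \<Rightarrow> complex) \<Rightarrow> bool" where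
  "has_strong_operator_sum \<mu> A I T \<longleftrightarrow>
     (\<forall>f\<in>L2 \<mu>. T f \<in> L2 \<mu> \<and> (\<forall>i\<in>I. A i f \<in> L2 \<mu>) \<and>
        ((\<lambda>F. L2_norm \<mu> (\<lambda>y. T f y - (\<Sum>i\<in>F. A i f y))) \<longlongrightarrow> 0) (finite_subsets_at_top I))"


section \<open>Left regular representation and class operators\<close>

definition left_regular :: "'g::group_add \<Rightarrow> ('g \<Rightarrow> complex) \<Rightarrow> ('g \<Rightarrow> complex)" where
  "left_regular g f = (\<lambda>y. f (- g + y))"

definition conj_class :: "'g::group_add \<Rightarrow> 'g set" where
  "conj_class g0 = {x + g0 - x | x. True}"

definition class_operator ::
    "'g::group_add measure \<Rightarrow> 'g \<Rightarrow> ('g \<Rightarrow> complex) \<Rightarrow> ('g \<Rightarrow> complex)" where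
  "class_operator \<mu> g0 f = (\<lambda>y. \<integral>x. left_regular (x + g0 - x) f y \<partial>\<mu>)"


section \<open>Irreducible unitary representations and the dual\<close>

(* Irreducible unitary representations of a compact group are finite-dimensional; they are
   written as matrices in an orthonormal basis of the representation space. *)
definition unitary_rep :: "nat \<Rightarrow> ('g::topological_group_add \<Rightarrow> complex mat) \<Rightarrow> bool" where
  "unitary_rep n \<pi> \<longleftrightarrow>
     (\<forall>g. \<pi> g \<in> carrier_mat n n \<and> mat_adjoint (\<pi> g) * \<pi> g = 1\<^sub>m n) \<and>
     (\<forall>g h. \<pi> (g + h) = \<pi> g * \<pi> h) \<and>
     (\<forall>i<n. \<forall>j<n. continuous_on UNIV (\<lambda>g. \<pi> g $$ (i, j)))"

definition rep_dim :: "('g::zero \<Rightarrow> complex mat) \<Rightarrow> nat" where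
  "rep_dim \<pi> = dim_row (\<pi> 0)"

definition vec_subspace :: "nat \<Rightarrow> complex vec set \<Rightarrow> bool" where
  "vec_subspace n W \<longleftrightarrow>
     W \<subseteq> carrier_vec n \<and> 0\<^sub>v n \<in> W \<and>
     (\<forall>u\<in>W. \<forall>v\<in>W. u + v \<in> W) \<and> (\<forall>c. \<forall>v\<in>W. c \<cdot>\<^sub>v v \<in> W)"

definition irreps :: "('g::topological_group_add \<Rightarrow> complex mat) set" where
  "irreps = {\<pi>. \<exists>n>0. unitary_rep n \<pi> \<and>
     (\<forall>W. vec_subspace n W \<and> (\<forall>g. \<forall>v\<in>W. \<pi> g *\<^sub>v v \<in> W)
        \<longrightarrow> W = {0\<^sub>v n} \<or> W = carrier_vec n)}"

definition rep_equiv ::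
    "(('g::topological_group_add \<Rightarrow> complex mat) \<times> ('g \<Rightarrow> complex mat)) set" where
  "rep_equiv = {(\<pi>, \<rho>). \<pi> \<in> irreps \<and> \<rho> \<in> irreps \<and> rep_dim \<pi> = rep_dim \<rho> \<and>
     (\<exists>U \<in> carrier_mat (rep_dim \<pi>) (rep_dim \<pi>).
        mat_adjoint U * U = 1\<^sub>m (rep_dim \<pi>) \<and> (\<forall>g. U * \<pi> g = \<rho> g * U))}"

definition unitary_dual :: "('g::topological_group_add \<Rightarrow> complex mat) set set" where
  "unitary_dual = irreps // rep_equiv"

definition representative ::
    "('g::topological_group_add \<Rightarrow> complex mat) set \<Rightarrow> ('g \<Rightarrow> complex mat)" where
  "representative \<alpha> = (SOME \<pi>. \<pi> \<in> \<alpha>)"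

definition dual_dim :: "('g::topological_group_add \<Rightarrow> complex mat) set \<Rightarrow> nat" where
  "dual_dim \<alpha> = rep_dim (representative \<alpha>)"

definition dual_character ::
    "('g::topological_group_add \<Rightarrow> complex mat) set \<Rightarrow> 'g \<Rightarrow> complex" where
  "dual_character \<alpha> g = (\<Sum>i<dual_dim \<alpha>. representative \<alpha> g $$ (i, i))"

definition dual_character_on ::
    "('g::topological_group_add \<Rightarrow> complex mat) set \<Rightarrow> 'g set \<Rightarrow> complex" where
  "dual_character_on \<alpha> C = (THE c. \<forall>g\<in>C. dual_character \<alpha> g = c)"


section \<open>Isotypic components of the left regular representation\<close>

(* T is a unitary equivalence of \<pi> with a subrepresentation of the left regular representation *)
definition regular_embedding ::
    "'g::topological_group_add measure \<Rightarrow> ('g \<Rightarrow> complex mat)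
      \<Rightarrow> (complex vec \<Rightarrow> 'g \<Rightarrow> complex) \<Rightarrow> bool" where
  "regular_embedding \<mu> \<pi> T \<longleftrightarrow> (let V = carrier_vec (rep_dim \<pi>) in
     (\<forall>v\<in>V. T v \<in> L2 \<mu>) \<and>
     (\<forall>u\<in>V. \<forall>v\<in>V. AE y in \<mu>. T (u + v) y = T u y + T v y) \<and>
     (\<forall>c. \<forall>v\<in>V. AE y in \<mu>. T (c \<cdot>\<^sub>v v) y = c * T v y) \<and>
     (\<forall>u\<in>V. \<forall>v\<in>V. L2_inner \<mu> (T u) (T v) = u \<bullet>c v) \<and>
     (\<forall>g. \<forall>v\<in>V. AE y in \<mu>. T (\<pi> g *\<^sub>v v) y = left_regular g (T v) y))"

(* The algebraic sum of all subrepresentations of type \<alpha>. *)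
definition isotypic_sum ::
    "'g::topological_group_add measure \<Rightarrow> ('g \<Rightarrow> complex mat) set \<Rightarrow> ('g \<Rightarrow> complex) set" where
  "isotypic_sum \<mu> \<alpha> = {\<lambda>y. \<Sum>k<m. T k (v k) y | (m::nat) T v.
     \<forall>k<m. regular_embedding \<mu> (representative \<alpha>) (T k) \<and> v k \<in> carrier_vec (dual_dim \<alpha>)}"

definition isotypic_component ::
    "'g::topological_group_add measure \<Rightarrow> ('g \<Rightarrow> complex mat) set \<Rightarrow> ('g \<Rightarrow> complex) set" where
  "isotypic_component \<mu> \<alpha> =
     {f \<in> L2 \<mu>. \<forall>e>0. \<exists>h\<in>isotypic_sum \<mu> \<alpha>. L2_norm \<mu> (\<lambda>y. f y - h y) < e}"

definition isotypic_projection ::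
    "'g::topological_group_add measure \<Rightarrow> ('g \<Rightarrow> complex mat) set
      \<Rightarrow> ('g \<Rightarrow> complex) \<Rightarrow> ('g \<Rightarrow> complex)" where
  "isotypic_projection \<mu> \<alpha> = orthogonal_projection \<mu> (isotypic_component \<mu> \<alpha>)"

end

theory Submission
  imports Defs "HOL-Probability.Giry_Monad" "Jordan_Normal_Form.Spectral_Radius"
begin

text \<open>The class operator is an \<open>L\<^sup>2\<close>-contraction, by Jensen's inequality and Fubini's theorem, and by
  Schur's orthogonality relations it multiplies the matrix coefficients of type \<open>\<alpha>\<close> by
  \<open>\<chi>\<^sup>\<alpha>(g\<^sub>0)/n\<^sup>\<alpha>\<close>. So the theorem follows from the Peter--Weyl theorem \<open>f = \<Sum> P\<^sup>\<alpha> f\<close>.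

  Density of the matrix coefficients is obtained without spectral theory. For a self-adjoint continuous
  \<open>r \<noteq> 0\<close>, the even convolution powers of \<open>r\<close>, divided by the powers of the top eigenvalue
  \<open>\<Lambda>\<close> of \<open>r * r\<close>, converge uniformly to an idempotent, because \<open>n \<mapsto> \<parallel>r\<^sup>n\<parallel>\<^sup>2\<close> is log-convex and
  submultiplicative. The range of this idempotent is finite-dimensional, and a minimal invariant subspace
  gives an irreducible representation whose coefficients reduce \<open>\<parallel>r\<parallel>\<^sup>2\<close> by at least \<open>\<Lambda>\<close>. Starting
  from an approximate identity and almost minimizing \<open>\<parallel>r\<parallel>\<^sup>2\<close> modulo coefficients makes \<open>\<Lambda>\<close>,
  hence \<open>\<parallel>r * r\<parallel>\<close>, arbitrarily small.

  The group need not be second countable, so its Borel sets are handled on the topological product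
  rather than on the product \<open>\<sigma>\<close>-algebra.\<close>

section \<open>Fubini's theorem for Borel sets of the product topology\<close>

text \<open>Why almost minimizing forces \<Lambda> to be small: let q be the idempotent of a minimal
  invariant subspace of the eigenspace for \<Lambda>. Replacing r by (1 - q) r (1 - q) keeps it
  self-adjoint and changes it only by matrix coefficients, as these form a two-sided ideal. The
  right factor alone lowers the squared norm by that of r q, which is \<Lambda> times that of q and
  so at least \<Lambda>. If the squared norm of r is within d of the infimum, then \<Lambda> < d.

  Representations are built on continuous functions: for them equality almost everywhere is
  equality, so subspaces and bases obey plain linear algebra, and one convolution turns L2
  convergence into uniform convergence. Null sets come back with the isotypic components, which are
  defined by embeddings whose covariance fails on a null set depending on the group element.
  Matching them with spaces of matrix coefficients rests on Fubini's theorem, as does associativity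
  of convolution.

  The coefficients are conjugated throughout because left translation acts on a column of conjugated
  entries of \<pi> by \<pi> itself.\<close>

locale regular_prob_space =
  fixes \<mu> :: "'g::t2_space measure"
  assumes sets_mu [simp, measurable_cong]: "sets \<mu> = sets borel"
    and emeasure_UNIV [simp]: "emeasure \<mu> UNIV = 1"
    and inner_regular:
      "open U \<Longrightarrow> emeasure \<mu> U = (SUP K\<in>{K. compact K \<and> K \<subseteq> U}. emeasure \<mu> K)"
begin

lemma space_mu [simp]: "space \<mu> = UNIV"
  using sets_eq_imp_space_eq[OF sets_mu] by simp

sublocale prob_space \<mu>
  by standard simp

sublocale mu2: pair_prob_space \<mu> \<mu> ..

lemma inner_regular_less:
  assumes "open U" "c < emeasure \<mu> U"
  obtains K where "compact K" "K \<subseteq> U" "c < emeasure \<mu> K"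
  using assms inner_regular[of U] by (auto simp: less_SUP_iff)

lemma open_Pair_vimage: "open W \<Longrightarrow> open (Pair x -` W)"
  by (rule open_vimage) (auto intro!: continuous_intros)

text \<open>Lower semicontinuity of the measure of the sections: a compact subset of one section
  that already has measure above c stays inside all nearby sections by the tube lemma.\<close>

lemma open_section_greater:
  fixes W :: "('a::topological_space \<times> 'g) set"
  assumes "open W"
  shows "open {x. c < emeasure \<mu> (Pair x -` W)}"
proof (subst open_subopen, safe)
  fix x assume "c < emeasure \<mu> (Pair x -` W)"
  from inner_regular_less[OF open_Pair_vimage[OF assms] this]
  obtain K where K: "compact K" "K \<subseteq> Pair x -` W" "c < emeasure \<mu> K" by blast
  have xK: "{x} \<times> K \<subseteq> W" using K(2) by auto
  obtain X0 where X0: "x \<in> X0" "open X0" "X0 \<times> K \<subseteq> W"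
    using Elementary_Topology.tube_lemma[OF K(1) assms, of x] xK by blast
  have "X0 \<subseteq> {x. c < emeasure \<mu> (Pair x -` W)}"
  proof safe
    fix z assume "z \<in> X0"
    then have "K \<subseteq> Pair z -` W" using X0(3) by auto
    then have "emeasure \<mu> K \<le> emeasure \<mu> (Pair z -` W)"
      by (intro emeasure_mono) (auto intro: borel_open open_Pair_vimage assms)
    then show "c < emeasure \<mu> (Pair z -` W)" using K(3) by simp
  qed
  then show "\<exists>T. open T \<and> x \<in> T \<and> T \<subseteq> {x. c < emeasure \<mu> (Pair x -` W)}"
    using X0 by blast
qed

lemma measurable_section:
  fixes W :: "('g \<times> 'g) set"
  assumes "open W"
  shows "(\<lambda>x. emeasure \<mu> (Pair x -` W)) \<in> borel_measurable \<mu>"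
  by (rule borel_measurableI_greater)
    (use open_section_greater[OF assms] in \<open>auto intro: borel_open\<close>)

text \<open>Approximants of \<open>W\<close> from below: they are members of the product
  \<sigma>-algebra, where the usual Fubini theorem applies, and they are directed under
  union.\<close>

definition rects :: "('g \<times> 'g) set \<Rightarrow> ('g \<times> 'g) set set" where
  "rects W = {\<Union>(A, B)\<in>F. A \<times> B | F. finite F \<and> (\<forall>(A, B)\<in>F. open A \<and> open B \<and> A \<times> B \<subseteq> W)}"

lemma rects_open: "R \<in> rects W \<Longrightarrow> open R"
  by (auto simp: rects_def intro!: open_Times)

lemma rects_sets: "R \<in> rects W \<Longrightarrow> R \<in> sets (\<mu> \<Otimes>\<^sub>M \<mu>)"
  unfolding rects_def by (auto intro!: sets.finite_UN pair_measureI borel_open)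

lemma rects_subset: "R \<in> rects W \<Longrightarrow> R \<subseteq> W"
  by (auto simp: rects_def; blast)

lemma rects_empty: "{} \<in> rects W"
  by (auto simp: rects_def)

lemma rects_single:
  "open A \<Longrightarrow> open B \<Longrightarrow> A \<times> B \<subseteq> W \<Longrightarrow> A \<times> B \<in> rects W"
  unfolding rects_def mem_Collect_eq by (rule exI[of _ "{(A, B)}"]) auto

lemma rects_Un:
  assumes "R \<in> rects W" "S \<in> rects W"
  shows "R \<union> S \<in> rects W"
proof -
  from assms obtain F F' where
    "R = (\<Union>(A, B)\<in>F. A \<times> B)" "finite F" "\<forall>(A, B)\<in>F. open A \<and> open B \<and> A \<times> B \<subseteq> W"
    "S = (\<Union>(A, B)\<in>F'. A \<times> B)" "finite F'" "\<forall>(A, B)\<in>F'. open A \<and> open B \<and> A \<times> B \<subseteq> W"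
    unfolding rects_def mem_Collect_eq by blast
  then show ?thesis
    unfolding rects_def mem_Collect_eq by (intro exI[of _ "F \<union> F'"]) auto
qed

lemma rects_UN:
  "finite I \<Longrightarrow> (\<And>i. i \<in> I \<Longrightarrow> R i \<in> rects W) \<Longrightarrow> (\<Union>i\<in>I. R i) \<in> rects W"
  by (induction I rule: finite_induct) (simp_all add: rects_empty rects_Un)

lemma rects_swap:
  assumes "R \<in> rects (prod.swap -` W)"
  shows "prod.swap -` R \<in> rects W"
proof -
  from assms obtain F where F1: "R = (\<Union>(A, B)\<in>F. A \<times> B)" "finite F"
    and "\<forall>(A, B)\<in>F. open A \<and> open B \<and> A \<times> B \<subseteq> prod.swap -` W"
    unfolding rects_def mem_Collect_eq by (elim exE conjE)
  then have F: "R = (\<Union>(A, B)\<in>F. A \<times> B)" "finite F"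
    "\<And>A B. (A, B) \<in> F \<Longrightarrow> open A \<and> open B \<and> A \<times> B \<subseteq> prod.swap -` W"
    by (simp, simp, fast)
  have *: "B \<times> A \<subseteq> W" if "(A, B) \<in> F" for A B
    using F(3)[OF that] by auto
  have "prod.swap -` R = (\<Union>(A, B)\<in>prod.swap ` F. A \<times> B)"
    unfolding F(1) by fastforce
  moreover have "\<forall>(A, B)\<in>prod.swap ` F. open A \<and> open B \<and> A \<times> B \<subseteq> W"
    using F(3) * by fastforce
  ultimately show ?thesis
    unfolding rects_def mem_Collect_eq using F(2) by (intro exI[of _ "prod.swap ` F"]) simp
qed

text \<open>The point where regularity enters: an open set is an uncountable union of open rectangles,
  and only compactness lets finitely many of them capture almost all of a section.\<close>

lemma AE_section_eq:
  assumes W: "open W" and W0: "open W0" "W0 \<subseteq> W"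
    and rects_le: "\<And>R. R \<in> rects W \<Longrightarrow>
      AE x in \<mu>. emeasure \<mu> (Pair x -` R) \<le> emeasure \<mu> (Pair x -` W0)"
  shows "AE x in \<mu>. emeasure \<mu> (Pair x -` W) = emeasure \<mu> (Pair x -` W0)"
proof -
  note [measurable] = measurable_section[OF W] measurable_section[OF W0(1)]
  let ?h = "\<lambda>W x. emeasure \<mu> (Pair x -` W)"
  \<comment> \<open>\<open>W0\<close> can fall short of \<open>W\<close> at x only if some level q
    separates the two section measures, so it is enough to treat one level at a time.\<close>
  have main: "AE x in \<mu>. \<not> (?h W0 x \<le> q \<and> q < ?h W x)" for q
  proof -
    define B where "B = {x. ?h W0 x \<le> q \<and> q < ?h W x}"
    define S where "S = {x. q < ?h W x}"
    have S: "open S" unfolding S_def by (rule open_section_greater[OF W])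
    have B_sets: "B \<in> sets \<mu>"
      unfolding B_def by measurable
    have B_sub: "B \<subseteq> S" by (auto simp: B_def S_def)
    \<comment> \<open>\<open>S\<close> is open, so its measure is the supremum over compact
      \<open>K\<close>. Each such \<open>K\<close> lies in \<open>S - B\<close> up to a null set,
      and therefore \<open>B\<close> is null.\<close>
    have "emeasure \<mu> K \<le> emeasure \<mu> (S - B)" if K: "compact K" "K \<subseteq> S" for K
    proof -
      have "\<exists>R\<in>rects W. q < ?h R x" if x: "x \<in> K" for x
      proof -
        have "q < ?h W x" using x K by (auto simp: S_def)
        from inner_regular_less[OF open_Pair_vimage[OF W] this]
        obtain L where L: "compact L" "L \<subseteq> Pair x -` W" "q < emeasure \<mu> L" by blast
        \<comment> \<open>The second sides of rectangles in \<open>W\<close> whose first side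
          contains x. Finitely many of them cover the compact \<open>L\<close> and yield a single
          member of \<open>rects W\<close> with a large section at x.\<close>
        define \<C> where "\<C> = {B. open B \<and> (\<exists>A. open A \<and> x \<in> A \<and> A \<times> B \<subseteq> W)}"
        have "L \<subseteq> \<Union>\<C>"
        proof
          fix y assume "y \<in> L"
          then have "(x, y) \<in> W" using L by auto
          from open_prod_elim[OF W this] obtain A B
            where "open A" "open B" "(x, y) \<in> A \<times> B" "A \<times> B \<subseteq> W" by blast
          then show "y \<in> \<Union>\<C>" by (auto simp: \<C>_def)
        qed
        then obtain D where D: "D \<subseteq> \<C>" "finite D" "L \<subseteq> \<Union>D"
          using compactE[OF L(1), of \<C>] unfolding \<C>_def by (metis (no_types, lifting) mem_Collect_eq)
        have "\<forall>B\<in>D. \<exists>A. open A \<and> x \<in> A \<and> A \<times> B \<subseteq> W"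
          using D(1) by (auto simp: \<C>_def)
        then obtain a where a: "\<And>B. B \<in> D \<Longrightarrow> open (a B) \<and> x \<in> a B \<and> a B \<times> B \<subseteq> W"
          by metis
        have R: "(\<Union>B\<in>D. a B \<times> B) \<in> rects W"
          using a D by (intro rects_UN rects_single) (auto simp: \<C>_def)
        have "L \<subseteq> Pair x -` (\<Union>B\<in>D. a B \<times> B)"
        proof
          fix y assume "y \<in> L"
          then obtain B where "B \<in> D" "y \<in> B" using D(3) by auto
          then show "y \<in> Pair x -` (\<Union>B\<in>D. a B \<times> B)"
            using a[of B] by auto
        qed
        then have "emeasure \<mu> L \<le> ?h (\<Union>B\<in>D. a B \<times> B) x"
          by (intro emeasure_mono) (auto intro!: borel_open open_Pair_vimage rects_open[OF R])
        then show ?thesis using L(3) R by force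
      qed
      then obtain r where r: "\<And>x. x \<in> K \<Longrightarrow> r x \<in> rects W" "\<And>x. x \<in> K \<Longrightarrow> q < ?h (r x) x"
        by metis
      \<comment> \<open>Compactness a second time, now in the first coordinate: finitely many of the
        \<open>r z\<close> serve every x in \<open>K\<close>, so their union does, and the
        hypothesis on rectangles applies to it.\<close>
      obtain D where D: "D \<subseteq> K" "finite D" "K \<subseteq> (\<Union>z\<in>D. {x. q < ?h (r z) x})"
        by (rule compactE_image[OF K(1), of K "\<lambda>z. {x. q < ?h (r z) x}"])
          (use r in \<open>auto intro!: open_section_greater rects_open\<close>)
      define R where "R = (\<Union>z\<in>D. r z)"
      have R: "R \<in> rects W" unfolding R_def using D r by (intro rects_UN) auto
      have q_less: "q < ?h R x" if x: "x \<in> K" for x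
      proof -
        obtain z where z: "z \<in> D" "q < ?h (r z) x" using x D by auto
        have "?h (r z) x \<le> ?h R x"
        proof (rule emeasure_mono)
          show "Pair x -` r z \<subseteq> Pair x -` R" using z(1) by (auto simp: R_def)
          show "Pair x -` R \<in> sets \<mu>" using open_Pair_vimage[OF rects_open[OF R]] by simp
        qed
        then show ?thesis using z by simp
      qed
      have "AE x in \<mu>. x \<in> K \<longrightarrow> x \<in> S - B"
        using rects_le[OF R]
      proof eventually_elim
        case (elim x)
        then show ?case
          using q_less[of x] K(2) by (auto simp: B_def)
      qed
      then show ?thesis
        by (intro emeasure_mono_AE) (use S B_sets in \<open>auto intro: borel_open\<close>)
    qed
    then have le: "emeasure \<mu> S \<le> emeasure \<mu> (S - B)"
      by (subst inner_regular[OF S]) (auto intro: SUP_least)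
    have "measure \<mu> (S - B) = measure \<mu> S - measure \<mu> B"
      by (rule finite_measure_Diff) (use S B_sets B_sub in \<open>auto intro: borel_open\<close>)
    then have "emeasure \<mu> B = 0"
      using le measure_nonneg[of \<mu> B] measure_nonneg[of \<mu> S]
        finite_measure_mono[OF B_sub] S
      by (auto simp add: emeasure_eq_measure ennreal_le_iff2 borel_open)
    then have "B \<in> null_sets \<mu>" using B_sets by auto
    from AE_not_in[OF this] show ?thesis by (auto simp: B_def)
  qed
  \<comment> \<open>Rational levels, enumerated by \<open>from_nat\<close>, keep the union of the
    exceptional sets null. Between two different section measures, which are finite, there is always
    such a level.\<close>
  have "AE x in \<mu>. \<forall>q\<in>range (\<lambda>n. ennreal (of_rat (from_nat n))). \<not> (?h W0 x \<le> q \<and> q < ?h W x)"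
    using main by (intro AE_ball_countable[THEN iffD2] ballI) simp_all
  then show ?thesis
  proof eventually_elim
    case (elim x)
    have le: "?h W0 x \<le> ?h W x"
      using W0 by (intro emeasure_mono) (auto intro!: borel_open open_Pair_vimage W)
    moreover have "\<not> ?h W0 x < ?h W x"
    proof
      assume "?h W0 x < ?h W x"
      then have "measure \<mu> (Pair x -` W0) < measure \<mu> (Pair x -` W)"
        by (simp add: emeasure_eq_measure ennreal_less_iff)
      then obtain r where r: "r \<in> \<rat>" "measure \<mu> (Pair x -` W0) < r" "r < measure \<mu> (Pair x -` W)"
        using Rats_dense_in_real by blast
      obtain s where s: "r = of_rat s" using r(1) by (auto elim: Rats_cases)
      have "ennreal r \<in> range (\<lambda>n. ennreal (of_rat (from_nat n)))"
        unfolding s by (rule image_eqI[of _ _ "to_nat s"]) simp_all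
      moreover have "?h W0 x \<le> ennreal r" "ennreal r < ?h W x"
        using r(2,3) le_less_trans[OF measure_nonneg[of \<mu> "Pair x -` W0"] r(2)]
        by (auto simp: emeasure_eq_measure intro!: ennreal_leI ennreal_lessI)
      ultimately show False using elim by blast
    qed
    ultimately show ?case by simp
  qed
qed

lemma swap_section: "Pair y -` (prod.swap -` W) = (\<lambda>x. (x, y)) -` W"
  by auto

lemma open_swap: "open W \<Longrightarrow> open (prod.swap -` (W :: ('g \<times> 'g) set))"
  by (rule open_vimage) (auto intro!: continuous_on_swap)

text \<open>\<open>W\<close> itself may lie outside the product \<sigma>-algebra. It is replaced by
  a countable union \<open>W0\<close> of members of \<open>rects W\<close> with the largest possible
  product measure, to which the usual theorem applies. Maximality makes \<open>W0\<close> absorb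
  every member of \<open>rects W\<close> up to a null set, and then almost all sections of
  \<open>W\<close> and \<open>W0\<close> agree in measure, in both directions.\<close>

lemma Fubini_open:
  assumes W: "open W"
  shows "(\<integral>\<^sup>+x. emeasure \<mu> (Pair x -` W) \<partial>\<mu>) = (\<integral>\<^sup>+y. emeasure \<mu> ((\<lambda>x. (x, y)) -` W) \<partial>\<mu>)"
proof -
  let ?P = "\<mu> \<Otimes>\<^sub>M \<mu>"
  define c where "c = (SUP R\<in>rects W. emeasure ?P R)"
  \<comment> \<open>The supremum over the possibly uncountable family \<open>rects W\<close> is
    already the supremum along a sequence.\<close>
  obtain f :: "nat \<Rightarrow> ennreal" where f: "range f \<subseteq> emeasure ?P ` rects W" "c = Sup (range f)"
    using ennreal_SUP_countable_SUP[of "rects W" "emeasure ?P"] rects_empty unfolding c_def by blast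
  have "\<forall>n. \<exists>R. R \<in> rects W \<and> f n = emeasure ?P R"
    using f(1) by blast
  then obtain R where R: "\<And>n. R n \<in> rects W" "\<And>n. f n = emeasure ?P (R n)"
    by metis
  define W0 where "W0 = (\<Union>n. R n)"
  have W0: "open W0" "W0 \<subseteq> W" "W0 \<in> sets ?P"
    unfolding W0_def using rects_subset[OF R(1)] rects_sets[OF R(1)] rects_open[OF R(1)]
    by (auto simp del: sets_mu intro!: open_UN)
  have c_eq: "emeasure ?P (W0 \<union> S) \<le> c" if S: "S \<in> rects W" for S
  proof -
    have R_S: "(\<Union>i\<le>n. R i) \<union> S \<in> rects W" for n
      using R(1) S by (intro rects_Un rects_UN) auto
    have "W0 \<union> S = (\<Union>n. (\<Union>i\<le>n. R i) \<union> S)"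
      by (auto simp: W0_def)
    also have "emeasure ?P \<dots> = (SUP n. emeasure ?P ((\<Union>i\<le>n. R i) \<union> S))"
    proof (rule SUP_emeasure_incseq[symmetric])
      show "range (\<lambda>n. (\<Union>i\<le>n. R i) \<union> S) \<subseteq> sets ?P"
        using rects_sets[OF R_S] by blast
      show "incseq (\<lambda>n. (\<Union>i\<le>n. R i) \<union> S)"
        by (rule incseq_SucI) (auto simp: atMost_Suc)
    qed
    also have "\<dots> \<le> c"
      unfolding c_def by (rule SUP_least) (rule SUP_upper[OF R_S])
    finally show ?thesis .
  qed
  have c_le: "c \<le> emeasure ?P W0"
    unfolding f(2)
  proof (rule SUP_least)
    fix n
    show "f n \<le> emeasure ?P W0"
      unfolding R(2) by (rule emeasure_mono[OF _ W0(3)]) (auto simp: W0_def)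
  qed
  \<comment> \<open>Adjoining \<open>S\<close> to \<open>W0\<close> cannot raise the measure beyond
    the supremum \<open>c\<close>, which \<open>W0\<close> attains.\<close>
  have null: "AE z in ?P. z \<in> S \<longrightarrow> z \<in> W0" if S: "S \<in> rects W" for S
  proof -
    have "emeasure ?P (S - W0) = emeasure ?P (W0 \<union> S - W0)"
      by (rule arg_cong[where f="emeasure ?P"]) auto
    also have "\<dots> = emeasure ?P (W0 \<union> S) - emeasure ?P W0"
      by (rule emeasure_Diff)
        (use W0(3) rects_sets[OF S] in \<open>auto simp: mu2.P.emeasure_eq_measure simp del: sets_mu\<close>)
    also have "\<dots> = 0"
      using order_trans[OF c_eq[OF S] c_le]
      by (intro diff_eq_0_ennreal) (auto simp: mu2.P.emeasure_eq_measure)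
    finally have "S - W0 \<in> null_sets ?P"
      using W0(3) rects_sets[OF S] by auto
    from AE_not_in[OF this] show ?thesis by auto
  qed
  have 1: "AE x in \<mu>. emeasure \<mu> (Pair x -` W) = emeasure \<mu> (Pair x -` W0)"
  proof (rule AE_section_eq[OF W W0(1,2)])
    fix S assume S: "S \<in> rects W"
    show "AE x in \<mu>. emeasure \<mu> (Pair x -` S) \<le> emeasure \<mu> (Pair x -` W0)"
      using mu2.AE_pair[OF null[OF S]]
      by eventually_elim (auto intro!: emeasure_mono_AE borel_open open_Pair_vimage W0)
  qed
  have 2: "AE y in \<mu>. emeasure \<mu> (Pair y -` (prod.swap -` W)) = emeasure \<mu> (Pair y -` (prod.swap -` W0))"
  proof (rule AE_section_eq[OF open_swap[OF W] open_swap[OF W0(1)]])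
    show "prod.swap -` W0 \<subseteq> prod.swap -` W" using W0 by auto
    fix S assume S: "S \<in> rects (prod.swap -` W)"
    have "AE x in \<mu>. AE y in \<mu>. (y, x) \<in> S \<longrightarrow> (x, y) \<in> W0"
      using mu2.AE_pair[OF null[OF rects_swap[OF S]]] by simp
    \<comment> \<open>Exchanging the two almost-everywhere quantifiers asks for a set in the product
      \<sigma>-algebra; \<open>S\<close> and \<open>W0\<close> provide one.\<close>
    moreover have "{z \<in> space ?P. (snd z, fst z) \<in> S \<longrightarrow> (fst z, snd z) \<in> W0} \<in> sets ?P"
    proof -
      have "{z \<in> space ?P. (snd z, fst z) \<in> S \<longrightarrow> (fst z, snd z) \<in> W0}
          = (space ?P - prod.swap -` S) \<union> W0"
        by (auto simp: space_pair_measure)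
      then show ?thesis
        using W0(3) rects_sets[OF rects_swap[OF S]] by (simp del: sets_mu add: sets.compl_sets sets.Un)
    qed
    ultimately have "AE y in \<mu>. AE x in \<mu>. (y, x) \<in> S \<longrightarrow> (x, y) \<in> W0"
      using mu2.AE_commute[of "\<lambda>x y. (y, x) \<in> S \<longrightarrow> (x, y) \<in> W0"] by simp
    then
    show "AE y in \<mu>. emeasure \<mu> (Pair y -` S) \<le> emeasure \<mu> (Pair y -` prod.swap -` W0)"
      by eventually_elim (auto intro!: emeasure_mono_AE borel_open open_Pair_vimage open_swap W0)
  qed
  have "(\<integral>\<^sup>+x. emeasure \<mu> (Pair x -` W) \<partial>\<mu>) = (\<integral>\<^sup>+x. emeasure \<mu> (Pair x -` W0) \<partial>\<mu>)"
    by (rule nn_integral_cong_AE[OF 1])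
  also have "\<dots> = emeasure ?P W0"
    using W0(3) by (rule emeasure_pair_measure_alt[symmetric])
  also have "\<dots> = (\<integral>\<^sup>+y. emeasure \<mu> ((\<lambda>x. (x, y)) -` W0) \<partial>\<mu>)"
    using W0(3) by (rule mu2.emeasure_pair_measure_alt2)
  also have "\<dots> = (\<integral>\<^sup>+y. emeasure \<mu> ((\<lambda>x. (x, y)) -` W) \<partial>\<mu>)"
    using nn_integral_cong_AE[OF 2] unfolding swap_section by simp
  finally show ?thesis .
qed

lemma measurable_Pair_borel [measurable]:
  "Pair x \<in> measurable \<mu> (borel :: ('g \<times> 'g) measure)"
  "(\<lambda>y. (y, x)) \<in> measurable \<mu> (borel :: ('g \<times> 'g) measure)"
  by (auto simp: measurable_cong_sets[OF sets_mu refl]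
      intro!: borel_measurable_continuous_onI continuous_intros)

text \<open>\<open>kernel1\<close> and \<open>kernel2\<close> are the copies of \<mu> on the lines
  with fixed first and fixed second coordinate, as Borel measures for the product topology. Binding
  \<mu> with either of them gives a product measure on all Borel sets of the product.\<close>

definition kernel1 :: "'g \<Rightarrow> ('g \<times> 'g) measure" where
  "kernel1 x = distr \<mu> borel (Pair x)"

definition kernel2 :: "'g \<Rightarrow> ('g \<times> 'g) measure" where
  "kernel2 y = distr \<mu> borel (\<lambda>x. (x, y))"

lemma borel_prod_generator: "sets (borel :: ('g \<times> 'g) measure) = sigma_sets UNIV {W. open W}"
  by (rule sets_borel)

lemma kernel_measurable [measurable]:
  "kernel1 \<in> \<mu> \<rightarrow>\<^sub>M subprob_algebra borel"
  "kernel2 \<in> \<mu> \<rightarrow>\<^sub>M subprob_algebra borel"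
proof -
  have 1: "emeasure (kernel1 x) W = emeasure \<mu> (Pair x -` W)"
    and 2: "emeasure (kernel2 x) W = emeasure \<mu> (Pair x -` (prod.swap -` W))" if "open W" for x W
    using that by (simp_all add: kernel1_def kernel2_def emeasure_distr swap_section)
  have 3: "prob_space (kernel1 x)" "prob_space (kernel2 x)" for x
    by (auto simp: kernel1_def kernel2_def intro!: prob_space_distr)
  show "kernel1 \<in> \<mu> \<rightarrow>\<^sub>M subprob_algebra borel"
  proof (rule measurable_subprob_algebra_generated[OF borel_prod_generator])
    show "(\<lambda>x. emeasure (kernel1 x) UNIV) \<in> borel_measurable \<mu>"
      by (simp add: 1)
  qed (auto simp: Int_stable_def 1 prob_space_imp_subprob_space 3 measurable_section,
      auto simp: kernel1_def)
  show "kernel2 \<in> \<mu> \<rightarrow>\<^sub>M subprob_algebra borel"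
  proof (rule measurable_subprob_algebra_generated[OF borel_prod_generator])
    show "(\<lambda>x. emeasure (kernel2 x) UNIV) \<in> borel_measurable \<mu>"
      by (simp add: 2)
  qed (auto simp: Int_stable_def 2 prob_space_imp_subprob_space 3 measurable_section open_swap,
      auto simp: kernel2_def)
qed

text \<open>By \<open>Fubini_open\<close> the two measures agree on open sets, which are stable
  under intersection and generate the Borel sets. The exchanges of integrals below are integration
  against this one measure.\<close>

lemma bind_kernel_eq: "\<mu> \<bind> kernel1 = \<mu> \<bind> kernel2"
proof (rule measure_eqI_generator_eq[where E="{W. open W}" and \<Omega>=UNIV and A="\<lambda>_. UNIV"])
  show "sets (\<mu> \<bind> kernel1) = sigma_sets UNIV {W. open W}"
    using sets_bind[OF sets_kernel[OF kernel_measurable(1)], of \<mu>] by (simp add: sets_borel)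
  show "sets (\<mu> \<bind> kernel2) = sigma_sets UNIV {W. open W}"
    using sets_bind[OF sets_kernel[OF kernel_measurable(2)], of \<mu>] by (simp add: sets_borel)
  show "emeasure (\<mu> \<bind> kernel1) W = emeasure (\<mu> \<bind> kernel2) W" if "W \<in> {W. open W}" for W
  proof -
    have "open W" using that by simp
    then show ?thesis
      using Fubini_open[of W]
      by (simp add: emeasure_bind[OF _ kernel_measurable(1)] emeasure_bind[OF _ kernel_measurable(2)]
          kernel1_def kernel2_def emeasure_distr)
  qed
  have "emeasure (\<mu> \<bind> kernel1) UNIV = 1"
    by (simp add: emeasure_bind[OF _ kernel_measurable(1)] kernel1_def emeasure_distr)
  then show "emeasure (\<mu> \<bind> kernel1) UNIV \<noteq> \<infinity>"
    by simp
qed (auto simp: Int_stable_def)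

lemma Fubini_nn_integral:
  fixes F :: "'g \<times> 'g \<Rightarrow> ennreal"
  assumes [measurable]: "F \<in> borel_measurable borel"
  shows "(\<integral>\<^sup>+x. \<integral>\<^sup>+y. F (x, y) \<partial>\<mu> \<partial>\<mu>) = (\<integral>\<^sup>+y. \<integral>\<^sup>+x. F (x, y) \<partial>\<mu> \<partial>\<mu>)"
  using nn_integral_bind[OF assms kernel_measurable(1)] nn_integral_bind[OF assms kernel_measurable(2)]
  by (simp add: bind_kernel_eq kernel1_def kernel2_def nn_integral_distr)

lemma Fubini_AE:
  assumes [measurable]: "Measurable.pred borel (P :: 'g \<times> 'g \<Rightarrow> bool)"
  shows "(AE x in \<mu>. AE y in \<mu>. P (x, y)) \<longleftrightarrow> (AE y in \<mu>. AE x in \<mu>. P (x, y))"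
proof -
  have 1: "{z \<in> space borel. P z} \<in> sets borel" by measurable
  show ?thesis
    using AE_bind[OF kernel_measurable(1) assms] AE_bind[OF kernel_measurable(2) assms]
    unfolding bind_kernel_eq kernel1_def kernel2_def
    by (simp only: AE_distr_iff[OF measurable_Pair_borel(1) 1] AE_distr_iff[OF measurable_Pair_borel(2) 1])
qed

lemma measurable_integral_section:
  fixes F :: "'g \<times> 'g \<Rightarrow> complex"
  assumes [measurable]: "F \<in> borel_measurable borel"
  shows "(\<lambda>x. \<integral>y. F (x, y) \<partial>\<mu>) \<in> borel_measurable \<mu>"
    and "(\<lambda>y. \<integral>x. F (x, y) \<partial>\<mu>) \<in> borel_measurable \<mu>"
  using measurable_compose[OF kernel_measurable(1) integral_measurable_subprob_algebra[OF assms]]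
    measurable_compose[OF kernel_measurable(2) integral_measurable_subprob_algebra[OF assms]]
  by (simp_all add: kernel1_def kernel2_def integral_distr)

lemma measurable_nn_integral_section:
  fixes F :: "'g \<times> 'g \<Rightarrow> ennreal"
  assumes [measurable]: "F \<in> borel_measurable borel"
  shows "(\<lambda>x. \<integral>\<^sup>+y. F (x, y) \<partial>\<mu>) \<in> borel_measurable \<mu>"
    and "(\<lambda>y. \<integral>\<^sup>+x. F (x, y) \<partial>\<mu>) \<in> borel_measurable \<mu>"
  using measurable_compose[OF kernel_measurable(1) nn_integral_measurable_subprob_algebra[OF assms]]
    measurable_compose[OF kernel_measurable(2) nn_integral_measurable_subprob_algebra[OF assms]]
  by (simp_all add: kernel1_def kernel2_def nn_integral_distr)

lemma Fubini_bounded_real: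
  fixes F :: "'g \<times> 'g \<Rightarrow> real"
  assumes [measurable]: "F \<in> borel_measurable borel" and bound: "\<And>z. \<bar>F z\<bar> \<le> B"
  shows "(\<integral>x. \<integral>y. F (x, y) \<partial>\<mu> \<partial>\<mu>) = (\<integral>y. \<integral>x. F (x, y) \<partial>\<mu> \<partial>\<mu>)"
proof -
  have 1: "emeasure (kernel1 x) (space (kernel1 x)) \<le> ennreal 1"
       "emeasure (kernel2 x) (space (kernel2 x)) \<le> ennreal 1" for x
    by (simp_all add: kernel1_def kernel2_def emeasure_distr)
  show ?thesis
    using integral_bind[OF assms(1) bound kernel_measurable(1) finite_measure_axioms, of 1]
      integral_bind[OF assms(1) bound kernel_measurable(2) finite_measure_axioms, of 1] 1
    by (simp add: bind_kernel_eq) (simp add: kernel1_def kernel2_def integral_distr)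
qed

lemma Fubini_bounded:
  fixes F :: "'g \<times> 'g \<Rightarrow> complex"
  assumes [measurable]: "F \<in> borel_measurable borel" and bound: "\<And>z. cmod (F z) \<le> B"
  shows "(\<integral>x. \<integral>y. F (x, y) \<partial>\<mu> \<partial>\<mu>) = (\<integral>y. \<integral>x. F (x, y) \<partial>\<mu> \<partial>\<mu>)"
proof -
  have F_sec: "integrable \<mu> (\<lambda>y. F (x, y))" "integrable \<mu> (\<lambda>y. F (y, x))" for x
    by (rule integrable_const_bound[of _ B]; use bound in simp)+
  have norm_le: "cmod (\<integral>y. f y \<partial>\<mu>) \<le> B" if "integrable \<mu> f" "\<And>y. cmod (f y) \<le> B" for f
    using that by (intro order_trans[OF integral_norm_bound] integral_le_const) auto
  note [measurable] = measurable_integral_section[OF assms(1)]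
  have F_int: "integrable \<mu> (\<lambda>x. \<integral>y. F (x, y) \<partial>\<mu>)" "integrable \<mu> (\<lambda>x. \<integral>y. F (y, x) \<partial>\<mu>)"
    by (rule integrable_const_bound[of _ B]; use norm_le F_sec bound in simp)+
  have le: "\<bar>Re (F z)\<bar> \<le> B" "\<bar>Im (F z)\<bar> \<le> B" for z
    using bound[of z] abs_Re_le_cmod[of "F z"] abs_Im_le_cmod[of "F z"] by linarith+
  from Fubini_bounded_real[of "\<lambda>z. Re (F z)", OF _ le(1)] Fubini_bounded_real[of "\<lambda>z. Im (F z)", OF _ le(2)]
  show ?thesis
    by (intro complex_eqI) (simp_all add: F_int F_sec)
qed

end

section \<open>The Hilbert space of square integrable functions\<close>

context regular_prob_space
begin

lemma borel_measurable_mu [simp]: "borel_measurable \<mu> = borel_measurable borel"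
  by (rule measurable_cong_sets[OF sets_mu refl])

lemma L2_measurable [measurable_dest]: "f \<in> L2 \<mu> \<Longrightarrow> f \<in> borel_measurable borel"
  by (simp add: L2_def)

lemma L2_norm_square_integrable: "f \<in> L2 \<mu> \<Longrightarrow> integrable \<mu> (\<lambda>x. (cmod (f x))\<^sup>2)"
  by (simp add: L2_def)

lemma L2_mult_integrable:
  assumes "f \<in> L2 \<mu>" "g \<in> L2 \<mu>"
  shows "integrable \<mu> (\<lambda>x. f x * g x)"
proof (rule Bochner_Integration.integrable_bound)
  show "integrable \<mu> (\<lambda>x. (cmod (f x))\<^sup>2 + (cmod (g x))\<^sup>2)"
    using assms by (auto intro: L2_norm_square_integrable)
  show "(\<lambda>x. f x * g x) \<in> borel_measurable \<mu>"
    using assms by measurable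
  have "a * b \<le> a\<^sup>2 + b\<^sup>2" if "0 \<le> a" "0 \<le> b" for a b :: real
    using sum_squares_bound[of a b] mult_nonneg_nonneg[OF that] by linarith
  then show "AE x in \<mu>. norm (f x * g x) \<le> norm ((cmod (f x))\<^sup>2 + (cmod (g x))\<^sup>2)"
    by (simp add: norm_mult)
qed

lemma borel_measurable_cnj [measurable (raw)]:
  "f \<in> borel_measurable M \<Longrightarrow> (\<lambda>x. cnj (f x)) \<in> borel_measurable M"
  by (rule borel_measurable_continuous_on[OF continuous_on_cnj[OF continuous_on_id]])

lemma L2_cnj: "f \<in> L2 \<mu> \<Longrightarrow> (\<lambda>x. cnj (f x)) \<in> L2 \<mu>"
  by (simp add: L2_def borel_measurable_cnj)

lemma L2_inner_integrable:
  "f \<in> L2 \<mu> \<Longrightarrow> g \<in> L2 \<mu> \<Longrightarrow> integrable \<mu> (\<lambda>x. f x * cnj (g x))"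
  using L2_mult_integrable[OF _ L2_cnj] .

lemma L2_bounded:
  assumes "f \<in> borel_measurable borel" "\<And>x. cmod (f x) \<le> B"
  shows "f \<in> L2 \<mu>"
proof -
  have "(cmod (f x))\<^sup>2 \<le> B\<^sup>2" for x
    using assms(2)[of x] by (intro power_mono) auto
  then have "integrable \<mu> (\<lambda>x. (cmod (f x))\<^sup>2)"
    by (intro integrable_const_bound[of _ "B\<^sup>2"]) (use assms in auto)
  then show ?thesis using assms by (simp add: L2_def)
qed

lemma L2_const: "(\<lambda>x. c) \<in> L2 \<mu>"
  by (rule L2_bounded[of _ "cmod c"]) auto

lemma L2_integrable: "f \<in> L2 \<mu> \<Longrightarrow> integrable \<mu> f"
  using L2_mult_integrable[OF _ L2_const[of 1]] by simp

lemma L2_scale: "f \<in> L2 \<mu> \<Longrightarrow> (\<lambda>x. c * f x) \<in> L2 \<mu>"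
  by (auto simp: L2_def norm_mult power_mult_distrib)

lemma L2_add:
  assumes "f \<in> L2 \<mu>" "g \<in> L2 \<mu>"
  shows "(\<lambda>x. f x + g x) \<in> L2 \<mu>"
proof -
  have "integrable \<mu> (\<lambda>x. (cmod (f x + g x))\<^sup>2)"
  proof (rule Bochner_Integration.integrable_bound)
    show "integrable \<mu> (\<lambda>x. 2 * (cmod (f x))\<^sup>2 + 2 * (cmod (g x))\<^sup>2)"
      using L2_norm_square_integrable[OF assms(1)] L2_norm_square_integrable[OF assms(2)] by simp
    show "(\<lambda>x. (cmod (f x + g x))\<^sup>2) \<in> borel_measurable \<mu>"
      using assms by measurable
    have "(cmod (a + b))\<^sup>2 \<le> 2 * (cmod a)\<^sup>2 + 2 * (cmod b)\<^sup>2" for a b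
    proof -
      have "(cmod (a + b))\<^sup>2 \<le> (cmod a + cmod b)\<^sup>2"
        by (intro power_mono norm_triangle_ineq) simp
      also have "\<dots> \<le> 2 * (cmod a)\<^sup>2 + 2 * (cmod b)\<^sup>2"
        using sum_squares_bound[of "cmod a" "cmod b"] by (simp add: power2_sum)
      finally show ?thesis .
    qed
    then show "AE x in \<mu>. norm ((cmod (f x + g x))\<^sup>2) \<le> norm (2 * (cmod (f x))\<^sup>2 + 2 * (cmod (g x))\<^sup>2)"
      by simp
  qed
  moreover have "(\<lambda>x. f x + g x) \<in> borel_measurable borel"
    using assms by measurable
  ultimately show ?thesis by (simp add: L2_def)
qed

lemma L2_diff: "f \<in> L2 \<mu> \<Longrightarrow> g \<in> L2 \<mu> \<Longrightarrow> (\<lambda>x. f x - g x) \<in> L2 \<mu>"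
  using L2_add[of f "\<lambda>x. (-1) * g x"] L2_scale[of g "-1"] by simp

lemma L2_sum: "(\<And>i. i \<in> I \<Longrightarrow> f i \<in> L2 \<mu>) \<Longrightarrow> (\<lambda>x. \<Sum>i\<in>I. f i x) \<in> L2 \<mu>"
  by (induction I rule: infinite_finite_induct) (simp_all add: L2_const L2_add)

lemma L2_inner_diff:
  assumes "f \<in> L2 \<mu>" "g \<in> L2 \<mu>" "h \<in> L2 \<mu>"
  shows "L2_inner \<mu> (\<lambda>x. f x - g x) h = L2_inner \<mu> f h - L2_inner \<mu> g h"
    and "L2_inner \<mu> h (\<lambda>x. f x - g x) = L2_inner \<mu> h f - L2_inner \<mu> h g"
  using assms by (simp_all add: L2_inner_def right_diff_distrib left_diff_distrib L2_inner_integrable)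

lemma L2_inner_scale:
  "L2_inner \<mu> (\<lambda>x. c * f x) h = c * L2_inner \<mu> f h"
  "L2_inner \<mu> h (\<lambda>x. c * f x) = cnj c * L2_inner \<mu> h f"
proof -
  show "L2_inner \<mu> (\<lambda>x. c * f x) h = c * L2_inner \<mu> f h"
    by (simp add: L2_inner_def mult.assoc)
  have "(\<lambda>x. h x * cnj (c * f x)) = (\<lambda>x. cnj c * (h x * cnj (f x)))"
    by (simp add: mult_ac)
  then show "L2_inner \<mu> h (\<lambda>x. c * f x) = cnj c * L2_inner \<mu> h f"
    by (simp add: L2_inner_def)
qed

lemma L2_inner_sum:
  assumes "\<And>i. i \<in> I \<Longrightarrow> f i \<in> L2 \<mu>" "h \<in> L2 \<mu>"
  shows "L2_inner \<mu> (\<lambda>x. \<Sum>i\<in>I. f i x) h = (\<Sum>i\<in>I. L2_inner \<mu> (f i) h)"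
    and "L2_inner \<mu> h (\<lambda>x. \<Sum>i\<in>I. f i x) = (\<Sum>i\<in>I. L2_inner \<mu> h (f i))"
proof -
  have *: "integrable \<mu> (\<lambda>x. f i x * cnj (h x))" "integrable \<mu> (\<lambda>x. h x * cnj (f i x))"
    if "i \<in> I" for i
    using assms that by (auto intro: L2_inner_integrable)
  show "L2_inner \<mu> (\<lambda>x. \<Sum>i\<in>I. f i x) h = (\<Sum>i\<in>I. L2_inner \<mu> (f i) h)"
    unfolding L2_inner_def sum_distrib_right
    by (rule Bochner_Integration.integral_sum) (rule *)
  show "L2_inner \<mu> h (\<lambda>x. \<Sum>i\<in>I. f i x) = (\<Sum>i\<in>I. L2_inner \<mu> h (f i))"
    unfolding L2_inner_def cnj_sum sum_distrib_left
    by (rule Bochner_Integration.integral_sum) (rule *)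
qed

lemma L2_inner_commute: "L2_inner \<mu> g f = cnj (L2_inner \<mu> f g)"
proof -
  have "cnj (L2_inner \<mu> f g) = (\<integral>x. cnj (f x * cnj (g x)) \<partial>\<mu>)"
    unfolding L2_inner_def by (rule Bochner_Integration.integral_cnj[symmetric])
  then show ?thesis by (simp add: L2_inner_def mult.commute)
qed

lemma L2_norm_nonneg [simp]: "0 \<le> L2_norm \<mu> f"
  by (simp add: L2_norm_def)

lemma L2_norm_square: "(L2_norm \<mu> f)\<^sup>2 = (\<integral>x. (cmod (f x))\<^sup>2 \<partial>\<mu>)"
  by (simp add: L2_norm_def)

lemma L2_inner_self: "L2_inner \<mu> f f = of_real ((L2_norm \<mu> f)\<^sup>2)"
  unfolding L2_norm_square L2_inner_def
  by (simp add: complex_norm_square[symmetric] del: of_real_power)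

lemma L2_norm_cong_AE:
  assumes "f \<in> borel_measurable borel" "g \<in> borel_measurable borel" "AE x in \<mu>. f x = g x"
  shows "L2_norm \<mu> f = L2_norm \<mu> g"
  unfolding L2_norm_def by (rule arg_cong[where f=sqrt], rule integral_cong_AE) (use assms in auto)

lemma L2_inner_cong_AE:
  assumes "f \<in> borel_measurable borel" "f' \<in> borel_measurable borel"
    "g \<in> borel_measurable borel" "g' \<in> borel_measurable borel"
    "AE x in \<mu>. f x = f' x" "AE x in \<mu>. g x = g' x"
  shows "L2_inner \<mu> f g = L2_inner \<mu> f' g'"
  unfolding L2_inner_def
proof (rule integral_cong_AE)
  show "(\<lambda>x. f x * cnj (g x)) \<in> borel_measurable \<mu>" "(\<lambda>x. f' x * cnj (g' x)) \<in> borel_measurable \<mu>"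
    using assms(1-4) by measurable
  show "AE x in \<mu>. f x * cnj (g x) = f' x * cnj (g' x)"
    using assms(5,6) by eventually_elim simp
qed

lemma L2_norm_eq_0:
  assumes "f \<in> L2 \<mu>" "L2_norm \<mu> f = 0"
  shows "AE x in \<mu>. f x = 0"
proof -
  have "(\<integral>x. (cmod (f x))\<^sup>2 \<partial>\<mu>) = 0"
    using assms(2) by (metis L2_norm_square power_zero_numeral)
  then show ?thesis
    by (subst (asm) integral_nonneg_eq_0_iff_AE) (use assms(1) in \<open>auto intro: L2_norm_square_integrable\<close>)
qed

lemma L2_norm_scale: "L2_norm \<mu> (\<lambda>x. c * f x) = cmod c * L2_norm \<mu> f"
  by (simp add: L2_norm_def norm_mult power_mult_distrib real_sqrt_mult)

lemma L2_norm_diff_square: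
  assumes "f \<in> L2 \<mu>" "g \<in> L2 \<mu>"
  shows "(L2_norm \<mu> (\<lambda>x. f x - g x))\<^sup>2 = (L2_norm \<mu> f)\<^sup>2 - 2 * Re (L2_inner \<mu> f g) + (L2_norm \<mu> g)\<^sup>2"
proof -
  have "complex_of_real ((L2_norm \<mu> (\<lambda>x. f x - g x))\<^sup>2) =
      of_real ((L2_norm \<mu> f)\<^sup>2) - (L2_inner \<mu> f g + cnj (L2_inner \<mu> f g)) + of_real ((L2_norm \<mu> g)\<^sup>2)"
    unfolding L2_inner_self[symmetric]
    by (simp add: L2_inner_diff L2_diff assms L2_inner_commute[of g f])
  from arg_cong[OF this, of Re] show ?thesis by simp
qed

lemma L2_Cauchy_Schwarz:
  assumes f: "f \<in> L2 \<mu>" and g: "g \<in> L2 \<mu>"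
  shows "cmod (L2_inner \<mu> f g) \<le> L2_norm \<mu> f * L2_norm \<mu> g"
proof -
  define c where "c = L2_inner \<mu> f g"
  define F where "F = (L2_norm \<mu> f)\<^sup>2"
  define G where "G = (L2_norm \<mu> g)\<^sup>2"
  have FG: "0 \<le> F" "0 \<le> G" by (simp_all add: F_def G_def)
  \<comment> \<open>The squared norm of f - t c g for real t. The best choice is t = 1/G; if G = 0,
    a large t forces c = 0.\<close>
  have ineq: "0 \<le> F - 2 * t * (cmod c)\<^sup>2 + t\<^sup>2 * (cmod c)\<^sup>2 * G" for t :: real
  proof -
    have "0 \<le> (L2_norm \<mu> (\<lambda>x. f x - (of_real t * c) * g x))\<^sup>2" by simp
    also have "\<dots> = F - 2 * Re (cnj (of_real t * c) * c) + (cmod (of_real t * c))\<^sup>2 * G"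
      by (simp add: L2_norm_diff_square f g L2_scale L2_inner_scale L2_norm_scale F_def G_def c_def
          power_mult_distrib del: complex_cnj_mult)
    also have "cnj (of_real t * c) * c = of_real (t * (cmod c)\<^sup>2)"
      using complex_norm_square[of c] by (simp add: mult_ac)
    finally show ?thesis
      by (simp add: norm_mult power_mult_distrib)
  qed
  have "(cmod c)\<^sup>2 \<le> F * G"
  proof (cases "G = 0")
    case True
    have "(cmod c)\<^sup>2 \<le> 0"
    proof (rule ccontr)
      assume "\<not> (cmod c)\<^sup>2 \<le> 0"
      then have "(cmod c)\<^sup>2 > 0" by simp
      then show False
        using ineq[of "(F + 1) / (cmod c)\<^sup>2"] FG True by simp
    qed
    then show ?thesis using True by simp
  next
    case False
    then have "G > 0" using FG by simp
    then have "0 \<le> F - (cmod c)\<^sup>2 / G"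
      using ineq[of "1 / G"] by (simp add: power2_eq_square)
    then show ?thesis using \<open>G > 0\<close> by (simp add: field_simps)
  qed
  then have "(cmod c)\<^sup>2 \<le> (L2_norm \<mu> f * L2_norm \<mu> g)\<^sup>2"
    by (simp add: F_def G_def power_mult_distrib)
  then show ?thesis
    unfolding c_def by (rule power2_le_imp_le) simp
qed

lemma L2_norm_uminus: "L2_norm \<mu> (\<lambda>x. - f x) = L2_norm \<mu> f"
  by (simp add: L2_norm_def)

lemma L2_norm_triangle:
  assumes f: "f \<in> L2 \<mu>" and g: "g \<in> L2 \<mu>"
  shows "L2_norm \<mu> (\<lambda>x. f x - g x) \<le> L2_norm \<mu> f + L2_norm \<mu> g"
proof (rule power2_le_imp_le)
  have "- Re (L2_inner \<mu> f g) \<le> L2_norm \<mu> f * L2_norm \<mu> g"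
    using L2_Cauchy_Schwarz[OF f g] abs_Re_le_cmod[of "L2_inner \<mu> f g"] by linarith
  then show "(L2_norm \<mu> (\<lambda>x. f x - g x))\<^sup>2 \<le> (L2_norm \<mu> f + L2_norm \<mu> g)\<^sup>2"
    by (simp add: L2_norm_diff_square f g power2_sum)
qed simp

lemma L2_norm_triangle3:
  assumes "f \<in> L2 \<mu>" "g \<in> L2 \<mu>" "h \<in> L2 \<mu>"
  shows "L2_norm \<mu> (\<lambda>x. f x - h x) \<le> L2_norm \<mu> (\<lambda>x. f x - g x) + L2_norm \<mu> (\<lambda>x. g x - h x)"
  using L2_norm_triangle[OF L2_diff[OF assms(1,2)] L2_diff[OF assms(3,2)]]
    L2_norm_uminus[of "\<lambda>x. g x - h x"] by simp

lemma L2_norm_bounded: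
  assumes "f \<in> borel_measurable borel" "\<And>x. cmod (f x) \<le> B" "0 \<le> B"
  shows "L2_norm \<mu> f \<le> B"
proof -
  have "(\<integral>x. (cmod (f x))\<^sup>2 \<partial>\<mu>) \<le> B\<^sup>2"
    using assms by (intro integral_le_const L2_norm_square_integrable L2_bounded AE_I2 power_mono) auto
  then show ?thesis
    using assms(3) by (simp add: L2_norm_def real_le_lsqrt)
qed

text \<open>Cauchy-Schwarz against the constant 1, which has norm 1 as \<mu> is a probability
  measure. This is the case of Jensen's inequality that makes the class operator a
  contraction.\<close>

lemma L2_norm_integral:
  assumes "f \<in> L2 \<mu>"
  shows "(\<integral>x. cmod (f x) \<partial>\<mu>) \<le> L2_norm \<mu> f"
proof -
  have 1: "(\<lambda>x. of_real (cmod (f x))) \<in> L2 \<mu>"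
    using assms by (auto simp: L2_def)
  have "L2_inner \<mu> (\<lambda>x. of_real (cmod (f x))) (\<lambda>x. 1) = of_real (\<integral>x. cmod (f x) \<partial>\<mu>)"
    by (simp add: L2_inner_def)
  then have "\<bar>\<integral>x. cmod (f x) \<partial>\<mu>\<bar> \<le> L2_norm \<mu> (\<lambda>x. of_real (cmod (f x))) * L2_norm \<mu> (\<lambda>x. 1)"
    using L2_Cauchy_Schwarz[OF 1 L2_const[of 1]] by simp
  then show ?thesis using prob_space by (simp add: L2_norm_def)
qed

end

section \<open>Convolution of continuous functions on a compact group\<close>

locale haar_group =
  fixes \<mu> :: "'g::{topological_group_add, t2_space} measure"
  assumes compact_UNIV: "compact (UNIV :: 'g set)" and haar: "normalized_haar \<mu>"

sublocale haar_group \<subseteq> regular_prob_space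
proof
  note haar' = haar[unfolded normalized_haar_def]
  show "sets \<mu> = sets borel" using haar' by (elim conjE)
  show "emeasure \<mu> UNIV = 1" using haar' by (elim conjE)
  have *: "\<forall>U. open U \<longrightarrow> emeasure \<mu> U = (SUP K\<in>{K. compact K \<and> K \<subseteq> U}. emeasure \<mu> K)"
    using haar' by (elim conjE)
  show "emeasure \<mu> U = (SUP K\<in>{K. compact K \<and> K \<subseteq> U}. emeasure \<mu> K)" if "open U" for U
    using spec[OF *, THEN mp, OF that] .
qed

context haar_group
begin

section \<open>Invariance of Haar measure under translation and inversion\<close>

lemma measurable_translate [measurable]:
  "(\<lambda>x. a + x) \<in> measurable borel (borel :: 'g measure)"
  "uminus \<in> measurable borel (borel :: 'g measure)"
  by (auto intro!: borel_measurable_continuous_onI continuous_intros)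

lemma distr_left: "distr \<mu> borel (\<lambda>x. a + x) = \<mu>"
proof (rule measure_eqI)
  fix A assume "A \<in> sets (distr \<mu> borel (\<lambda>x. a + x))"
  then have A: "A \<in> sets borel" by simp
  have *: "(\<lambda>x. a + x) -` A = (\<lambda>x. - a + x) ` A"
  proof safe
    fix x assume "a + x \<in> A"
    then show "x \<in> (\<lambda>x. - a + x) ` A"
      by (intro image_eqI[of _ _ "a + x"]) (simp_all add: add.assoc[symmetric])
  qed (simp add: add.assoc[symmetric])
  have "emeasure (distr \<mu> borel (\<lambda>x. a + x)) A = emeasure \<mu> ((\<lambda>x. - a + x) ` A)"
    using A by (simp add: emeasure_distr *)
  also have "\<dots> = emeasure \<mu> A"
  proof -
    have "\<forall>g. \<forall>A\<in>sets borel. emeasure \<mu> ((\<lambda>x. g + x) ` A) = emeasure \<mu> A"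
      using haar[unfolded normalized_haar_def] by (elim conjE)
    then show ?thesis using A by blast
  qed
  finally show "emeasure (distr \<mu> borel (\<lambda>x. a + x)) A = emeasure \<mu> A" .
qed simp

lemma nn_integral_left:
  "f \<in> borel_measurable borel \<Longrightarrow> (\<integral>\<^sup>+x. f (a + x) \<partial>\<mu>) = (\<integral>\<^sup>+x. f x \<partial>\<mu>)"
  using nn_integral_distr[of "\<lambda>x. a + x" \<mu> borel f] by (simp add: distr_left)

text \<open>Both orders of integration of \<open>1\<^sub>A(x\<inverse> y)\<close> are computed by left invariance.\<close>

lemma distr_uminus: "distr \<mu> borel uminus = \<mu>"
proof (rule measure_eqI)
  fix A assume "A \<in> sets (distr \<mu> borel uminus)"
  then have A [measurable]: "A \<in> sets borel" by simp
  define F :: "'g \<times> 'g \<Rightarrow> ennreal" where "F z = indicator A (- fst z + snd z)" for z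
  have "(\<lambda>z. - fst z + snd z) \<in> measurable borel (borel :: 'g measure)"
    by (auto intro!: borel_measurable_continuous_onI continuous_intros)
  then have F: "F \<in> borel_measurable borel"
    unfolding F_def by measurable
  have 1: "(\<integral>\<^sup>+y. F (x, y) \<partial>\<mu>) = emeasure \<mu> A" for x
    using nn_integral_left[of "indicator A" "- x"] by (simp add: F_def)
  have 2: "(\<integral>\<^sup>+x. F (x, y) \<partial>\<mu>) = emeasure (distr \<mu> borel uminus) A" for y
  proof -
    have "(\<integral>\<^sup>+x. F (x, y) \<partial>\<mu>) = (\<integral>\<^sup>+x. F (y + x, y) \<partial>\<mu>)"
      by (rule nn_integral_left[symmetric])
        (rule measurable_compose[OF _ F], auto intro!: borel_measurable_continuous_onI continuous_intros)
    also have "\<dots> = (\<integral>\<^sup>+x. indicator A (- x) \<partial>\<mu>)"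
      by (simp add: F_def minus_add add.assoc)
    also have "\<dots> = (\<integral>\<^sup>+x. indicator A x \<partial>distr \<mu> borel uminus)"
      by (subst nn_integral_distr) auto
    finally show ?thesis by simp
  qed
  show "emeasure (distr \<mu> borel uminus) A = emeasure \<mu> A"
    using Fubini_nn_integral[OF F] by (simp add: 1 2 emeasure_space_1[simplified])
qed simp

lemma integral_translate:
  fixes f :: "'g \<Rightarrow> 'b::{banach, second_countable_topology}"
  assumes "f \<in> borel_measurable borel"
  shows "(\<integral>x. f (a + x) \<partial>\<mu>) = (\<integral>x. f x \<partial>\<mu>)"
    "(\<integral>x. f (- x) \<partial>\<mu>) = (\<integral>x. f x \<partial>\<mu>)"
  using integral_distr[of "\<lambda>x. a + x" \<mu> borel f] integral_distr[of uminus \<mu> borel f] assms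
  by (simp_all add: distr_left distr_uminus)

lemma AE_translate:
  assumes [measurable]: "Measurable.pred borel P" and AE: "AE x in \<mu>. P x"
  shows "AE x in \<mu>. P (a + x)" "AE x in \<mu>. P (- x)"
proof -
  have P: "{x \<in> space borel. P x} \<in> sets borel" by measurable
  have 1: "AE x in distr \<mu> borel (\<lambda>x. a + x). P x" "AE x in distr \<mu> borel uminus. P x"
    unfolding distr_left distr_uminus by (rule AE)+
  have 2: "(\<lambda>x. a + x) \<in> measurable \<mu> borel" "uminus \<in> measurable \<mu> (borel :: 'g measure)"
    by simp_all
  show "AE x in \<mu>. P (a + x)" "AE x in \<mu>. P (- x)"
    using 1 unfolding AE_distr_iff[OF 2(1) P] AE_distr_iff[OF 2(2) P] by this+
qed

section \<open>The convolution algebra of continuous functions\<close>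

abbreviation cont :: "('g \<Rightarrow> complex) \<Rightarrow> bool" where
  "cont f \<equiv> continuous_on UNIV f"

lemma cont_measurable [measurable_dest]: "cont f \<Longrightarrow> f \<in> borel_measurable borel"
  by (rule borel_measurable_continuous_onI)

lemma cont_bounded:
  assumes "cont f"
  obtains B where "0 < B" "\<And>x. cmod (f x) \<le> B"
proof -
  have "bounded (range f)"
    by (rule compact_imp_bounded[OF compact_continuous_image[OF assms compact_UNIV]])
  then show ?thesis using that by (auto simp: bounded_pos)
qed

lemma cont_L2: "cont f \<Longrightarrow> f \<in> L2 \<mu>"
  by (meson cont_bounded L2_bounded cont_measurable)

lemma cont_integrable: "cont f \<Longrightarrow> integrable \<mu> f"
  by (rule L2_integrable[OF cont_L2])

text \<open>The tube lemma around the compact slice over u = 0. Right displacements are the ones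
  that matter, since a convolution depends on x through \<open>g (- y + x)\<close>.\<close>

lemma uniformly_continuous_right:
  assumes f: "cont f" and e: "0 < e"
  obtains U where "open U" "0 \<in> U" "\<And>u x. u \<in> U \<Longrightarrow> cmod (f (x + u) - f x) < e"
proof -
  define W where "W = {z. cmod (f (snd z + fst z) - f (snd z)) < e}"
  have "open W"
    unfolding W_def
    by (intro open_Collect_less continuous_intros continuous_on_compose2[OF f]) auto
  moreover have "{0} \<times> UNIV \<subseteq> W" using e by (auto simp: W_def)
  ultimately obtain U where "0 \<in> U" "open U" "U \<times> UNIV \<subseteq> W"
    using Elementary_Topology.tube_lemma[OF compact_UNIV, of W 0] by auto
  then show ?thesis
    by (intro that[of U]) (auto simp: W_def subset_iff)
qed

definition conv :: "('g \<Rightarrow> complex) \<Rightarrow> ('g \<Rightarrow> complex) \<Rightarrow> 'g \<Rightarrow> complex" where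
  "conv f g = (\<lambda>x. \<integral>y. f y * g (- y + x) \<partial>\<mu>)"

definition star :: "('g \<Rightarrow> complex) \<Rightarrow> 'g \<Rightarrow> complex" where
  "star f = (\<lambda>x. cnj (f (- x)))"

lemma star_star [simp]: "star (star f) = f"
  by (simp add: star_def)

lemma cont_translate:
  assumes "cont f"
  shows "cont (\<lambda>x. f (a + x))" "cont (\<lambda>x. f (x + a))" "cont (\<lambda>x. f (- x))" "cont (\<lambda>x. f (- x + a))"
  by (intro continuous_on_compose2[OF assms] continuous_intros; simp)+

lemma cont_star [continuous_intros]: "cont f \<Longrightarrow> cont (star f)"
  unfolding star_def by (rule continuous_on_cnj[OF cont_translate(3)])

lemma conv_integrable:
  assumes "f \<in> L2 \<mu>" "cont g"
  shows "integrable \<mu> (\<lambda>y. f y * g (- y + x))"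
  by (intro L2_mult_integrable assms cont_L2 cont_translate)

text \<open>Passing from x to z multiplies \<open>- y + x\<close> on the right by
  \<open>- x + z\<close>, which is the same for all y, so one neighbourhood from
  \<open>uniformly_continuous_right\<close> bounds the whole integrand.\<close>

lemma cont_conv_L2:
  assumes f: "f \<in> L2 \<mu>" and g: "cont g"
  shows "cont (conv f g)"
proof (rule continuous_at_imp_continuous_on, rule ballI)
  fix x
  define I where "I = (\<integral>y. cmod (f y) \<partial>\<mu>)"
  have I: "0 \<le> I" by (simp add: I_def)
  have "\<exists>S. open S \<and> x \<in> S \<and> (\<forall>z\<in>S. dist (conv f g z) (conv f g x) < e)" if e: "0 < e" for e
  proof -
    \<comment> \<open>The summand 1 covers I = 0 and makes d I < e strict.\<close>
    define d where "d = e / (I + 1)"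
    have d: "0 < d" "d * I < e"
      using e I by (simp_all add: d_def field_simps)
    obtain U where U: "open U" "0 \<in> U" "\<And>u x. u \<in> U \<Longrightarrow> cmod (g (x + u) - g x) < d"
      using uniformly_continuous_right[OF g d(1)] by blast
    define S where "S = (\<lambda>z. - x + z) -` U"
    have "open S" unfolding S_def by (intro open_vimage U continuous_intros)
    moreover have "x \<in> S" using U by (simp add: S_def)
    moreover have "dist (conv f g z) (conv f g x) < e" if z: "z \<in> S" for z
    proof -
      have gz: "cmod (g (- y + z) - g (- y + x)) \<le> d" for y
      proof -
        have "- y + z = (- y + x) + (- x + z)" by (simp add: add.assoc)
        then show ?thesis using U(3)[of "- x + z" "- y + x"] z by (simp add: S_def)
      qed
      have "conv f g z - conv f g x = (\<integral>y. f y * (g (- y + z) - g (- y + x)) \<partial>\<mu>)"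
        using conv_integrable[OF f g] by (simp add: conv_def right_diff_distrib)
      also have "cmod \<dots> \<le> (\<integral>y. cmod (f y) * d \<partial>\<mu>)"
      proof (rule order_trans[OF integral_norm_bound], rule Bochner_Integration.integral_mono)
        show "integrable \<mu> (\<lambda>y. cmod (f y * (g (- y + z) - g (- y + x))))"
          using conv_integrable[OF f g] by (simp add: right_diff_distrib)
        show "integrable \<mu> (\<lambda>y. cmod (f y) * d)" using L2_integrable[OF f] by simp
      qed (simp add: norm_mult mult_left_mono gz)
      also have "\<dots> = d * I" by (simp add: I_def)
      finally show ?thesis using d by (simp add: dist_norm)
    qed
    ultimately show ?thesis by blast
  qed
  then have ex: "0 < e \<Longrightarrow> \<exists>S. open S \<and> x \<in> S \<and> (\<forall>z\<in>S. dist (conv f g z) (conv f g x) < e)" for e .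
  show "isCont (conv f g) x"
    unfolding isCont_def
  proof (rule tendstoI)
    fix e :: real assume "0 < e"
    from ex[OF this] obtain S where "open S" "x \<in> S" "\<forall>z\<in>S. dist (conv f g z) (conv f g x) < e"
      by (elim exE conjE)
    then show "\<forall>\<^sub>F z in at x. dist (conv f g z) (conv f g x) < e"
      unfolding eventually_at_topological by (intro exI[of _ S]) simp
  qed
qed

lemma cont_conv [continuous_intros]: "cont f \<Longrightarrow> cont g \<Longrightarrow> cont (conv f g)"
  by (rule cont_conv_L2[OF cont_L2])

text \<open>The integrand is continuous on G x G, hence bounded and Borel for the product topology,
  but not obviously measurable for the product \<sigma>-algebra; \<open>Fubini_bounded\<close> is
  made for this situation.\<close>

lemma conv_assoc:
  assumes f: "cont f" and g: "cont g" and h: "cont h"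
  shows "conv (conv f g) h = conv f (conv g h)"
proof
  fix x
  define F where "F z = f (fst z) * g (- fst z + snd z) * h (- snd z + x)" for z
  have F: "continuous_on UNIV F"
    unfolding F_def
    by (intro continuous_intros continuous_on_compose2[OF f] continuous_on_compose2[OF g]
        continuous_on_compose2[OF h]) auto
  then have F': "F \<in> borel_measurable borel" by (rule borel_measurable_continuous_onI)
  obtain B where B: "\<And>z. cmod (f z) \<le> B" "0 < B" using cont_bounded[OF f] by metis
  obtain C where C: "\<And>z. cmod (g z) \<le> C" "0 < C" using cont_bounded[OF g] by metis
  obtain D where D: "\<And>z. cmod (h z) \<le> D" "0 < D" using cont_bounded[OF h] by metis
  have bound: "cmod (F z) \<le> B * C * D" for z
    unfolding F_def norm_mult using B C D by (intro mult_mono) (auto simp: less_imp_le)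
  have "conv (conv f g) h x = (\<integral>y. \<integral>z. F (z, y) \<partial>\<mu> \<partial>\<mu>)"
    by (simp add: conv_def F_def)
  also have "\<dots> = (\<integral>z. \<integral>y. F (z, y) \<partial>\<mu> \<partial>\<mu>)"
    by (rule Fubini_bounded[OF F' bound, symmetric])
  also have "\<dots> = (\<integral>z. f z * (\<integral>y. g y * h (- y + (- z + x)) \<partial>\<mu>) \<partial>\<mu>)"
  proof (rule Bochner_Integration.integral_cong[OF refl])
    fix z
    have "cont (\<lambda>y. g y * h (- y + (- z + x)))"
      by (intro continuous_intros g cont_translate h)
    from integral_translate(1)[OF cont_measurable[OF this], of "- z"]
    have "(\<integral>y. g y * h (- y + (- z + x)) \<partial>\<mu>) = (\<integral>y. g (- z + y) * h (- y + x) \<partial>\<mu>)"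
      by (simp add: minus_add add.assoc)
    then show "(\<integral>y. F (z, y) \<partial>\<mu>) = f z * (\<integral>y. g y * h (- y + (- z + x)) \<partial>\<mu>)"
      by (simp add: F_def mult.assoc)
  qed
  finally show "conv (conv f g) h x = conv f (conv g h) x"
    by (simp add: conv_def)
qed

lemma star_conv:
  assumes f: "cont f" and g: "cont g"
  shows "star (conv f g) = conv (star g) (star f)"
proof
  fix x
  have "cont (\<lambda>y. cnj (g (- y)) * cnj (f (- x + y)))"
    by (intro continuous_intros cont_translate f g)
  from integral_translate(1)[OF cont_measurable[OF this], of x]
  have "(\<integral>y. cnj (g (- y)) * cnj (f (- x + y)) \<partial>\<mu>) = (\<integral>y. cnj (f y * g (- y + - x)) \<partial>\<mu>)"
    by (simp add: minus_add add.assoc[symmetric] mult.commute)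
  also have "\<dots> = cnj (\<integral>y. f y * g (- y + - x) \<partial>\<mu>)"
    by (rule Bochner_Integration.integral_cnj)
  finally show "star (conv f g) x = conv (star g) (star f) x"
    by (simp add: star_def conv_def minus_add)
qed

lemma conv_add:
  assumes "cont f" "cont g" "cont h"
  shows "conv (\<lambda>x. f x + g x) h = (\<lambda>x. conv f h x + conv g h x)"
    "conv h (\<lambda>x. f x + g x) = (\<lambda>x. conv h f x + conv h g x)"
  using assms by (simp_all add: conv_def distrib_left distrib_right conv_integrable cont_L2)

lemma conv_diff:
  assumes "cont f" "cont g" "cont h"
  shows "conv (\<lambda>x. f x - g x) h = (\<lambda>x. conv f h x - conv g h x)"
    "conv h (\<lambda>x. f x - g x) = (\<lambda>x. conv h f x - conv h g x)"
  using assms by (simp_all add: conv_def left_diff_distrib right_diff_distrib conv_integrable cont_L2)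

lemma conv_scale:
  "conv (\<lambda>x. c * f x) h = (\<lambda>x. c * conv f h x)"
  "conv h (\<lambda>x. c * f x) = (\<lambda>x. c * conv h f x)"
  by (simp_all add: conv_def mult.assoc mult.left_commute[of _ c])

text \<open>Evaluation at the identity acts as a trace on the convolution algebra, and inner
  products are traces. The adjoints of left and right convolution then follow from associativity and
  \<open>conv_trace\<close>.\<close>

lemma conv_star_0: "conv f (star g) 0 = L2_inner \<mu> f g"
  by (simp add: conv_def star_def L2_inner_def)

lemma conv_trace:
  assumes "cont f" "cont g"
  shows "conv f g 0 = conv g f 0"
proof -
  have "cont (\<lambda>y. g y * f (- y))"
    by (intro continuous_intros cont_translate assms)
  from integral_translate(2)[OF cont_measurable[OF this]] show ?thesis
    by (simp add: conv_def mult.commute)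
qed

lemma L2_inner_conv_right:
  assumes "cont f" "cont g" "cont h"
  shows "L2_inner \<mu> (conv f g) h = L2_inner \<mu> f (conv h (star g))"
  using assms by (simp add: conv_star_0[symmetric] conv_assoc star_conv cont_star cont_conv)

lemma L2_inner_conv_left:
  assumes "cont f" "cont g" "cont h"
  shows "L2_inner \<mu> (conv f g) h = L2_inner \<mu> g (conv (star f) h)"
proof -
  have "L2_inner \<mu> (conv f g) h = conv f (conv g (star h)) 0"
    using assms by (simp add: conv_star_0[symmetric] conv_assoc cont_star)
  also have "\<dots> = conv (conv g (star h)) f 0"
    using assms by (intro conv_trace cont_star cont_conv)
  also have "\<dots> = L2_inner \<mu> g (conv (star f) h)"
    using assms by (simp add: conv_star_0[symmetric] conv_assoc star_conv cont_star)
  finally show ?thesis .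
qed

lemma L2_norm_star: "cont f \<Longrightarrow> L2_norm \<mu> (star f) = L2_norm \<mu> f"
  using integral_translate(2)[of "\<lambda>x. (cmod (f x))\<^sup>2"] cont_measurable[of f]
  by (simp add: L2_norm_def star_def)

lemma L2_norm_translate:
  assumes [measurable]: "f \<in> borel_measurable borel"
  shows "L2_norm \<mu> (\<lambda>x. f (a + x)) = L2_norm \<mu> f"
  using integral_translate(1)[of "\<lambda>x. (cmod (f x))\<^sup>2" a] by (simp add: L2_norm_def)

lemma L2_norm_reflect:
  assumes g: "cont g"
  shows "L2_norm \<mu> (\<lambda>y. cnj (g (- y + x))) = L2_norm \<mu> g"
proof -
  have "(\<lambda>y. cnj (g (- y + x))) = (\<lambda>y. star g (- x + y))"
    by (simp add: star_def minus_add)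
  then show ?thesis
    using L2_norm_translate[OF cont_measurable[OF cont_star[OF g]], of "- x"] L2_norm_star[OF g] by simp
qed

text \<open>Pointwise Cauchy-Schwarz; reflection and translation leave the norm of g unchanged. It
  turns L2 estimates into uniform ones after one convolution.\<close>

lemma conv_bound:
  assumes f: "f \<in> L2 \<mu>" and g: "cont g"
  shows "cmod (conv f g x) \<le> L2_norm \<mu> f * L2_norm \<mu> g"
proof -
  have 1: "(\<lambda>y. cnj (g (- y + x))) \<in> L2 \<mu>"
    by (intro L2_cnj cont_L2 cont_translate g)
  have "conv f g x = L2_inner \<mu> f (\<lambda>y. cnj (g (- y + x)))"
    by (simp add: conv_def L2_inner_def)
  then show ?thesis using L2_Cauchy_Schwarz[OF f 1] by (simp add: L2_norm_reflect[OF g])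
qed

lemma L2_norm_conv:
  assumes f: "f \<in> L2 \<mu>" and g: "cont g"
  shows "L2_norm \<mu> (conv f g) \<le> L2_norm \<mu> f * L2_norm \<mu> g"
  using conv_bound[OF f g] cont_conv_L2[OF f g]
  by (intro L2_norm_bounded cont_measurable) auto

end

section \<open>Normalized convolution powers and the top idempotent\<close>

text \<open>Meant for \<open>A n\<close>, the squared norm of the (n+1)-st power of r, which
  explains the shift of indices. Log-convexity makes the ratios \<open>\<rho>\<close> increase,
  submultiplicativity bounds them, and \<Lambda> is their limit. Division by
  \<open>\<Lambda> ^ Suc n\<close> gives a decreasing sequence; submultiplicativity keeps it above
  1, so that the idempotent built from it cannot vanish.\<close>

lemma log_convex_growth:
  fixes A :: "nat \<Rightarrow> real"
  assumes pos: "\<And>n. 0 < A n"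
    and log_convex: "\<And>n. (A (Suc n))\<^sup>2 \<le> A n * A (Suc (Suc n))"
    and submult: "\<And>m n. A (Suc (m + n)) \<le> A m * A n"
  obtains \<Lambda> L where "0 < \<Lambda>" "1 \<le> L" "A 1 \<le> \<Lambda> * A 0" "(\<lambda>n. A n / \<Lambda> ^ Suc n) \<longlonglongrightarrow> L"
proof -
  define \<rho> where "\<rho> n = A (Suc n) / A n" for n
  have \<rho>_pos: "0 < \<rho> n" for n using pos by (simp add: \<rho>_def)
  have A_Suc: "A (Suc n) = \<rho> n * A n" for n using pos[of n] by (simp add: \<rho>_def)
  have inc: "incseq \<rho>"
  proof (rule incseq_SucI)
    fix n show "\<rho> n \<le> \<rho> (Suc n)"
      using log_convex[of n] pos[of n] pos[of "Suc n"]
      by (simp add: \<rho>_def divide_simps power2_eq_square mult.commute)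
  qed
  have "\<rho> n \<le> A 0" for n
    using submult[of 0 n] pos[of n] by (simp add: \<rho>_def divide_simps)
  then obtain \<Lambda> where \<Lambda>: "\<rho> \<longlonglongrightarrow> \<Lambda>" "\<And>n. \<rho> n \<le> \<Lambda>"
    using incseq_convergent[OF inc, of "A 0"] by blast
  have \<Lambda>_pos: "0 < \<Lambda>" using \<rho>_pos[of 0] \<Lambda>(2)[of 0] by simp
  define B where "B n = A n / \<Lambda> ^ Suc n" for n
  have B_dec: "decseq B"
  proof (rule decseq_SucI)
    fix n
    have "A (Suc n) \<le> \<Lambda> * A n" unfolding A_Suc using \<Lambda>(2) pos[of n] by simp
    then show "B (Suc n) \<le> B n"
      using \<Lambda>_pos by (simp add: B_def divide_simps mult_ac)
  qed
  \<comment> \<open>As the ratios increase, \<open>\<rho> m ^ Suc n * A m\<close> is at most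
    \<open>A (m + Suc n)\<close>, hence at most \<open>A m * A n\<close>. Cancel \<open>A m\<close>
    and let m grow.\<close>
  have "\<Lambda> ^ Suc n \<le> A n" for n
  proof (rule LIMSEQ_le_const2)
    show "(\<lambda>m. \<rho> m ^ Suc n) \<longlonglongrightarrow> \<Lambda> ^ Suc n" by (intro tendsto_power \<Lambda>)
    have "\<rho> m ^ k * A m \<le> A (m + k)" for m k
    proof (induction k)
      case (Suc k)
      have "\<rho> m ^ Suc k * A m = \<rho> m * (\<rho> m ^ k * A m)" by simp
      also have "\<dots> \<le> \<rho> (m + k) * A (m + k)"
        using Suc \<rho>_pos[of m] pos[of m] incseqD[OF inc, of m "m + k"]
        by (intro mult_mono) (auto simp: less_imp_le)
      finally show ?case by (simp add: A_Suc)
    qed simp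
    from this[of _ "Suc n"] have "\<rho> m ^ Suc n * A m \<le> A m * A n" for m
      using submult[of m n] by (metis add_Suc_right order_trans)
    then have "\<rho> m ^ Suc n \<le> A n" for m
      using mult_le_cancel_left_pos[OF pos[of m], of "\<rho> m ^ Suc n" "A n"] by (simp only: mult.commute)
    then show "\<exists>N. \<forall>m\<ge>N. \<rho> m ^ Suc n \<le> A n" by simp
  qed
  then have B_ge: "1 \<le> B n" for n
    using \<Lambda>_pos by (simp add: B_def)
  obtain L where L: "B \<longlonglongrightarrow> L"
    using decseq_convergent[OF B_dec, of 1] B_ge by metis
  have "1 \<le> L" by (rule LIMSEQ_le_const[OF L]) (use B_ge in auto)
  moreover have "A 1 \<le> \<Lambda> * A 0"
    using A_Suc[of 0] \<Lambda>(2)[of 0] pos[of 0] by simp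
  ultimately show ?thesis
    using that[of \<Lambda> L] \<Lambda>_pos L by (simp add: B_def[abs_def])
qed

context haar_group
begin

text \<open>Finitely many translates of a nonempty open set cover the compact group, so it cannot be
  null. Consequently L2 equality of continuous functions is pointwise equality.\<close>

lemma emeasure_open_pos:
  assumes "open U" "x0 \<in> U"
  shows "emeasure \<mu> U \<noteq> 0"
proof
  assume zero: "emeasure \<mu> U = 0"
  define V where "V g = (\<lambda>x. g + x) -` U" for g
  have V_open: "open (V g)" for g
    unfolding V_def by (rule open_vimage[OF assms(1)]) (intro continuous_intros)
  have cover: "UNIV \<subseteq> (\<Union>g\<in>UNIV. V g)"
  proof
    fix x :: 'g
    have "x \<in> V (x0 - x)" using assms(2) by (simp add: V_def)
    then show "x \<in> (\<Union>g\<in>UNIV. V g)" by (rule UN_I[OF UNIV_I])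
  qed
  obtain D where D: "D \<subseteq> UNIV" "finite D" "UNIV \<subseteq> (\<Union>g\<in>D. V g)"
    by (rule compactE_image[OF compact_UNIV V_open cover])
  have V_null: "emeasure \<mu> (V g) = 0" for g
  proof -
    have "emeasure \<mu> (V g) = emeasure (distr \<mu> borel (\<lambda>x. g + x)) U"
      using assms(1) by (subst emeasure_distr) (auto simp: V_def)
    then show ?thesis by (simp add: distr_left zero)
  qed
  have "1 = emeasure \<mu> (\<Union>g\<in>D. V g)"
    using D(3) by (simp add: top.extremum_unique)
  also have "\<dots> \<le> (\<Sum>g\<in>D. emeasure \<mu> (V g))"
    using D(2) V_open by (intro emeasure_subadditive_finite) (auto intro: borel_open)
  finally show False by (simp add: V_null)
qed

lemma cont_eq_0:
  assumes f: "cont f" and "L2_norm \<mu> f = 0"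
  shows "f = (\<lambda>x. 0)"
proof (rule ccontr)
  assume "f \<noteq> (\<lambda>x. 0)"
  then obtain x where x: "f x \<noteq> 0" by (auto simp: fun_eq_iff)
  have "open {x. f x \<noteq> 0}"
    by (intro open_Collect_neq f continuous_intros)
  moreover have "emeasure \<mu> {x. f x \<noteq> 0} = 0"
    using L2_norm_eq_0[OF cont_L2[OF f] assms(2)] cont_measurable[OF f]
    by (subst (asm) AE_iff_measurable[of "{x. f x \<noteq> 0}"]) auto
  ultimately show False using emeasure_open_pos x by blast
qed

lemma uniform_limit_L2_norm:
  assumes lim: "uniform_limit UNIV F f sequentially"
    and F: "\<And>n. cont (F n)" and f: "cont f"
  shows "(\<lambda>n. L2_norm \<mu> (\<lambda>x. F n x - f x)) \<longlonglongrightarrow> 0"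
proof (rule tendstoI)
  fix e :: real assume e: "0 < e"
  then have "\<forall>\<^sub>F n in sequentially. \<forall>x\<in>UNIV. dist (F n x) (f x) < e / 2"
    by (intro uniform_limitD[OF lim]) simp
  then show "\<forall>\<^sub>F n in sequentially. dist (L2_norm \<mu> (\<lambda>x. F n x - f x)) 0 < e"
  proof eventually_elim
    case (elim n)
    have "L2_norm \<mu> (\<lambda>x. F n x - f x) \<le> e / 2"
      using elim e by (intro L2_norm_bounded cont_measurable continuous_on_diff F f)
        (auto simp: dist_norm less_imp_le)
    then show ?case using e by simp
  qed
qed

lemma conv_tendsto:
  assumes f_lim: "uniform_limit UNIV F f sequentially" and F: "\<And>n. cont (F n)" and f: "cont f"
    and g_lim: "uniform_limit UNIV G g sequentially" and G: "\<And>n. cont (G n)" and g: "cont g"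
  shows "(\<lambda>n. conv (F n) (G n) x) \<longlonglongrightarrow> conv f g x"
proof (rule Lim_transform2)
  have F_lim: "(\<lambda>n. conv (F n) g x) \<longlonglongrightarrow> conv f g x"
  proof (rule Lim_null_comparison[THEN LIM_zero_cancel])
    show "(\<lambda>n. L2_norm \<mu> (\<lambda>x. F n x - f x) * L2_norm \<mu> g) \<longlonglongrightarrow> 0"
      using tendsto_mult_right[OF uniform_limit_L2_norm[OF f_lim F f]] by simp
    show "\<forall>\<^sub>F n in sequentially. norm (conv (F n) g x - conv f g x) \<le> L2_norm \<mu> (\<lambda>x. F n x - f x) * L2_norm \<mu> g"
      using conv_bound[OF L2_diff[OF cont_L2[OF F] cont_L2[OF f]] g, of _ x] conv_diff(1)[OF F f g] by simp
  qed
  then show "(\<lambda>n. conv (F n) g x) \<longlonglongrightarrow> conv f g x" .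
  have norm_F: "L2_norm \<mu> (F n) \<le> L2_norm \<mu> (\<lambda>x. F n x - f x) + L2_norm \<mu> f" for n
    using L2_norm_triangle3[of "F n" f "\<lambda>x. 0"] L2_const[of 0] cont_L2[OF F] cont_L2[OF f] by simp
  show "(\<lambda>n. conv (F n) g x - conv (F n) (G n) x) \<longlonglongrightarrow> 0"
  proof (rule Lim_null_comparison)
    show "(\<lambda>n. (L2_norm \<mu> (\<lambda>x. F n x - f x) + L2_norm \<mu> f) * L2_norm \<mu> (\<lambda>x. G n x - g x)) \<longlonglongrightarrow> 0"
      using tendsto_mult[OF tendsto_add[OF uniform_limit_L2_norm[OF f_lim F f] tendsto_const]
          uniform_limit_L2_norm[OF g_lim G g]] by simp
    have "norm (conv (F n) g x - conv (F n) (G n) x)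
      \<le> (L2_norm \<mu> (\<lambda>x. F n x - f x) + L2_norm \<mu> f) * L2_norm \<mu> (\<lambda>x. G n x - g x)" for n
    proof -
      have "norm (conv (F n) g x - conv (F n) (G n) x) = norm (conv (F n) (\<lambda>x. G n x - g x) x)"
        by (simp add: conv_diff(2)[OF G g F] norm_minus_commute)
      also have "\<dots> \<le> L2_norm \<mu> (F n) * L2_norm \<mu> (\<lambda>x. G n x - g x)"
        by (intro conv_bound cont_L2 F G g continuous_on_diff)
      also have "\<dots> \<le> (L2_norm \<mu> (\<lambda>x. F n x - f x) + L2_norm \<mu> f) * L2_norm \<mu> (\<lambda>x. G n x - g x)"
        by (intro mult_right_mono norm_F) simp
      finally show ?thesis .
    qed
    then show "\<forall>\<^sub>F n in sequentially. norm (conv (F n) g x - conv (F n) (G n) x)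
      \<le> (L2_norm \<mu> (\<lambda>x. F n x - f x) + L2_norm \<mu> f) * L2_norm \<mu> (\<lambda>x. G n x - g x)" by simp
  qed
qed

text \<open>\<open>conv_power r n\<close> is the convolution power \<open>r\<^sup>n\<^sup>+\<^sup>1\<close>.\<close>

primrec conv_power :: "('g \<Rightarrow> complex) \<Rightarrow> nat \<Rightarrow> 'g \<Rightarrow> complex" where
  "conv_power r 0 = r"
| "conv_power r (Suc n) = conv r (conv_power r n)"

lemma cont_conv_power: "cont r \<Longrightarrow> cont (conv_power r n)"
  by (induction n) (simp_all add: cont_conv)

lemma conv_power_add:
  assumes "cont r"
  shows "conv (conv_power r m) (conv_power r n) = conv_power r (Suc (m + n))"
  by (induction m) (simp_all add: conv_assoc cont_conv_power assms)

lemma star_conv_power: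
  assumes "cont r" "star r = r"
  shows "star (conv_power r n) = conv_power r n"
proof (induction n)
  case (Suc n)
  have "star (conv_power r (Suc n)) = conv (conv_power r n) (conv_power r 0)"
    using Suc assms by (simp add: star_conv cont_conv_power)
  then show ?case using conv_power_add[OF assms(1), of n 0] by simp
qed (use assms in simp)

text \<open>In spectral terms p is the projection onto the eigenspace of r * r for its largest
  eigenvalue \<Lambda>: powers of r * r divided by powers of \<Lambda> suppress all smaller
  eigenvalues. Even powers are taken because r may have both square roots of \<Lambda> as
  eigenvalues. Convergence is read off from one numerical sequence, since all inner products of
  powers are values of powers at the identity.\<close>

lemma top_idempotent:
  assumes r: "cont r" "star r = r" and nz: "L2_norm \<mu> r \<noteq> 0"
  obtains p \<Lambda> where "0 < \<Lambda>" "cont p" "star p = p" "conv p p = p"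
    "conv (conv r r) p = (\<lambda>x. of_real \<Lambda> * p x)" "1 \<le> L2_norm \<mu> p"
    "(L2_norm \<mu> (conv r r))\<^sup>2 \<le> \<Lambda> * (L2_norm \<mu> r)\<^sup>2"
proof -
  define k where "k = conv_power r"
  have k_cont [simp]: "cont (k n)" for n unfolding k_def by (rule cont_conv_power[OF r(1)])
  have k_add: "conv (k m) (k n) = k (Suc (m + n))" for m n
    unfolding k_def by (rule conv_power_add[OF r(1)])
  have k_star: "star (k n) = k n" for n unfolding k_def by (rule star_conv_power[OF r])
  have k_inner: "L2_inner \<mu> (k m) (k n) = k (Suc (m + n)) 0" for m n
    using conv_star_0[of "k m" "k n"] by (simp add: k_star k_add)
  define A where "A n = (L2_norm \<mu> (k n))\<^sup>2" for n
  have A_eq: "k (Suc (2 * n)) 0 = of_real (A n)" for n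
    using k_inner[of n n] L2_inner_self[of "k n"] by (simp add: A_def mult_2)
  have A_pos: "0 < A n" for n
  proof (induction n)
    case 0
    then show ?case using nz by (simp add: A_def k_def)
  next
    case (Suc n)
    show ?case
    proof (rule ccontr)
      \<comment> \<open>If the power \<open>k (Suc n)\<close> vanished, so would
        \<open>k (Suc (2 * n))\<close>, whose value at the identity is \<open>A n\<close>. For n = 0
        the two powers coincide.\<close>
      assume "\<not> 0 < A (Suc n)"
      then have "k (Suc n) = (\<lambda>x. 0)"
        by (intro cont_eq_0) (auto simp: A_def)
      moreover have "conv f (\<lambda>x. 0) = (\<lambda>x. 0)" "conv (\<lambda>x. 0) f = (\<lambda>x. 0)" for f
        by (simp_all add: conv_def)
      ultimately have "k (Suc (2 * n)) = (\<lambda>x. 0)"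
        using k_add[of "Suc n" "n - 1"] by (cases n) (simp_all add: mult_2)
      then show False using A_eq[of n] Suc by (simp add: fun_eq_iff)
    qed
  qed
  \<comment> \<open>The number \<open>A (Suc n)\<close> also arises from the uneven splitting into
    \<open>k n\<close> and \<open>k (Suc (Suc n))\<close>; Cauchy-Schwarz for that splitting is
    log-convexity.\<close>
  have logc: "(A (Suc n))\<^sup>2 \<le> A n * A (Suc (Suc n))" for n
  proof -
    have "A (Suc n) = cmod (L2_inner \<mu> (k n) (k (Suc (Suc n))))"
      using A_eq[of "Suc n"] A_pos[of "Suc n"] by (simp add: k_inner mult_2)
    also have "\<dots> \<le> L2_norm \<mu> (k n) * L2_norm \<mu> (k (Suc (Suc n)))"
      by (intro L2_Cauchy_Schwarz cont_L2 k_cont)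
    finally have "(A (Suc n))\<^sup>2 \<le> (L2_norm \<mu> (k n) * L2_norm \<mu> (k (Suc (Suc n))))\<^sup>2"
      using A_pos[of "Suc n"] by (intro power_mono) auto
    then show ?thesis by (simp add: A_def power_mult_distrib)
  qed
  have subm: "A (Suc (m + n)) \<le> A m * A n" for m n
    using power_mono[OF L2_norm_conv[OF cont_L2[OF k_cont[of m]] k_cont[of n]], of 2]
    by (simp add: A_def k_add power_mult_distrib)
  obtain \<Lambda> L where \<Lambda>: "0 < \<Lambda>" "1 \<le> L" "A 1 \<le> \<Lambda> * A 0" "(\<lambda>n. A n / \<Lambda> ^ Suc n) \<longlonglongrightarrow> L"
    using log_convex_growth[OF A_pos logc subm] by metis
  define B where "B n = A n / \<Lambda> ^ Suc n" for n
  have B_lim: "B \<longlonglongrightarrow> L" using \<Lambda>(4) by (simp add: B_def[abs_def])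
  define w where "w n = (\<lambda>x. of_real (1 / \<Lambda> ^ Suc n) * k (Suc (2 * n)) x)" for n
  have w_cont: "cont (w n)" for n unfolding w_def by (intro continuous_intros k_cont)
  \<comment> \<open>Only m + n enters, so convergence of \<open>B\<close> makes the
    \<open>w n\<close> a Cauchy sequence in L2.\<close>
  have w_inner: "L2_inner \<mu> (w m) (w n) = of_real (B (Suc (m + n)))" for m n
  proof -
    have "Suc (Suc (2 * m) + Suc (2 * n)) = Suc (2 * Suc (m + n))" by simp
    then have "L2_inner \<mu> (k (Suc (2 * m))) (k (Suc (2 * n))) = of_real (A (Suc (m + n)))"
      by (simp only: k_inner A_eq)
    then show ?thesis
      unfolding w_def L2_inner_scale by (simp add: B_def power_add)
  qed
  have w_diff: "(L2_norm \<mu> (\<lambda>x. w m x - w n x))\<^sup>2 = B (Suc (m + m)) - 2 * B (Suc (m + n)) + B (Suc (n + n))" for m n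
  proof -
    have *: "(L2_norm \<mu> (w n))\<^sup>2 = B (Suc (n + n))" for n
      using L2_inner_self[of "w n"] w_inner[of n n] by (metis of_real_eq_iff)
    show ?thesis
      by (simp add: L2_norm_diff_square cont_L2 w_cont w_inner *)
  qed
  have w_Suc: "w (Suc n) = (\<lambda>x. of_real (1 / \<Lambda>) * conv (k 1) (w n) x)" for n
  proof -
    have "conv (k 1) (k (Suc (2 * n))) = k (Suc (2 * Suc n))"
      using k_add[of 1 "Suc (2 * n)"] by simp
    then show ?thesis unfolding w_def conv_scale by (simp add: mult.assoc)
  qed
  have L2_small: "\<exists>N. \<forall>m\<ge>N. \<forall>n\<ge>N. L2_norm \<mu> (\<lambda>x. w m x - w n x) < e" if e: "0 < e" for e
  proof -
    \<comment> \<open>The three terms in \<open>w_diff\<close> have weights 1, 2 and 1, hence the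
      factor 4.\<close>
    have "0 < e\<^sup>2 / 4" using e by simp
    then obtain N where N: "\<And>n. n \<ge> N \<Longrightarrow> \<bar>B n - L\<bar> < e\<^sup>2 / 4"
      using B_lim unfolding LIMSEQ_iff real_norm_def by metis
    have "L2_norm \<mu> (\<lambda>x. w m x - w n x) < e" if "m \<ge> N" "n \<ge> N" for m n
    proof (rule power2_less_imp_less)
      have "\<bar>B (Suc (m + m)) - L\<bar> < e\<^sup>2 / 4" "\<bar>B (Suc (m + n)) - L\<bar> < e\<^sup>2 / 4" "\<bar>B (Suc (n + n)) - L\<bar> < e\<^sup>2 / 4"
        using that by (intro N; simp)+
      then show "(L2_norm \<mu> (\<lambda>x. w m x - w n x))\<^sup>2 < e\<^sup>2"
        unfolding w_diff by linarith
    qed (use e in simp)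
    then show ?thesis by blast
  qed
  \<comment> \<open>One more convolution with \<open>k 1\<close> turns the L2 Cauchy property into a
    uniform one at the cost of this factor; the summand 1 ensures M > 0.\<close>
  define M where "M = L2_norm \<mu> (k 1) / \<Lambda> + 1"
  have M: "0 < M" using \<Lambda>(1) by (simp add: M_def add_nonneg_pos)
  have w_sup: "cmod (w (Suc m) x - w (Suc n) x) \<le> M * L2_norm \<mu> (\<lambda>x. w m x - w n x)" for m n x
  proof -
    have "w (Suc m) x - w (Suc n) x = of_real (1 / \<Lambda>) * conv (k 1) (\<lambda>x. w m x - w n x) x"
      by (simp add: w_Suc conv_diff(2)[OF w_cont w_cont k_cont] right_diff_distrib[symmetric] diff_divide_distrib)
    also have "cmod \<dots> \<le> (1 / \<Lambda>) * (L2_norm \<mu> (k 1) * L2_norm \<mu> (\<lambda>x. w m x - w n x))"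
      unfolding norm_mult using \<Lambda>(1)
      by (intro mult_mono conv_bound cont_L2 k_cont continuous_on_diff w_cont) (auto simp: norm_divide)
    also have "\<dots> \<le> M * L2_norm \<mu> (\<lambda>x. w m x - w n x)"
      by (simp add: M_def distrib_right)
    finally show ?thesis .
  qed
  have "uniformly_Cauchy_on UNIV w"
  proof (rule uniformly_Cauchy_onI)
    fix e :: real assume e: "0 < e"
    obtain N where N: "\<And>m n. m \<ge> N \<Longrightarrow> n \<ge> N \<Longrightarrow> L2_norm \<mu> (\<lambda>x. w m x - w n x) < e / M"
      using L2_small[of "e / M"] e M by auto
    have "dist (w m x) (w n x) < e" if mn: "m \<ge> Suc N" "n \<ge> Suc N" for m n x
    proof -
      obtain m' n' where mn': "m = Suc m'" "n = Suc n'" "m' \<ge> N" "n' \<ge> N"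
        using mn that[of "m - 1" "n - 1"] by simp
      then have "cmod (w m x - w n x) \<le> M * L2_norm \<mu> (\<lambda>x. w m' x - w n' x)"
        using w_sup by simp
      also have "\<dots> < M * (e / M)"
        using N[of m' n'] mn' M by (intro mult_strict_left_mono) auto
      finally show ?thesis using M by (simp add: dist_norm)
    qed
    then show "\<exists>M. \<forall>x\<in>UNIV. \<forall>m\<ge>M. \<forall>n\<ge>M. dist (w m x) (w n x) < e" by blast
  qed
  then obtain p where p_lim: "uniform_limit UNIV w p sequentially"
    using Cauchy_uniformly_convergent[of UNIV w] unfolding uniformly_convergent_on_def by blast
  have p_cont: "cont p"
    by (rule uniform_limit_theorem[OF _ p_lim]) (auto intro: always_eventually w_cont)
  have p_pt: "(\<lambda>n. w n x) \<longlonglongrightarrow> p x" for x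
    by (rule tendsto_uniform_limitI[OF p_lim]) simp
  have p_star: "star p = p"
  proof
    fix x
    have "(\<lambda>n. star (w n) x) \<longlonglongrightarrow> star p x"
      unfolding star_def by (intro tendsto_intros p_pt)
    moreover have "star (w n) = w n" for n
    proof
      fix x
      have "star (k (Suc (2 * n))) x = k (Suc (2 * n)) x" by (simp only: k_star)
      then show "star (w n) x = w n x" by (simp add: w_def star_def)
    qed
    ultimately have "(\<lambda>n. w n x) \<longlonglongrightarrow> star p x" by simp
    then show "star p x = p x" by (rule LIMSEQ_unique[OF _ p_pt])
  qed
  have p_idem: "conv p p = p"
  proof
    fix x
    have "conv (w n) (w n) = w (Suc (2 * n))" for n
    proof -
      have "conv (k (Suc (2 * n))) (k (Suc (2 * n))) = k (Suc (2 * Suc (2 * n)))"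
        by (simp add: k_add)
      moreover have "complex_of_real (1 / \<Lambda> ^ Suc n) * of_real (1 / \<Lambda> ^ Suc n) = of_real (1 / \<Lambda> ^ Suc (Suc (2 * n)))"
        unfolding of_real_mult[symmetric] by (simp add: power_add[symmetric] mult_2)
      ultimately show ?thesis unfolding w_def conv_scale
        by (simp only: mult.assoc[symmetric])
    qed
    then have "(\<lambda>n. w (Suc (2 * n)) x) \<longlonglongrightarrow> conv p p x"
      using conv_tendsto[OF p_lim w_cont p_cont p_lim w_cont p_cont, of x] by simp
    moreover have "(\<lambda>n. w (Suc (2 * n)) x) \<longlonglongrightarrow> p x"
      using LIMSEQ_subseq_LIMSEQ[OF p_pt[of x], of "\<lambda>n. Suc (2 * n)"]
      by (simp add: strict_mono_def o_def)
    ultimately show "conv p p x = p x" by (rule LIMSEQ_unique)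
  qed
  have p_eig: "conv (k 1) p = (\<lambda>x. of_real \<Lambda> * p x)"
  proof
    fix x
    have "(\<lambda>n. conv (k 1) (w n) x) \<longlonglongrightarrow> conv (k 1) p x"
      by (rule conv_tendsto[OF uniform_limit_const k_cont k_cont p_lim w_cont p_cont])
    moreover have "(\<lambda>n. of_real \<Lambda> * w (Suc n) x) \<longlonglongrightarrow> of_real \<Lambda> * p x"
      by (intro tendsto_mult_left LIMSEQ_Suc p_pt)
    moreover have "of_real \<Lambda> * w (Suc n) x = conv (k 1) (w n) x" for n
      using \<Lambda>(1) by (simp add: w_Suc)
    ultimately have "(\<lambda>n. conv (k 1) (w n) x) \<longlonglongrightarrow> of_real \<Lambda> * p x" by simp
    then show "conv (k 1) p x = of_real \<Lambda> * p x"
      by (rule LIMSEQ_unique[OF \<open>(\<lambda>n. conv (k 1) (w n) x) \<longlonglongrightarrow> conv (k 1) p x\<close>])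
  qed
  \<comment> \<open>The squared norm of p is its value at the identity, and that value is the limit
    L of \<open>B n\<close>.\<close>
  have "complex_of_real ((L2_norm \<mu> p)\<^sup>2) = p 0"
    using conv_star_0[of p p] by (simp add: p_star p_idem L2_inner_self)
  moreover have "(\<lambda>n. w n 0) \<longlonglongrightarrow> of_real L"
  proof -
    have "w n 0 = of_real (B n)" for n
      by (simp add: w_def A_eq B_def)
    then show ?thesis using tendsto_of_real[OF B_lim] by simp
  qed
  ultimately have "complex_of_real ((L2_norm \<mu> p)\<^sup>2) = of_real L"
    using LIMSEQ_unique[OF p_pt[of 0]] by simp
  then have "(L2_norm \<mu> p)\<^sup>2 = L" by (simp only: of_real_eq_iff)
  then have "1 \<le> (L2_norm \<mu> p)\<^sup>2" using \<Lambda>(2) by simp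
  then have "1 \<le> L2_norm \<mu> p"
    by (intro power2_le_imp_le[of 1]) simp_all
  moreover have "k 1 = conv r r" "k 0 = r" by (simp_all add: k_def)
  ultimately show ?thesis
    using that[OF \<Lambda>(1) p_cont p_star p_idem] \<Lambda>(3) p_eig by (simp add: A_def)
qed

end

section \<open>Unitary representations in matrix form\<close>

lemma mat_adjoint_dim [simp]: "dim_row (mat_adjoint A) = dim_col A" "dim_col (mat_adjoint A) = dim_row A"
  by (simp_all add: mat_adjoint_def)

lemma mat_adjoint_index:
  fixes A :: "complex mat"
  assumes "i < dim_col A" "j < dim_row A"
  shows "mat_adjoint A $$ (i, j) = cnj (A $$ (j, i))"
  using assms by (simp add: mat_adjoint_def mat_of_rows_index conjugate_complex_def)

lemma mat_mult_index:
  fixes A B :: "complex mat"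
  assumes "A \<in> carrier_mat m n" "B \<in> carrier_mat n k" "i < m" "j < k"
  shows "(A * B) $$ (i, j) = (\<Sum>l<n. A $$ (i, l) * B $$ (l, j))"
  using assms by (simp add: scalar_prod_def atLeast0LessThan)

lemma mat_adjoint_carrier: "A \<in> carrier_mat m n \<Longrightarrow> mat_adjoint A \<in> carrier_mat n m"
  by (intro carrier_matI) auto

lemma mat_adjoint_right_inverse:
  fixes A :: "complex mat"
  assumes A: "A \<in> carrier_mat n n" and inv: "mat_adjoint A * A = 1\<^sub>m n"
  shows "A * mat_adjoint A = 1\<^sub>m n"
  by (rule mat_mult_left_right_inverse[OF mat_adjoint_carrier[OF A] A inv])

lemma isometry_cols:
  fixes A :: "complex mat"
  assumes A: "A \<in> carrier_mat n n" and inv: "mat_adjoint A * A = 1\<^sub>m n" and ij: "i < n" "j < n"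
  shows "(\<Sum>k<n. cnj (A $$ (k, i)) * A $$ (k, j)) = of_bool (i = j)"
proof -
  have "(mat_adjoint A * A) $$ (i, j) = (\<Sum>k<n. mat_adjoint A $$ (i, k) * A $$ (k, j))"
    by (rule mat_mult_index[OF mat_adjoint_carrier[OF A] A ij])
  moreover have "(mat_adjoint A * A) $$ (i, j) = of_bool (i = j)" using ij by (simp add: inv)
  ultimately show ?thesis using A ij by (simp add: mat_adjoint_index)
qed

lemma isometry_rows:
  fixes A :: "complex mat"
  assumes A: "A \<in> carrier_mat n n" and inv: "mat_adjoint A * A = 1\<^sub>m n" and ij: "i < n" "j < n"
  shows "(\<Sum>k<n. A $$ (i, k) * cnj (A $$ (j, k))) = of_bool (i = j)"
proof -
  have "(A * mat_adjoint A) $$ (i, j) = (\<Sum>k<n. A $$ (i, k) * mat_adjoint A $$ (k, j))"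
    by (rule mat_mult_index[OF A mat_adjoint_carrier[OF A] ij])
  moreover have "(A * mat_adjoint A) $$ (i, j) = of_bool (i = j)"
    using ij by (simp add: mat_adjoint_right_inverse[OF A inv])
  ultimately show ?thesis using A ij by (simp add: mat_adjoint_index)
qed

lemma unitary_repD:
  assumes "unitary_rep n \<pi>"
  shows "\<pi> g \<in> carrier_mat n n" "mat_adjoint (\<pi> g) * \<pi> g = 1\<^sub>m n" "\<pi> (g + h) = \<pi> g * \<pi> h"
    "i < n \<Longrightarrow> j < n \<Longrightarrow> continuous_on UNIV (\<lambda>g. \<pi> g $$ (i, j))"
  using assms unfolding unitary_rep_def by auto

lemma unitary_rep_add:
  assumes "unitary_rep n \<pi>" "i < n" "j < n"
  shows "\<pi> (g + h) $$ (i, j) = (\<Sum>k<n. \<pi> g $$ (i, k) * \<pi> h $$ (k, j))"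
  unfolding unitary_repD(3)[OF assms(1)]
  by (rule mat_mult_index[OF unitary_repD(1)[OF assms(1)] unitary_repD(1)[OF assms(1)] assms(2,3)])

lemma unitary_rep_cols:
  assumes "unitary_rep n \<pi>" "i < n" "j < n"
  shows "(\<Sum>k<n. cnj (\<pi> g $$ (k, i)) * \<pi> g $$ (k, j)) = of_bool (i = j)"
  by (rule isometry_cols[OF unitary_repD(1,2)[OF assms(1)] assms(2,3)])

lemma unitary_rep_rows:
  assumes "unitary_rep n \<pi>" "i < n" "j < n"
  shows "(\<Sum>k<n. \<pi> g $$ (i, k) * cnj (\<pi> g $$ (j, k))) = of_bool (i = j)"
  by (rule isometry_rows[OF unitary_repD(1,2)[OF assms(1)] assms(2,3)])

lemma unitary_rep_0:
  assumes \<pi>: "unitary_rep n \<pi>"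
  shows "\<pi> 0 = 1\<^sub>m n"
proof -
  note [simp] = unitary_repD(1)[OF \<pi>]
  have "\<pi> 0 = 1\<^sub>m n * \<pi> 0" by (rule left_mult_one_mat[OF unitary_repD(1)[OF \<pi>], symmetric])
  also have "\<dots> = mat_adjoint (\<pi> 0) * \<pi> 0 * \<pi> 0" by (simp add: unitary_repD(2)[OF \<pi>])
  also have "\<dots> = mat_adjoint (\<pi> 0) * (\<pi> 0 * \<pi> 0)"
    by (rule assoc_mult_mat[of _ n n _ n _ n]) (simp_all add: mat_adjoint_carrier)
  also have "\<pi> 0 * \<pi> 0 = \<pi> 0" using unitary_repD(3)[OF \<pi>, of 0 0] by simp
  finally show ?thesis by (simp add: unitary_repD(2)[OF \<pi>])
qed

lemma unitary_rep_uminus: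
  assumes \<pi>: "unitary_rep n \<pi>" and ij: "i < n" "j < n"
  shows "\<pi> (- g) $$ (i, j) = cnj (\<pi> g $$ (j, i))"
proof -
  note [simp] = unitary_repD(1)[OF \<pi>]
  have "\<pi> (- g) = 1\<^sub>m n * \<pi> (- g)"
    by (rule left_mult_one_mat[OF unitary_repD(1)[OF \<pi>], symmetric])
  also have "\<dots> = mat_adjoint (\<pi> g) * \<pi> g * \<pi> (- g)" by (simp add: unitary_repD(2)[OF \<pi>])
  also have "\<dots> = mat_adjoint (\<pi> g) * (\<pi> g * \<pi> (- g))"
    by (rule assoc_mult_mat[of _ n n _ n _ n]) (simp_all add: mat_adjoint_carrier)
  also have "\<pi> g * \<pi> (- g) = 1\<^sub>m n"
    using unitary_repD(3)[OF \<pi>, of g "- g"] by (simp add: unitary_rep_0[OF \<pi>])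
  finally have "\<pi> (- g) = mat_adjoint (\<pi> g)"
    by (simp add: right_mult_one_mat[OF mat_adjoint_carrier[OF unitary_repD(1)[OF \<pi>]]])
  moreover have "dim_row (\<pi> g) = n" "dim_col (\<pi> g) = n"
    using carrier_matD[OF unitary_repD(1)[OF \<pi>]] by simp_all
  ultimately show ?thesis using ij by (simp add: mat_adjoint_index)
qed

section \<open>Finite-dimensional invariant spaces of continuous functions\<close>

lemma sum_single:
  fixes n :: nat and f :: "nat \<Rightarrow> complex"
  assumes "j < n" "\<And>i. i < n \<Longrightarrow> i \<noteq> j \<Longrightarrow> f i = 0"
  shows "(\<Sum>i<n. f i) = f j"
  using assms by (subst sum.remove[of _ j]) (auto intro!: sum.neutral)

lemma delta_sum:
  fixes n :: nat and c :: "nat \<Rightarrow> complex"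
  assumes "j < n"
  shows "(\<Sum>i<n. c i * of_bool (i = j)) = c j" "(\<Sum>i<n. c i * of_bool (j = i)) = c j"
    "(\<Sum>i<n. of_bool (i = j) * c i) = c j" "(\<Sum>i<n. of_bool (j = i) * c i) = c j"
  using assms by (subst sum_single[of j]; simp)+

context haar_group
begin

text \<open>Continuity is included so that expansions in the family hold at every point and not
  merely almost everywhere.\<close>

definition orthonormal :: "nat \<Rightarrow> (nat \<Rightarrow> 'g \<Rightarrow> complex) \<Rightarrow> bool" where
  "orthonormal n u \<longleftrightarrow> (\<forall>i<n. cont (u i)) \<and> (\<forall>i<n. \<forall>j<n. L2_inner \<mu> (u i) (u j) = of_bool (i = j))"

definition spanned :: "nat \<Rightarrow> (nat \<Rightarrow> 'g \<Rightarrow> complex) \<Rightarrow> ('g \<Rightarrow> complex) set" where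
  "spanned n u = {\<lambda>x. \<Sum>i<n. c i * u i x | c. True}"

definition cont_subspace :: "('g \<Rightarrow> complex) set \<Rightarrow> bool" where
  "cont_subspace V \<longleftrightarrow> (\<forall>f\<in>V. cont f) \<and> (\<lambda>x. 0) \<in> V \<and>
     (\<forall>f\<in>V. \<forall>g\<in>V. (\<lambda>x. f x + g x) \<in> V) \<and> (\<forall>c. \<forall>f\<in>V. (\<lambda>x. c * f x) \<in> V)"

definition left_invariant :: "('g \<Rightarrow> complex) set \<Rightarrow> bool" where
  "left_invariant V \<longleftrightarrow> (\<forall>g. \<forall>f\<in>V. (\<lambda>y. f (- g + y)) \<in> V)"

lemma cont_sum: "(\<And>i. i < n \<Longrightarrow> cont (u i)) \<Longrightarrow> cont (\<lambda>x. \<Sum>i<n. c i * u i x)"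
  by (intro continuous_on_sum continuous_on_mult continuous_on_const) simp

lemma orthonormalD:
  assumes "orthonormal n u"
  shows "i < n \<Longrightarrow> cont (u i)" "i < n \<Longrightarrow> u i \<in> L2 \<mu>"
    "i < n \<Longrightarrow> j < n \<Longrightarrow> L2_inner \<mu> (u i) (u j) = of_bool (i = j)"
  using assms cont_L2 by (auto simp: orthonormal_def)

lemma inner_comb:
  assumes u: "orthonormal n u"
  shows "j < n \<Longrightarrow> L2_inner \<mu> (\<lambda>x. \<Sum>i<n. c i * u i x) (u j) = c j"
    and "L2_inner \<mu> (\<lambda>x. \<Sum>i<n. c i * u i x) (\<lambda>x. \<Sum>i<n. d i * u i x) = (\<Sum>i<n. c i * cnj (d i))"
proof -
  have 1: "L2_inner \<mu> (\<lambda>x. \<Sum>i<n. c i * u i x) (u j) = c j" if j: "j < n" for j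
    using orthonormalD[OF u] j
    by (subst L2_inner_sum) (auto simp: L2_scale L2_inner_scale delta_sum)
  show "j < n \<Longrightarrow> L2_inner \<mu> (\<lambda>x. \<Sum>i<n. c i * u i x) (u j) = c j" by (rule 1)
  show "L2_inner \<mu> (\<lambda>x. \<Sum>i<n. c i * u i x) (\<lambda>x. \<Sum>i<n. d i * u i x) = (\<Sum>i<n. c i * cnj (d i))"
    using orthonormalD[OF u]
    by (subst L2_inner_sum(2)) (auto simp: L2_scale L2_inner_scale 1 mult.commute intro!: L2_sum)
qed

lemma spanned_expansion:
  assumes u: "orthonormal n u" and f: "f \<in> spanned n u"
  shows "f = (\<lambda>x. \<Sum>i<n. L2_inner \<mu> f (u i) * u i x)"
proof -
  obtain c where c: "f = (\<lambda>x. \<Sum>i<n. c i * u i x)" using f by (auto simp: spanned_def)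
  show ?thesis unfolding c by (intro ext sum.cong) (simp_all add: inner_comb(1)[OF u])
qed

lemma spanned_parseval:
  assumes u: "orthonormal n u" and f: "f \<in> spanned n u" and g: "g \<in> spanned n u"
  shows "L2_inner \<mu> f g = (\<Sum>i<n. L2_inner \<mu> f (u i) * cnj (L2_inner \<mu> g (u i)))"
proof -
  have "L2_inner \<mu> f g = L2_inner \<mu> (\<lambda>x. \<Sum>i<n. L2_inner \<mu> f (u i) * u i x) (\<lambda>x. \<Sum>i<n. L2_inner \<mu> g (u i) * u i x)"
    using spanned_expansion[OF u f] spanned_expansion[OF u g] by simp
  then show ?thesis by (simp only: inner_comb(2)[OF u])
qed

lemma inner_residual:
  assumes u: "orthonormal n u" and f: "f \<in> L2 \<mu>"
  defines "g \<equiv> \<lambda>x. f x - (\<Sum>i<n. L2_inner \<mu> f (u i) * u i x)"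
  shows "j < n \<Longrightarrow> L2_inner \<mu> g (u j) = 0"
    and "(L2_norm \<mu> g)\<^sup>2 = (L2_norm \<mu> f)\<^sup>2 - (\<Sum>i<n. (cmod (L2_inner \<mu> f (u i)))\<^sup>2)"
proof -
  let ?s = "\<lambda>x. \<Sum>i<n. L2_inner \<mu> f (u i) * u i x"
  have s: "?s \<in> L2 \<mu>" by (intro L2_sum L2_scale orthonormalD(2)[OF u]) simp
  show "j < n \<Longrightarrow> L2_inner \<mu> g (u j) = 0"
    unfolding g_def by (simp add: L2_inner_diff(1)[OF f s orthonormalD(2)[OF u]] inner_comb(1)[OF u])
  have *: "L2_inner \<mu> f ?s = (\<Sum>i<n. of_real ((cmod (L2_inner \<mu> f (u i)))\<^sup>2))"
    using orthonormalD(2)[OF u] f unfolding complex_norm_square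
    by (subst L2_inner_sum(2)) (simp_all add: L2_scale L2_inner_scale(2) mult.commute[of "cnj _"])
  have "complex_of_real ((L2_norm \<mu> ?s)\<^sup>2) = of_real (\<Sum>i<n. (cmod (L2_inner \<mu> f (u i)))\<^sup>2)"
    unfolding L2_inner_self[symmetric] inner_comb(2)[OF u]
    by (simp add: complex_norm_square[symmetric] del: of_real_power)
  then have **: "(L2_norm \<mu> ?s)\<^sup>2 = (\<Sum>i<n. (cmod (L2_inner \<mu> f (u i)))\<^sup>2)"
    by (simp only: of_real_eq_iff)
  show "(L2_norm \<mu> g)\<^sup>2 = (L2_norm \<mu> f)\<^sup>2 - (\<Sum>i<n. (cmod (L2_inner \<mu> f (u i)))\<^sup>2)"
    unfolding g_def L2_norm_diff_square[OF f s] * ** by simp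
qed

lemma bessel:
  assumes "orthonormal n u" "f \<in> L2 \<mu>"
  shows "(\<Sum>i<n. (cmod (L2_inner \<mu> f (u i)))\<^sup>2) \<le> (L2_norm \<mu> f)\<^sup>2"
  using inner_residual(2)[OF assms]
    zero_le_power2[of "L2_norm \<mu> (\<lambda>x. f x - (\<Sum>i<n. L2_inner \<mu> f (u i) * u i x))"] by linarith

lemma cont_subspaceD:
  assumes "cont_subspace V"
  shows "f \<in> V \<Longrightarrow> cont f" "(\<lambda>x. 0) \<in> V" "f \<in> V \<Longrightarrow> g \<in> V \<Longrightarrow> (\<lambda>x. f x + g x) \<in> V"
    "f \<in> V \<Longrightarrow> (\<lambda>x. c * f x) \<in> V"
  using assms by (simp_all add: cont_subspace_def)

lemma subspace_sum:
  fixes n :: nat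
  assumes V: "cont_subspace V" and u: "\<And>i. i < n \<Longrightarrow> u i \<in> V"
  shows "(\<lambda>x. \<Sum>i<n. c i * u i x) \<in> V"
  using u
proof (induction n)
  case 0
  then show ?case using cont_subspaceD(2)[OF V] by simp
next
  case (Suc n)
  then have "(\<lambda>x. \<Sum>i<n. c i * u i x) \<in> V" "(\<lambda>x. c n * u n x) \<in> V"
    by (simp_all add: cont_subspaceD(4)[OF V])
  from cont_subspaceD(3)[OF V this] show ?case by simp
qed

text \<open>Gram-Schmidt. The residual g has nonzero norm, because a continuous function of norm
  zero vanishes everywhere, which would put f into the span.\<close>

lemma orthonormal_extend:
  assumes V: "cont_subspace V" and u: "orthonormal n u" "\<And>i. i < n \<Longrightarrow> u i \<in> V"
    and f: "f \<in> V" "f \<notin> spanned n u"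
  obtains u' where "orthonormal (Suc n) u'" "\<forall>i<Suc n. u' i \<in> V"
proof -
  have f_cont: "cont f" using V f by (simp add: cont_subspace_def)
  define s where "s = (\<lambda>x. \<Sum>i<n. L2_inner \<mu> f (u i) * u i x)"
  define g where "g = (\<lambda>x. f x - s x)"
  have s: "s \<in> V" unfolding s_def by (rule subspace_sum[OF V u(2)])
  have g: "g \<in> V"
    using cont_subspaceD(3)[OF V f(1) cont_subspaceD(4)[OF V s, of "-1"]] by (simp add: g_def)
  then have g_cont: "cont g" by (rule cont_subspaceD(1)[OF V])
  have g_orth: "L2_inner \<mu> g (u j) = 0" if "j < n" for j
    using inner_residual(1)[OF u(1) cont_L2[OF f_cont] that] by (simp add: g_def s_def)
  have "L2_norm \<mu> g \<noteq> 0"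
  proof
    assume "L2_norm \<mu> g = 0"
    then have "g = (\<lambda>x. 0)" by (rule cont_eq_0[OF g_cont])
    then have "f = s" by (auto simp: g_def fun_eq_iff)
    then show False using f(2) by (auto simp: spanned_def s_def)
  qed
  then have g_pos: "0 < L2_norm \<mu> g" by (simp add: order_less_le)
  define e where "e = (\<lambda>x. of_real (1 / L2_norm \<mu> g) * g x)"
  have e: "e \<in> V" unfolding e_def by (rule cont_subspaceD(4)[OF V g])
  then have e_cont: "cont e" by (rule cont_subspaceD(1)[OF V])
  have e_orth: "L2_inner \<mu> e (u j) = 0" "L2_inner \<mu> (u j) e = 0" if "j < n" for j
  proof -
    show 1: "L2_inner \<mu> e (u j) = 0" unfolding e_def L2_inner_scale by (simp add: g_orth[OF that])
    show "L2_inner \<mu> (u j) e = 0" by (subst L2_inner_commute) (simp add: 1)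
  qed
  have e_norm: "L2_inner \<mu> e e = 1"
    unfolding e_def L2_inner_scale L2_inner_self using g_pos by (simp add: power2_eq_square)
  have "orthonormal (Suc n) (u(n := e))"
    using u(1) e_cont e_orth e_norm unfolding orthonormal_def by (auto simp: less_Suc_eq)
  moreover have "\<forall>i<Suc n. (u(n := e)) i \<in> V"
    using u(2) e by (auto simp: less_Suc_eq)
  ultimately show ?thesis by (rule that)
qed

text \<open>The bound on the length of orthonormal families stands in for finite dimension. A
  longest family spans, since a vector outside its span would extend it.\<close>

lemma orthonormal_basis_exists:
  assumes V: "cont_subspace V"
    and bound: "\<And>n u. orthonormal n u \<Longrightarrow> (\<And>i. i < n \<Longrightarrow> u i \<in> V) \<Longrightarrow> n \<le> B"
  obtains n u where "orthonormal n u" "V = spanned n u" "\<And>i. i < n \<Longrightarrow> u i \<in> V"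
proof -
  define P where "P n \<longleftrightarrow> (\<exists>u. orthonormal n u \<and> (\<forall>i<n. u i \<in> V))" for n
  have P0: "P 0" by (simp add: P_def orthonormal_def)
  have PB: "n \<le> B" if "P n" for n
    using that bound unfolding P_def by blast
  define n where "n = (GREATEST n. P n)"
  have "P n" unfolding n_def by (rule GreatestI_nat[of P 0 B, OF P0 PB])
  have n_max: "m \<le> n" if "P m" for m unfolding n_def by (rule Greatest_le_nat[of P m B, OF that PB])
  obtain u where u: "orthonormal n u" "\<And>i. i < n \<Longrightarrow> u i \<in> V"
    using \<open>P n\<close> unfolding P_def by blast
  have "V \<subseteq> spanned n u"
  proof (rule subsetI, rule ccontr)
    fix f assume f: "f \<in> V" "f \<notin> spanned n u"
    obtain u' where "orthonormal (Suc n) u'" "\<forall>i<Suc n. u' i \<in> V"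
      by (rule orthonormal_extend[OF V u(1) _ f]) (rule u(2))
    then have "P (Suc n)" unfolding P_def by (intro exI[of _ u'] conjI)
    from n_max[OF this] show False by simp
  qed
  moreover have "spanned n u \<subseteq> V"
    using subspace_sum[OF V u(2)] by (auto simp: spanned_def)
  ultimately show ?thesis by (intro that[OF u(1) _ u(2)]) auto
qed

lemma orthonormal_norm:
  assumes "orthonormal n u" "j < n"
  shows "(L2_norm \<mu> (u j))\<^sup>2 = 1"
proof -
  have "complex_of_real ((L2_norm \<mu> (u j))\<^sup>2) = 1"
    unfolding L2_inner_self[symmetric] by (simp add: orthonormalD(3)[OF assms(1,2,2)])
  then show ?thesis by (simp only: of_real_eq_1_iff)
qed

text \<open>Sum the squared moduli of all \<open>L2_inner \<mu> (e i) (u j)\<close> in two ways: for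
  fixed i they add up to 1 by Parseval, for fixed j to at most 1 by Bessel.\<close>

lemma orthonormal_card_le:
  assumes e: "orthonormal m e" and u: "orthonormal n u" and sub: "\<And>i. i < m \<Longrightarrow> e i \<in> spanned n u"
  shows "m \<le> n"
proof -
  have 1: "(\<Sum>j<n. (cmod (L2_inner \<mu> (e i) (u j)))\<^sup>2) = 1" if "i < m" for i
  proof -
    have "complex_of_real (\<Sum>j<n. (cmod (L2_inner \<mu> (e i) (u j)))\<^sup>2) = L2_inner \<mu> (e i) (e i)"
      using spanned_parseval[OF u sub[OF that] sub[OF that]]
      by (simp add: complex_norm_square[symmetric] del: of_real_power)
    also have "\<dots> = 1" by (simp add: orthonormalD(3)[OF e that that])
    finally show ?thesis by (simp only: of_real_eq_1_iff)
  qed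
  note norm_u = orthonormal_norm[OF u]
  have "real m = (\<Sum>i<m. \<Sum>j<n. (cmod (L2_inner \<mu> (e i) (u j)))\<^sup>2)" by (simp add: 1)
  also have "\<dots> = (\<Sum>j<n. \<Sum>i<m. (cmod (L2_inner \<mu> (u j) (e i)))\<^sup>2)"
    by (subst sum.swap) (simp add: L2_inner_commute[of "e _" "u _"])
  also have "\<dots> \<le> (\<Sum>j<n. 1)"
    using bessel[OF e orthonormalD(2)[OF u]] by (intro sum_mono) (simp add: norm_u)
  finally show ?thesis by simp
qed

text \<open>The values \<open>u i x\<close> are up to conjugation the Fourier coefficients of one
  function, \<open>\<lambda>y. cnj (p (- y + x))\<close>, whose norm is that of p. Bessel bounds the
  sum of their squared moduli for each x, and the integral of that sum over x is n. So the range of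
  a convolution idempotent is finite-dimensional.\<close>

lemma reproducing_bound:
  assumes u: "orthonormal n u" and p: "cont p" and repr: "\<And>i. i < n \<Longrightarrow> conv (u i) p = u i"
  shows "real n \<le> (L2_norm \<mu> p)\<^sup>2"
proof -
  have "(\<Sum>i<n. (cmod (u i x))\<^sup>2) \<le> (L2_norm \<mu> p)\<^sup>2" for x
  proof -
    define P where "P = (\<lambda>y. cnj (p (- y + x)))"
    have P: "P \<in> L2 \<mu>" unfolding P_def by (intro L2_cnj cont_L2 cont_translate p)
    have "u i x = L2_inner \<mu> (u i) P" if "i < n" for i
      using fun_cong[OF repr[OF that], of x] by (simp add: conv_def L2_inner_def P_def)
    then have "(\<Sum>i<n. (cmod (u i x))\<^sup>2) = (\<Sum>i<n. (cmod (L2_inner \<mu> P (u i)))\<^sup>2)"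
      by (intro sum.cong) (simp_all add: L2_inner_commute[of _ P])
    then show ?thesis
      using bessel[OF u P] L2_norm_reflect[OF p, of x] by (simp add: P_def)
  qed
  then have "(\<integral>x. (\<Sum>i<n. (cmod (u i x))\<^sup>2) \<partial>\<mu>) \<le> (L2_norm \<mu> p)\<^sup>2"
    using L2_norm_square_integrable[OF orthonormalD(2)[OF u]]
    by (intro integral_le_const AE_I2 Bochner_Integration.integrable_sum) auto
  moreover have "(\<integral>x. (\<Sum>i<n. (cmod (u i x))\<^sup>2) \<partial>\<mu>) = (\<Sum>i<n. (L2_norm \<mu> (u i))\<^sup>2)"
    using L2_norm_square_integrable[OF orthonormalD(2)[OF u]]
    by (subst Bochner_Integration.integral_sum) (auto simp: L2_norm_square)
  ultimately show ?thesis by (simp add: orthonormal_norm[OF u])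
qed

lemma spanned_member: "(\<lambda>x. \<Sum>i<n. c i * u i x) \<in> spanned n u"
  by (auto simp: spanned_def)

lemma spanned_basis_member: "i < n \<Longrightarrow> u i \<in> spanned n u"
  unfolding spanned_def mem_Collect_eq
  by (rule exI[of _ "\<lambda>j. of_bool (j = i)"]) (simp add: delta_sum)

text \<open>A nonzero invariant subspace of least dimension. Minimality is stated for arbitrary
  subspaces V, the form in which it will yield irreducibility.\<close>

lemma minimal_invariant_subspace:
  assumes X: "cont_subspace X" "left_invariant X" "f \<in> X" "f \<noteq> (\<lambda>x. 0)"
    and bound: "\<And>n u. orthonormal n u \<Longrightarrow> (\<And>i. i < n \<Longrightarrow> u i \<in> X) \<Longrightarrow> n \<le> B"
  obtains n u where "0 < n" "orthonormal n u" "left_invariant (spanned n u)" "spanned n u \<subseteq> X"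
    "\<forall>V f. cont_subspace V \<and> left_invariant V \<and> V \<subseteq> spanned n u \<and> f \<in> V \<and> f \<noteq> (\<lambda>x. 0)
      \<longrightarrow> V = spanned n u"
proof -
  define P where "P n \<longleftrightarrow> (\<exists>u. 0 < n \<and> orthonormal n u \<and> left_invariant (spanned n u) \<and> spanned n u \<subseteq> X)" for n
  have sub: "\<exists>n u. P n \<and> orthonormal n u \<and> V = spanned n u"
    if V: "cont_subspace V" "left_invariant V" "V \<subseteq> X" "f \<in> V" "f \<noteq> (\<lambda>x. 0)" for V f
  proof -
    have V_bound: "n \<le> B" if "orthonormal n u" "\<And>i. i < n \<Longrightarrow> u i \<in> V" for n u
      using bound[OF that(1)] that(2) V(3) by (simp add: subset_iff)
    obtain n u where u: "orthonormal n u" "V = spanned n u"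
      by (rule orthonormal_basis_exists[OF V(1) V_bound])
    have "n \<noteq> 0"
    proof
      assume "n = 0"
      then have "f = (\<lambda>x. 0)" using V(4) u(2) by (auto simp: spanned_def)
      then show False using V(5) by simp
    qed
    then have "P n" unfolding P_def using u V(2,3) by (intro exI[of _ u]) simp
    then show ?thesis using u by (intro exI[of _ n] exI[of _ u]) simp
  qed
  have "\<exists>n. P n" using sub[OF X(1,2) subset_refl X(3,4)] by (elim exE conjE) (rule exI)
  define n where "n = (LEAST n. P n)"
  have "P n" unfolding n_def by (rule LeastI_ex) fact
  then obtain u where u: "0 < n" "orthonormal n u" "left_invariant (spanned n u)" "spanned n u \<subseteq> X"
    unfolding P_def by (elim exE conjE)
  have "V = spanned n u"
    if V: "cont_subspace V" "left_invariant V" "V \<subseteq> spanned n u" "f \<in> V" "f \<noteq> (\<lambda>x. 0)" for V f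
  proof (rule ccontr)
    assume neq: "V \<noteq> spanned n u"
    obtain m e where e: "P m" "orthonormal m e" "V = spanned m e"
      using sub[OF V(1,2) subset_trans[OF V(3) u(4)] V(4,5)] by (elim exE conjE)
    \<comment> \<open>Least dimension gives n \<le> m, while a vector outside V extends the basis of
      V to m + 1 orthonormal vectors in \<open>spanned n u\<close>, so that m + 1 \<le> n.\<close>
    have "n \<le> m" unfolding n_def by (rule Least_le) (rule e(1))
    obtain g where g: "g \<in> spanned n u" "g \<notin> spanned m e" using neq V(3) e(3) by auto
    have span_sub: "cont_subspace (spanned n u)"
      unfolding cont_subspace_def
    proof (intro conjI ballI allI)
      fix f assume "f \<in> spanned n u"
      then show "cont f" using cont_sum orthonormalD(1)[OF u(2)] by (auto simp: spanned_def)
    next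
      show "(\<lambda>x. 0) \<in> spanned n u" using spanned_member[where n=n and u=u and c="\<lambda>_. 0"] by simp
    next
      fix f g assume "f \<in> spanned n u" "g \<in> spanned n u"
      then obtain c d where "f = (\<lambda>x. \<Sum>i<n. c i * u i x)" "g = (\<lambda>x. \<Sum>i<n. d i * u i x)"
        by (auto simp: spanned_def)
      then show "(\<lambda>x. f x + g x) \<in> spanned n u"
        using spanned_member[where n=n and u=u and c="\<lambda>i. c i + d i"] by (simp add: distrib_right sum.distrib)
    next
      fix c f assume "f \<in> spanned n u"
      then obtain d where "f = (\<lambda>x. \<Sum>i<n. d i * u i x)" by (auto simp: spanned_def)
      then show "(\<lambda>x. c * f x) \<in> spanned n u"
        using spanned_member[where n=n and u=u and c="\<lambda>i. c * d i"] by (simp add: sum_distrib_left mult.assoc)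
    qed
    have "e i \<in> spanned n u" if "i < m" for i
      using spanned_basis_member[OF that, of e] e(3) V(3) by auto
    then obtain e' where e': "orthonormal (Suc m) e'" "\<forall>i<Suc m. e' i \<in> spanned n u"
      by (rule orthonormal_extend[OF span_sub e(2) _ g])
    have "Suc m \<le> n" by (rule orthonormal_card_le[OF e'(1) u(2)]) (simp add: e'(2))
    then show False using \<open>n \<le> m\<close> by simp
  qed
  then have "\<forall>V f. cont_subspace V \<and> left_invariant V \<and> V \<subseteq> spanned n u \<and> f \<in> V \<and> f \<noteq> (\<lambda>x. 0)
      \<longrightarrow> V = spanned n u"
    by (intro allI impI, elim conjE)
  from that[OF u this] show ?thesis .
qed

text \<open>If \<open>V\<close> is a minimal left-invariant space of continuous functions with orthonormal basis \<open>u\<close>,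
  its reproducing kernel is \<open>K(y, x) = q(y\<inverse>x)\<close> with \<open>q = K(1, \<cdot>)\<close>, so that the orthogonal
  projection onto \<open>V\<close> is right convolution with \<open>q\<close>.\<close>

lemma irreducible_projector:
  assumes p: "cont p" "star p = p" "conv p p = p" "p \<noteq> (\<lambda>x. 0)"
  obtains n \<pi> q c where "\<pi> \<in> irreps" "unitary_rep n \<pi>"
    "q = (\<lambda>x. \<Sum>i<n. \<Sum>j<n. c i j * cnj (\<pi> x $$ (i, j)))"
    "cont q" "star q = q" "conv q q = q" "conv q p = q" "1 \<le> L2_norm \<mu> q"
proof -
  \<comment> \<open>The range of right convolution with p. Right convolution commutes with left
    translation, so the range is left-invariant, and \<open>reproducing_bound\<close> makes it
    finite-dimensional.\<close>
  define X where "X = {f. cont f \<and> conv f p = f}"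
  have X: "cont_subspace X"
    using p(1) by (auto simp: cont_subspace_def X_def continuous_on_add continuous_on_mult conv_add conv_scale)
      (simp add: conv_def)
  have X_inv: "left_invariant X"
    unfolding left_invariant_def
  proof (intro allI ballI)
    fix g f assume "f \<in> X"
    then have f: "cont f" "conv f p = f" by (simp_all add: X_def)
    have "conv (\<lambda>y. f (- g + y)) p x = f (- g + x)" for x
    proof -
      have "cont (\<lambda>y. f y * p (- y + (- g + x)))"
        by (intro continuous_intros f p cont_translate)
      from integral_translate(1)[OF cont_measurable[OF this], of "- g"]
      have "conv (\<lambda>y. f (- g + y)) p x = conv f p (- g + x)"
        by (simp add: conv_def minus_add add.assoc)
      then show ?thesis by (simp add: f)
    qed
    then show "(\<lambda>y. f (- g + y)) \<in> X"
      using cont_translate(1)[OF f(1)] by (simp add: X_def fun_eq_iff)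
  qed
  obtain B :: nat where B: "(L2_norm \<mu> p)\<^sup>2 \<le> real B" using real_arch_simple by blast
  have X_bound: "n \<le> B" if "orthonormal n u" "\<And>i. i < n \<Longrightarrow> u i \<in> X" for n u
  proof -
    have "real n \<le> (L2_norm \<mu> p)\<^sup>2"
      by (rule reproducing_bound[OF that(1) p(1)]) (use that(2) in \<open>simp add: X_def\<close>)
    then show ?thesis using B by linarith
  qed
  have "p \<in> X" using p by (simp add: X_def)
  obtain n u where n: "0 < n" and u: "orthonormal n u" and inv: "left_invariant (spanned n u)"
    and sub: "spanned n u \<subseteq> X"
    and minimal': "\<forall>V f. cont_subspace V \<and> left_invariant V \<and> V \<subseteq> spanned n u \<and> f \<in> V
      \<and> f \<noteq> (\<lambda>x. 0) \<longrightarrow> V = spanned n u"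
    by (rule minimal_invariant_subspace[OF X X_inv \<open>p \<in> X\<close> p(4) X_bound])
  have minimal: "V = spanned n u" if "cont_subspace V" "left_invariant V" "V \<subseteq> spanned n u" "f \<in> V"
    "f \<noteq> (\<lambda>x. 0)" for V f
    by (rule minimal'[rule_format, of V f]) (intro conjI that)
  note u_cont = orthonormalD(1)[OF u]
  \<comment> \<open>Column j holds the coordinates of the translate of \<open>u j\<close>, so the
    matrix represents left translation by g in the basis \<open>u\<close>.\<close>
  define a where "a g i j = L2_inner \<mu> (\<lambda>y. u j (- g + y)) (u i)" for g i j
  have shift_mem: "(\<lambda>y. u j (- g + y)) \<in> spanned n u" if "j < n" for g j
    using inv spanned_basis_member[OF that, of u] unfolding left_invariant_def by simp
  have shift: "u j (- g + y) = (\<Sum>i<n. a g i j * u i y)" if "j < n" for g j y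
    using fun_cong[OF spanned_expansion[OF u shift_mem[OF that]], of g y] by (simp add: a_def)
  define \<pi> where "\<pi> g = mat n n (\<lambda>(i, j). a g i j)" for g
  have \<pi>_carrier [simp]: "\<pi> g \<in> carrier_mat n n" for g by (simp add: \<pi>_def)
  have \<pi>_index: "\<pi> g $$ (i, j) = a g i j" if "i < n" "j < n" for g i j
    using that by (simp add: \<pi>_def)
  have a_add: "a (g + h) i j = (\<Sum>k<n. a g i k * a h k j)" if ij: "i < n" "j < n" for g h i j
  proof -
    have "(\<lambda>y. u j (- (g + h) + y)) = (\<lambda>y. \<Sum>l<n. (\<Sum>k<n. a g l k * a h k j) * u l y)"
    proof
      fix y
      have "u j (- (g + h) + y) = u j (- h + (- g + y))" by (simp only: minus_add add.assoc)
      also have "\<dots> = (\<Sum>k<n. a h k j * u k (- g + y))" by (rule shift[OF ij(2)])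
      also have "\<dots> = (\<Sum>k<n. \<Sum>l<n. a h k j * (a g l k * u l y))"
        by (simp add: shift sum_distrib_left)
      also have "\<dots> = (\<Sum>l<n. \<Sum>k<n. a h k j * (a g l k * u l y))" by (rule sum.swap)
      also have "\<dots> = (\<Sum>l<n. (\<Sum>k<n. a g l k * a h k j) * u l y)"
        by (simp add: sum_distrib_left sum_distrib_right mult_ac)
      finally show "u j (- (g + h) + y) = (\<Sum>l<n. (\<Sum>k<n. a g l k * a h k j) * u l y)" .
    qed
    then show ?thesis unfolding a_def[of "g + h"] by (simp only: inner_comb(1)[OF u ij(1)])
  qed
  have a_unitary: "(\<Sum>k<n. cnj (a g k i) * a g k j) = of_bool (i = j)" if ij: "i < n" "j < n" for g i j
  proof -
    have "L2_inner \<mu> (\<lambda>y. u j (- g + y)) (\<lambda>y. u i (- g + y)) = (\<Sum>k<n. a g k j * cnj (a g k i))"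
      using spanned_parseval[OF u shift_mem[OF ij(2)] shift_mem[OF ij(1)]] by (simp add: a_def)
    moreover have "L2_inner \<mu> (\<lambda>y. u j (- g + y)) (\<lambda>y. u i (- g + y)) = L2_inner \<mu> (u j) (u i)"
    proof -
      have "cont (\<lambda>y. u j y * cnj (u i y))" by (intro continuous_intros u_cont ij)
      from integral_translate(1)[OF cont_measurable[OF this]] show ?thesis by (simp add: L2_inner_def)
    qed
    ultimately have "(\<Sum>k<n. a g k j * cnj (a g k i)) = of_bool (j = i)"
      using orthonormalD(3)[OF u ij(2,1)] by simp
    then show ?thesis by (simp add: mult.commute eq_commute[of j i])
  qed
  \<comment> \<open>Each entry is the conjugate of a convolution of a basis function with the star
    of another, whence continuity in g.\<close>
  have a_cont: "cont (\<lambda>g. a g i j)" if ij: "i < n" "j < n" for i j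
  proof -
    have "a g i j = cnj (conv (u i) (star (u j)) g)" for g
    proof -
      have "conv (u i) (star (u j)) g = L2_inner \<mu> (u i) (\<lambda>y. u j (- g + y))"
        by (simp add: conv_def L2_inner_def star_def minus_add)
      then show ?thesis unfolding a_def by (subst L2_inner_commute) simp
    qed
    then show ?thesis using ij by (simp add: u_cont cont_conv cont_star continuous_on_cnj)
  qed
  have rep: "unitary_rep n \<pi>"
    unfolding unitary_rep_def
  proof (intro conjI allI impI)
    fix g h
    show "\<pi> g \<in> carrier_mat n n" by simp
    show "mat_adjoint (\<pi> g) * \<pi> g = 1\<^sub>m n"
    proof (rule eq_matI)
      fix i j assume "i < dim_row (1\<^sub>m n :: complex mat)" "j < dim_col (1\<^sub>m n :: complex mat)"
      then have ij: "i < n" "j < n" by simp_all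
      have "(mat_adjoint (\<pi> g) * \<pi> g) $$ (i, j) = (\<Sum>k<n. mat_adjoint (\<pi> g) $$ (i, k) * \<pi> g $$ (k, j))"
        by (rule mat_mult_index[OF mat_adjoint_carrier[OF \<pi>_carrier] \<pi>_carrier ij])
      also have "\<dots> = (\<Sum>k<n. cnj (a g k i) * a g k j)"
        using ij carrier_matD[OF \<pi>_carrier] by (intro sum.cong) (simp_all add: mat_adjoint_index \<pi>_index)
      finally show "(mat_adjoint (\<pi> g) * \<pi> g) $$ (i, j) = 1\<^sub>m n $$ (i, j)"
        using ij by (simp add: a_unitary)
    qed (simp_all add: \<pi>_def)
    show "\<pi> (g + h) = \<pi> g * \<pi> h"
    proof (rule eq_matI)
      fix i j assume "i < dim_row (\<pi> g * \<pi> h)" "j < dim_col (\<pi> g * \<pi> h)"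
      then have ij: "i < n" "j < n" by (simp_all add: \<pi>_def)
      have "(\<pi> g * \<pi> h) $$ (i, j) = (\<Sum>k<n. \<pi> g $$ (i, k) * \<pi> h $$ (k, j))"
        by (rule mat_mult_index[OF \<pi>_carrier \<pi>_carrier ij])
      then show "\<pi> (g + h) $$ (i, j) = (\<pi> g * \<pi> h) $$ (i, j)"
        using ij by (simp add: \<pi>_index a_add)
    qed (simp_all add: \<pi>_def)
  next
    fix i j assume ij: "i < n" "j < n"
    then show "continuous_on UNIV (\<lambda>g. \<pi> g $$ (i, j))" by (simp add: \<pi>_index a_cont)
  qed
  \<comment> \<open>Coordinates identify vectors with functions in the minimal space. An invariant
    subspace of vectors becomes a left-invariant space of functions, and minimality becomes
    irreducibility.\<close>
  define comb where "comb v = (\<lambda>x. \<Sum>i<n. v $ i * u i x)" for v :: "complex vec"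
  have comb_inj: "v = w" if "v \<in> carrier_vec n" "w \<in> carrier_vec n" "comb v = comb w" for v w
  proof (rule eq_vecI)
    show "dim_vec v = dim_vec w" using that by simp
    fix i assume "i < dim_vec w"
    then have i: "i < n" using that by simp
    show "v $ i = w $ i"
      using arg_cong[OF that(3), of "\<lambda>f. L2_inner \<mu> f (u i)"] by (simp add: comb_def inner_comb(1)[OF u i])
  qed
  have irr: "W = {0\<^sub>v n} \<or> W = carrier_vec n"
    if W: "vec_subspace n W" and W_inv: "\<And>g v. v \<in> W \<Longrightarrow> \<pi> g *\<^sub>v v \<in> W" for W
  proof (cases "W = {0\<^sub>v n}")
    case False
    have W_carrier: "v \<in> carrier_vec n" if "v \<in> W" for v
      using W that by (auto simp: vec_subspace_def)
    have W_0: "0\<^sub>v n \<in> W" using W by (simp add: vec_subspace_def)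
    have W_add: "v + w \<in> W" if "v \<in> W" "w \<in> W" for v w using W that by (simp add: vec_subspace_def)
    have W_scale: "c \<cdot>\<^sub>v v \<in> W" if "v \<in> W" for v c using W that by (simp add: vec_subspace_def)
    obtain v0 where v0: "v0 \<in> W" "v0 \<noteq> 0\<^sub>v n" using False W_0 by auto
    have comb_0: "comb (0\<^sub>v n) = (\<lambda>x. 0)" by (simp add: comb_def)
    have "comb v0 \<noteq> (\<lambda>x. 0)"
      using comb_inj[OF W_carrier[OF v0(1)] W_carrier[OF W_0]] v0(2) comb_0 by auto
    have "comb ` W = spanned n u"
    proof (rule minimal)
      show "cont_subspace (comb ` W)"
        unfolding cont_subspace_def
      proof (intro conjI ballI allI)
        fix f assume "f \<in> comb ` W"
        then show "cont f" using cont_sum u_cont by (auto simp: comb_def)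
      next
        show "(\<lambda>x. 0) \<in> comb ` W" using imageI[OF W_0, of comb] by (simp only: comb_0)
      next
        fix f g assume "f \<in> comb ` W" "g \<in> comb ` W"
        then obtain v w where vw: "v \<in> W" "w \<in> W" "f = comb v" "g = comb w" by auto
        have "(\<lambda>x. f x + g x) = comb (v + w)"
          using W_carrier[OF vw(1)] W_carrier[OF vw(2)] by (simp add: vw comb_def distrib_right sum.distrib)
        then show "(\<lambda>x. f x + g x) \<in> comb ` W" 
          using imageI[OF W_add[OF vw(1,2)], of comb] by (simp only:)
      next
        fix c f assume "f \<in> comb ` W"
        then obtain v where v: "v \<in> W" "f = comb v" by auto
        have "(\<lambda>x. c * f x) = comb (c \<cdot>\<^sub>v v)"
          using W_carrier[OF v(1)] by (simp add: v comb_def sum_distrib_left mult.assoc)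
        then show "(\<lambda>x. c * f x) \<in> comb ` W" 
          using imageI[OF W_scale[OF v(1)], of comb] by (simp only:)
      qed
      show "left_invariant (comb ` W)"
        unfolding left_invariant_def
      proof (intro allI ballI)
        fix g f assume "f \<in> comb ` W"
        then obtain v where v: "v \<in> W" "f = comb v" by auto
        have "f (- g + y) = comb (\<pi> g *\<^sub>v v) y" for y
        proof -
          have "f (- g + y) = (\<Sum>j<n. v $ j * (\<Sum>i<n. a g i j * u i y))"
            by (simp add: v comb_def shift)
          also have "\<dots> = (\<Sum>j<n. \<Sum>i<n. a g i j * v $ j * u i y)"
            by (simp add: sum_distrib_left mult_ac)
          also have "\<dots> = (\<Sum>i<n. \<Sum>j<n. a g i j * v $ j * u i y)" by (rule sum.swap)
          also have "\<dots> = comb (\<pi> g *\<^sub>v v) y"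
            using W_carrier[OF v(1)]
            by (auto simp: comb_def sum_distrib_right[symmetric] \<pi>_def scalar_prod_def atLeast0LessThan
                intro!: sum.cong)
          finally show ?thesis .
        qed
        then show "(\<lambda>y. f (- g + y)) \<in> comb ` W"
          using imageI[OF W_inv[OF v(1)], of comb] by (simp only:)
      qed
      show "comb ` W \<subseteq> spanned n u" by (auto simp: comb_def spanned_def)
      show "comb v0 \<in> comb ` W" using v0 by simp
    qed fact
    have "carrier_vec n \<subseteq> W"
    proof
      fix v :: "complex vec" assume v: "v \<in> carrier_vec n"
      have "comb v \<in> spanned n u" unfolding comb_def by (rule spanned_member)
      then obtain w where w: "w \<in> W" "comb v = comb w" using \<open>comb ` W = spanned n u\<close> by auto
      then show "v \<in> W" using comb_inj[OF v W_carrier[OF w(1)] w(2)] by simp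
    qed
    then show ?thesis using W_carrier by auto
  qed simp
  have irrep: "\<pi> \<in> irreps"
    unfolding irreps_def mem_Collect_eq
  proof (intro exI[of _ n] conjI allI impI)
    fix W assume "vec_subspace n W \<and> (\<forall>g. \<forall>v\<in>W. \<pi> g *\<^sub>v v \<in> W)"
    then show "W = {0\<^sub>v n} \<or> W = carrier_vec n" by (intro irr) simp_all
  qed (fact n rep)+
  define q where "q = (\<lambda>x. \<Sum>i<n. cnj (u i 0) * u i x)"
  \<comment> \<open>Translating \<open>u j\<close> by x and evaluating at x gives
    \<open>u j 0\<close>; unitarity of the matrix inverts this relation and expresses
    \<open>u k x\<close> through conjugated entries.\<close>
  have u_eq: "u k x = (\<Sum>j<n. cnj (a x k j) * u j 0)" if k: "k < n" for k x
  proof -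
    have "(\<Sum>j<n. cnj (a x k j) * u j 0) = (\<Sum>j<n. cnj (a x k j) * (\<Sum>i<n. a x i j * u i x))"
      using shift[of _ x x] by simp
    also have "\<dots> = (\<Sum>i<n. \<Sum>j<n. cnj (a x k j) * (a x i j * u i x))"
      unfolding sum_distrib_left by (rule sum.swap)
    also have "\<dots> = (\<Sum>i<n. (\<Sum>j<n. \<pi> x $$ (i, j) * cnj (\<pi> x $$ (k, j))) * u i x)"
      by (simp add: sum_distrib_left sum_distrib_right \<pi>_index k mult_ac)
    also have "\<dots> = u k x"
      by (simp add: unitary_rep_rows[OF rep _ k] delta_sum(3)[OF k] del: of_bool_eq_iff)
    finally show ?thesis by simp
  qed
  have kernel: "q (- y + x) = (\<Sum>i<n. cnj (u i y) * u i x)" for x y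
  proof -
    have "q (- y + x) = (\<Sum>j<n. cnj (u j 0) * (\<Sum>i<n. a y i j * u i x))"
      by (simp add: q_def shift)
    also have "\<dots> = (\<Sum>i<n. \<Sum>j<n. cnj (u j 0) * (a y i j * u i x))"
      unfolding sum_distrib_left by (rule sum.swap)
    also have "\<dots> = (\<Sum>i<n. cnj (u i y) * u i x)"
      by (intro sum.cong refl) (simp add: u_eq[of _ y] sum_distrib_left sum_distrib_right mult_ac)
    finally show ?thesis .
  qed
  have q_cont: "cont q" unfolding q_def by (rule cont_sum[OF u_cont])
  have conv_q: "conv f q = (\<lambda>x. \<Sum>i<n. L2_inner \<mu> f (u i) * u i x)" if f: "cont f" for f
  proof
    fix x
    have "conv f q x = (\<integral>y. (\<Sum>i<n. u i x * (f y * cnj (u i y))) \<partial>\<mu>)"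
      by (simp add: conv_def kernel sum_distrib_left mult_ac)
    also have "\<dots> = (\<Sum>i<n. L2_inner \<mu> f (u i) * u i x)"
      using L2_inner_integrable[OF cont_L2[OF f] orthonormalD(2)[OF u]]
      by (subst Bochner_Integration.integral_sum) (simp_all add: L2_inner_def mult.commute)
    finally show "conv f q x = (\<Sum>i<n. L2_inner \<mu> f (u i) * u i x)" .
  qed
  have q_span: "q \<in> spanned n u" unfolding q_def by (rule spanned_member)
  have q_star: "star q = q"
  proof
    fix x
    have "star q x = cnj (q (- x + 0))" by (simp add: star_def)
    also have "\<dots> = q x" unfolding kernel by (simp add: q_def mult.commute)
    finally show "star q x = q x" .
  qed
  have q_idem: "conv q q = q"
    using conv_q[OF q_cont] spanned_expansion[OF u q_span] by simp
  have q_p: "conv q p = q" using q_span sub by (auto simp: X_def)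
  \<comment> \<open>The kernel on the diagonal is the constant \<open>q 0\<close>; integrating it
    gives the number of basis vectors, which is also the squared norm of q.\<close>
  have "q 0 = of_nat n"
  proof -
    have "q 0 = (\<integral>y. q (- y + y) \<partial>\<mu>)" using prob_space by simp
    also have "\<dots> = (\<integral>y. (\<Sum>i<n. u i y * cnj (u i y)) \<partial>\<mu>)"
      unfolding kernel by (simp add: mult.commute)
    also have "\<dots> = (\<Sum>i<n. L2_inner \<mu> (u i) (u i))"
      using L2_inner_integrable[OF orthonormalD(2)[OF u] orthonormalD(2)[OF u]]
      by (subst Bochner_Integration.integral_sum) (simp_all add: L2_inner_def)
    also have "\<dots> = of_nat n" by (simp add: orthonormalD(3)[OF u])
    finally show ?thesis .
  qed
  then have "complex_of_real ((L2_norm \<mu> q)\<^sup>2) = of_real (real n)"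
    using conv_star_0[of q q] by (simp add: q_star q_idem L2_inner_self)
  then have "(L2_norm \<mu> q)\<^sup>2 = real n" by (simp only: of_real_eq_iff)
  then have q_norm: "1 \<le> L2_norm \<mu> q"
    using n by (intro power2_le_imp_le[of 1]) simp_all
  have q_coef: "q = (\<lambda>x. \<Sum>i<n. \<Sum>j<n. (cnj (u i 0) * u j 0) * cnj (\<pi> x $$ (i, j)))"
  proof
    fix x
    show "q x = (\<Sum>i<n. \<Sum>j<n. (cnj (u i 0) * u j 0) * cnj (\<pi> x $$ (i, j)))"
      unfolding q_def by (intro sum.cong refl) (simp add: u_eq[of _ x] sum_distrib_left \<pi>_index mult_ac)
  qed
  show ?thesis
    by (rule that[OF irrep rep q_coef q_cont q_star q_idem q_p q_norm])
qed

end

section \<open>Schur's lemma and the orthogonality relations\<close>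

lemma mat_adjoint_mult:
  fixes A B :: "complex mat"
  assumes A: "A \<in> carrier_mat m n" and B: "B \<in> carrier_mat n k"
  shows "mat_adjoint (A * B) = mat_adjoint B * mat_adjoint A"
proof (rule eq_matI)
  fix i j assume "i < dim_row (mat_adjoint B * mat_adjoint A)" "j < dim_col (mat_adjoint B * mat_adjoint A)"
  then have ij: "i < k" "j < m" using A B by simp_all
  have "mat_adjoint (A * B) $$ (i, j) = cnj (\<Sum>l<n. A $$ (j, l) * B $$ (l, i))"
    using ij A B by (simp add: mat_adjoint_index mat_mult_index[OF A B] del: index_mult_mat(1))
  also have "\<dots> = (\<Sum>l<n. mat_adjoint B $$ (i, l) * mat_adjoint A $$ (l, j))"
    unfolding cnj_sum using ij carrier_matD[OF A] carrier_matD[OF B]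
    by (intro sum.cong) (simp_all add: mat_adjoint_index mult.commute)
  also have "\<dots> = (mat_adjoint B * mat_adjoint A) $$ (i, j)"
    by (rule mat_mult_index[OF mat_adjoint_carrier[OF B] mat_adjoint_carrier[OF A] ij, symmetric])
  finally show "mat_adjoint (A * B) $$ (i, j) = (mat_adjoint B * mat_adjoint A) $$ (i, j)" .
qed (use A B in simp_all)

lemma mat_adjoint_adjoint: "mat_adjoint (mat_adjoint A) = (A :: complex mat)"
  by (rule eq_matI) (simp_all add: mat_adjoint_index)

lemma unitary_rep_uminus_mat:
  assumes \<pi>: "unitary_rep n \<pi>"
  shows "\<pi> (- g) = mat_adjoint (\<pi> g)"
  using carrier_matD[OF unitary_repD(1)[OF \<pi>]]
  by (intro eq_matI) (simp_all add: mat_adjoint_index unitary_rep_uminus[OF \<pi>])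

lemma unitary_rep_dim: "unitary_rep n \<pi> \<Longrightarrow> rep_dim \<pi> = n"
  unfolding rep_dim_def using carrier_matD(1)[OF unitary_repD(1)[of n \<pi> 0]] by simp

lemma irrepsD:
  assumes "\<pi> \<in> irreps"
  shows "0 < rep_dim \<pi>" "unitary_rep (rep_dim \<pi>) \<pi>"
    "vec_subspace (rep_dim \<pi>) W \<Longrightarrow> (\<And>g v. v \<in> W \<Longrightarrow> \<pi> g *\<^sub>v v \<in> W)
      \<Longrightarrow> W = {0\<^sub>v (rep_dim \<pi>)} \<or> W = carrier_vec (rep_dim \<pi>)"
proof -
  obtain n where n: "0 < n" "unitary_rep n \<pi>"
    "\<forall>W. vec_subspace n W \<and> (\<forall>g. \<forall>v\<in>W. \<pi> g *\<^sub>v v \<in> W) \<longrightarrow> W = {0\<^sub>v n} \<or> W = carrier_vec n"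
    using assms unfolding irreps_def mem_Collect_eq by (elim exE conjE)
  then show "0 < rep_dim \<pi>" "unitary_rep (rep_dim \<pi>) \<pi>"
    "vec_subspace (rep_dim \<pi>) W \<Longrightarrow> (\<And>g v. v \<in> W \<Longrightarrow> \<pi> g *\<^sub>v v \<in> W)
      \<Longrightarrow> W = {0\<^sub>v (rep_dim \<pi>)} \<or> W = carrier_vec (rep_dim \<pi>)"
    by (simp_all add: unitary_rep_dim[OF n(2)])
qed

text \<open>An eigenspace of B is invariant under \<pi> and nonzero, so irreducibility makes it
  everything.\<close>

lemma commutant_scalar:
  assumes \<pi>: "\<pi> \<in> irreps" and n: "n = rep_dim \<pi>" and B: "B \<in> carrier_mat n n"
    and comm: "\<And>g. B * \<pi> g = \<pi> g * B"
  obtains c where "B = c \<cdot>\<^sub>m 1\<^sub>m n"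
proof -
  note rep = irrepsD(2)[OF \<pi>, folded n]
  note carr = unitary_repD(1)[OF rep]
  obtain k where "eigenvalue B k"
    using spectrum_non_empty[OF B] irrepsD(1)[OF \<pi>] n by (auto simp: spectrum_def)
  then obtain v where v: "v \<in> carrier_vec n" "v \<noteq> 0\<^sub>v n" "B *\<^sub>v v = k \<cdot>\<^sub>v v"
    using B by (auto simp: eigenvalue_def eigenvector_def)
  define W where "W = {v \<in> carrier_vec n. B *\<^sub>v v = k \<cdot>\<^sub>v v}"
  have W: "vec_subspace n W"
    unfolding vec_subspace_def
  proof (intro conjI ballI allI)
    show "W \<subseteq> carrier_vec n" by (auto simp: W_def)
    have "B *\<^sub>v 0\<^sub>v n = k \<cdot>\<^sub>v 0\<^sub>v n" by (rule eq_vecI) (use B in auto)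
    then show "0\<^sub>v n \<in> W" by (simp add: W_def)
  next
    fix u w assume "u \<in> W" "w \<in> W"
    then show "u + w \<in> W"
      by (simp add: W_def mult_add_distrib_mat_vec[OF B] smult_add_distrib_vec[of u n w])
  next
    fix c w assume "w \<in> W"
    then show "c \<cdot>\<^sub>v w \<in> W"
      by (simp add: W_def mult_mat_vec[OF B] smult_smult_assoc mult.commute)
  qed
  have W_inv: "\<pi> g *\<^sub>v w \<in> W" if w: "w \<in> W" for g w
  proof -
    have w': "w \<in> carrier_vec n" "B *\<^sub>v w = k \<cdot>\<^sub>v w" using w by (simp_all add: W_def)
    have "B *\<^sub>v (\<pi> g *\<^sub>v w) = (B * \<pi> g) *\<^sub>v w"
      by (rule assoc_mult_mat_vec[OF B carr w'(1), symmetric])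
    also have "\<dots> = \<pi> g *\<^sub>v (B *\<^sub>v w)"
      unfolding comm by (rule assoc_mult_mat_vec[OF carr B w'(1)])
    also have "\<dots> = k \<cdot>\<^sub>v (\<pi> g *\<^sub>v w)"
      unfolding w'(2) by (rule mult_mat_vec[OF carr w'(1)])
    finally show ?thesis using mult_mat_vec_carrier[OF carr w'(1)] by (simp add: W_def)
  qed
  have "v \<in> W" using v by (simp add: W_def)
  then have "W \<noteq> {0\<^sub>v n}" using v(2) by auto
  then have W_all: "W = carrier_vec n"
    using irrepsD(3)[OF \<pi>, folded n, OF W] W_inv by simp
  have "B = k \<cdot>\<^sub>m 1\<^sub>m n"
  proof (rule eq_matI)
    fix i j assume "i < dim_row (k \<cdot>\<^sub>m 1\<^sub>m n)" "j < dim_col (k \<cdot>\<^sub>m 1\<^sub>m n)"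
    then have ij: "i < n" "j < n" by simp_all
    have "unit_vec n j \<in> W" unfolding W_all by simp
    then have "(B *\<^sub>v unit_vec n j) $ i = (k \<cdot>\<^sub>v unit_vec n j) $ i" by (simp add: W_def)
    then show "B $$ (i, j) = (k \<cdot>\<^sub>m 1\<^sub>m n) $$ (i, j)"
      using ij B by (auto simp: scalar_prod_right_unit)
  qed (use B in simp_all)
  then show ?thesis by (rule that)
qed

lemma rep_equivD:
  assumes "(\<pi>, \<rho>) \<in> rep_equiv"
  obtains U where "\<pi> \<in> irreps" "\<rho> \<in> irreps" "rep_dim \<pi> = rep_dim \<rho>"
    "U \<in> carrier_mat (rep_dim \<pi>) (rep_dim \<pi>)" "mat_adjoint U * U = 1\<^sub>m (rep_dim \<pi>)"
    "\<forall>g. U * \<pi> g = \<rho> g * U"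
  using assms unfolding rep_equiv_def by auto

lemma scalar_mat_mult:
  assumes "A \<in> carrier_mat m n"
  shows "(c \<cdot>\<^sub>m 1\<^sub>m m) * A = c \<cdot>\<^sub>m A" "A * (c \<cdot>\<^sub>m 1\<^sub>m n) = c \<cdot>\<^sub>m (A :: complex mat)"
  using mult_smult_assoc_mat[OF one_carrier_mat assms, of c] mult_smult_distrib[OF assms one_carrier_mat, of c]
    left_mult_one_mat[OF assms] right_mult_one_mat[OF assms] by simp_all

text \<open>Both products of A with its adjoint A' commute with a representation and are scalar, say
  c and d. Associativity of A A' A gives c = d, and summing the squared entries of A by columns and
  by rows gives n c = m d, so the dimensions agree. Then A divided by the square root of c is
  unitary.\<close>

lemma intertwiner_equiv:
  assumes \<pi>: "\<pi> \<in> irreps" and \<rho>: "\<rho> \<in> irreps" and n: "n = rep_dim \<pi>" and m: "m = rep_dim \<rho>"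
    and A: "A \<in> carrier_mat m n" and inter: "\<And>g. A * \<pi> g = \<rho> g * A"
    and nz: "i0 < m" "j0 < n" "A $$ (i0, j0) \<noteq> 0"
  shows "(\<pi>, \<rho>) \<in> rep_equiv"
proof -
  note rep = irrepsD(2)[OF \<pi>, folded n] irrepsD(2)[OF \<rho>, folded m]
  note carr = unitary_repD(1)[OF rep(1)] unitary_repD(1)[OF rep(2)]
  define A' where "A' = mat_adjoint A"
  have A': "A' \<in> carrier_mat n m" unfolding A'_def by (rule mat_adjoint_carrier[OF A])
  have inter': "A' * \<rho> g = \<pi> g * A'" for g
  proof -
    have "mat_adjoint (\<pi> (- g)) * mat_adjoint A = mat_adjoint A * mat_adjoint (\<rho> (- g))"
      using arg_cong[OF inter[of "- g"], of mat_adjoint]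
      by (simp only: mat_adjoint_mult[OF A carr(1)] mat_adjoint_mult[OF carr(2) A])
    then show ?thesis
      by (simp add: unitary_rep_uminus_mat[OF rep(1)] unitary_rep_uminus_mat[OF rep(2)] mat_adjoint_adjoint A'_def)
  qed
  have "A' * A * \<pi> g = \<pi> g * (A' * A)" for g
  proof -
    have "A' * A * \<pi> g = A' * (\<rho> g * A)" by (simp only: assoc_mult_mat[OF A' A carr(1)] inter)
    also have "\<dots> = \<pi> g * A' * A" by (simp only: assoc_mult_mat[OF A' carr(2) A, symmetric] inter')
    also have "\<dots> = \<pi> g * (A' * A)" by (rule assoc_mult_mat[OF carr(1) A' A])
    finally show ?thesis .
  qed
  then obtain c where c: "A' * A = c \<cdot>\<^sub>m 1\<^sub>m n"
    by (rule commutant_scalar[OF \<pi> n mult_carrier_mat[OF A' A]])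
  have "A * A' * \<rho> g = \<rho> g * (A * A')" for g
  proof -
    have "A * A' * \<rho> g = A * (\<pi> g * A')" by (simp only: assoc_mult_mat[OF A A' carr(2)] inter')
    also have "\<dots> = \<rho> g * A * A'" by (simp only: assoc_mult_mat[OF A carr(1) A', symmetric] inter)
    also have "\<dots> = \<rho> g * (A * A')" by (rule assoc_mult_mat[OF carr(2) A A'])
    finally show ?thesis .
  qed
  then obtain d where d: "A * A' = d \<cdot>\<^sub>m 1\<^sub>m m"
    by (rule commutant_scalar[OF \<rho> m mult_carrier_mat[OF A A']])
  have "c \<cdot>\<^sub>m A = A * (A' * A)" unfolding c by (simp add: scalar_mat_mult[OF A])
  also have "\<dots> = (A * A') * A" by (rule assoc_mult_mat[OF A A' A, symmetric])
  also have "\<dots> = d \<cdot>\<^sub>m A" unfolding d by (simp add: scalar_mat_mult[OF A])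
  finally have "(c \<cdot>\<^sub>m A) $$ (i0, j0) = (d \<cdot>\<^sub>m A) $$ (i0, j0)" by simp
  then have cd: "c = d" using nz A by simp
  have dims: "dim_row A = m" "dim_col A = n" using A by auto
  have c_col: "c = of_real (\<Sum>i<m. (cmod (A $$ (i, j)))\<^sup>2)" if j: "j < n" for j
  proof -
    have "c = (A' * A) $$ (j, j)" using j by (simp add: c)
    also have "\<dots> = (\<Sum>i<m. cnj (A $$ (i, j)) * A $$ (i, j))"
      unfolding mat_mult_index[OF A' A j j]
      using j dims by (intro sum.cong) (simp_all add: A'_def mat_adjoint_index)
    also have "\<dots> = of_real (\<Sum>i<m. (cmod (A $$ (i, j)))\<^sup>2)"
      by (simp add: complex_norm_square mult.commute del: of_real_power)
    finally show ?thesis .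
  qed
  have d_row: "d = of_real (\<Sum>j<n. (cmod (A $$ (i, j)))\<^sup>2)" if i: "i < m" for i
  proof -
    have "d = (A * A') $$ (i, i)" using i by (simp add: d)
    also have "\<dots> = (\<Sum>j<n. A $$ (i, j) * cnj (A $$ (i, j)))"
      unfolding mat_mult_index[OF A A' i i]
      using i dims by (intro sum.cong) (simp_all add: A'_def mat_adjoint_index)
    also have "\<dots> = of_real (\<Sum>j<n. (cmod (A $$ (i, j)))\<^sup>2)"
      by (simp add: complex_norm_square del: of_real_power)
    finally show ?thesis .
  qed
  \<comment> \<open>The scalar c as a real number; it is positive because column j0 contains the
    nonzero entry.\<close>
  define r where "r = (\<Sum>i<m. (cmod (A $$ (i, j0)))\<^sup>2)"
  have c_r: "c = of_real r" unfolding r_def by (rule c_col[OF nz(2)])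
  have "0 < (cmod (A $$ (i0, j0)))\<^sup>2" using nz(3) by simp
  also have "\<dots> \<le> r" unfolding r_def using nz(1) by (intro member_le_sum) auto
  finally have r: "0 < r" .
  have "of_nat n * c = (\<Sum>j<n. c)" by simp
  also have "\<dots> = (\<Sum>j<n. of_real (\<Sum>i<m. (cmod (A $$ (i, j)))\<^sup>2))"
    by (rule sum.cong[OF refl]) (rule c_col, simp)
  also have "\<dots> = (\<Sum>i<m. of_real (\<Sum>j<n. (cmod (A $$ (i, j)))\<^sup>2))"
    unfolding of_real_sum by (rule sum.swap)
  also have "\<dots> = (\<Sum>i<m. d)"
    by (rule sum.cong[OF refl]) (rule d_row[symmetric], simp)
  finally have "of_nat n * c = of_nat m * c" by (simp add: cd)
  moreover have "c \<noteq> 0" using c_r r by simp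
  ultimately have nm: "n = m" by simp
  define z where "z = complex_of_real (1 / sqrt r)"
  have z: "cnj z * z = of_real (1 / r)"
    unfolding z_def complex_cnj_complex_of_real of_real_mult[symmetric] using r by simp
  define U where "U = z \<cdot>\<^sub>m A"
  have "mat_adjoint U * U = 1\<^sub>m n"
  proof (rule eq_matI)
    fix i j assume "i < dim_row (1\<^sub>m n :: complex mat)" "j < dim_col (1\<^sub>m n :: complex mat)"
    then have ij: "i < n" "j < n" by simp_all
    have U: "U \<in> carrier_mat m n" using A by (simp add: U_def)
    have "(mat_adjoint U * U) $$ (i, j) = (\<Sum>k<m. cnj (U $$ (k, i)) * U $$ (k, j))"
      unfolding mat_mult_index[OF mat_adjoint_carrier[OF U] U ij]
      using ij carrier_matD[OF U] by (intro sum.cong) (simp_all add: mat_adjoint_index)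
    also have "\<dots> = (\<Sum>k<m. of_real (1 / r) * (cnj (A $$ (k, i)) * A $$ (k, j)))"
      using ij dims by (intro sum.cong refl) (simp add: U_def z[symmetric] mult_ac del: of_real_divide)
    also have "\<dots> = of_real (1 / r) * (A' * A) $$ (i, j)"
      unfolding mat_mult_index[OF A' A ij] sum_distrib_left
      using ij dims by (intro sum.cong refl) (simp add: A'_def mat_adjoint_index)
    also have "\<dots> = 1\<^sub>m n $$ (i, j)" using ij r by (simp add: c c_r)
    finally show "(mat_adjoint U * U) $$ (i, j) = 1\<^sub>m n $$ (i, j)" .
  qed (use dims in \<open>simp_all add: U_def\<close>)
  moreover have "U * \<pi> g = \<rho> g * U" for g
    unfolding U_def using inter[of g] mult_smult_assoc_mat[OF A carr(1)] mult_smult_distrib[OF carr(2) A] by simp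
  moreover have "U \<in> carrier_mat n n" using A nm by (simp add: U_def)
  ultimately show ?thesis
    unfolding rep_equiv_def using \<pi> \<rho> n m nm by auto
qed

lemma rep_equiv_equiv:
  "equiv (irreps :: ('g::topological_group_add \<Rightarrow> complex mat) set) rep_equiv"
proof (rule equivI)
  show "rep_equiv \<subseteq> irreps \<times> (irreps :: ('g \<Rightarrow> complex mat) set)" by (auto simp: rep_equiv_def)
  show "refl_on irreps (rep_equiv :: (('g \<Rightarrow> complex mat) \<times> _) set)"
  proof (rule refl_onI)
    fix \<pi> :: "'g \<Rightarrow> complex mat" assume \<pi>: "\<pi> \<in> irreps"
    define n where "n = rep_dim \<pi>"
    have carr: "\<pi> g \<in> carrier_mat n n" for g
      unfolding n_def by (rule unitary_repD(1)[OF irrepsD(2)[OF \<pi>]])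
    have "1\<^sub>m n * \<pi> g = \<pi> g * 1\<^sub>m n" for g
      by (simp only: left_mult_one_mat[OF carr] right_mult_one_mat[OF carr])
    then show "(\<pi>, \<pi>) \<in> rep_equiv"
      using irrepsD(1)[OF \<pi>]
      by (intro intertwiner_equiv[OF \<pi> \<pi> n_def n_def one_carrier_mat, of 0 0]) (simp_all add: n_def)
  qed
  show "sym (rep_equiv :: (('g \<Rightarrow> complex mat) \<times> _) set)"
  proof (rule symI)
    fix \<pi> \<rho> :: "'g \<Rightarrow> complex mat" assume "(\<pi>, \<rho>) \<in> rep_equiv"
    then obtain U where U: "\<pi> \<in> irreps" "\<rho> \<in> irreps" "rep_dim \<pi> = rep_dim \<rho>"
      "U \<in> carrier_mat (rep_dim \<pi>) (rep_dim \<pi>)" "mat_adjoint U * U = 1\<^sub>m (rep_dim \<pi>)"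
      "\<forall>g. U * \<pi> g = \<rho> g * U" by (rule rep_equivD)
    define n where "n = rep_dim \<pi>"
    have n': "n = rep_dim \<rho>" using U(3) by (simp add: n_def)
    note carr = unitary_repD(1)[OF irrepsD(2)[OF U(1)], folded n_def] unitary_repD(1)[OF irrepsD(2)[OF U(2)], folded n']
    note U' = U(4)[folded n_def] and Uadj = mat_adjoint_carrier[OF U(4)[folded n_def]]
    have "mat_adjoint U * \<rho> g = \<pi> g * mat_adjoint U" for g
    proof -
      have "mat_adjoint U * \<rho> g = mat_adjoint U * (\<rho> g * (U * mat_adjoint U))"
        using mat_adjoint_right_inverse[OF U' U(5)[folded n_def]] by (simp add: right_mult_one_mat[OF carr(2)])
      also have "\<dots> = mat_adjoint U * ((\<rho> g * U) * mat_adjoint U)"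
        by (simp only: assoc_mult_mat[OF carr(2) U' Uadj])
      also have "\<dots> = mat_adjoint U * ((U * \<pi> g) * mat_adjoint U)" using U(6) by simp
      also have "\<dots> = mat_adjoint U * (U * (\<pi> g * mat_adjoint U))"
        by (simp only: assoc_mult_mat[OF U' carr(1) Uadj])
      also have "\<dots> = (mat_adjoint U * U) * (\<pi> g * mat_adjoint U)"
        by (simp only: assoc_mult_mat[OF Uadj U' mult_carrier_mat[OF carr(1) Uadj]])
      also have "\<dots> = \<pi> g * mat_adjoint U"
        unfolding U(5)[folded n_def] by (rule left_mult_one_mat[OF mult_carrier_mat[OF carr(1) Uadj]])
      finally show ?thesis .
    qed
    moreover have "mat_adjoint (mat_adjoint U) * mat_adjoint U = 1\<^sub>m n"
      unfolding mat_adjoint_adjoint by (rule mat_adjoint_right_inverse[OF U' U(5)[folded n_def]])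
    ultimately show "(\<rho>, \<pi>) \<in> rep_equiv"
      unfolding rep_equiv_def using U(1-3) n' Uadj by (auto simp: n_def intro!: bexI[of _ "mat_adjoint U"])
  qed
  show "trans (rep_equiv :: (('g \<Rightarrow> complex mat) \<times> _) set)"
  proof (rule transI)
    fix \<pi> \<rho> \<sigma> :: "'g \<Rightarrow> complex mat"
    assume 1: "(\<pi>, \<rho>) \<in> rep_equiv" and 2: "(\<rho>, \<sigma>) \<in> rep_equiv"
    obtain U where U: "\<pi> \<in> irreps" "\<rho> \<in> irreps" "rep_dim \<pi> = rep_dim \<rho>"
      "U \<in> carrier_mat (rep_dim \<pi>) (rep_dim \<pi>)" "mat_adjoint U * U = 1\<^sub>m (rep_dim \<pi>)"
      "\<forall>g. U * \<pi> g = \<rho> g * U" using 1 by (rule rep_equivD)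
    obtain V where V: "\<rho> \<in> irreps" "\<sigma> \<in> irreps" "rep_dim \<rho> = rep_dim \<sigma>"
      "V \<in> carrier_mat (rep_dim \<rho>) (rep_dim \<rho>)" "mat_adjoint V * V = 1\<^sub>m (rep_dim \<rho>)"
      "\<forall>g. V * \<rho> g = \<sigma> g * V" using 2 by (rule rep_equivD)
    define n where "n = rep_dim \<pi>"
    have n': "n = rep_dim \<rho>" "n = rep_dim \<sigma>" using U(3) V(3) by (simp_all add: n_def)
    note carr = unitary_repD(1)[OF irrepsD(2)[OF U(1)], folded n_def]
      unitary_repD(1)[OF irrepsD(2)[OF U(2)], folded n'(1)] unitary_repD(1)[OF irrepsD(2)[OF V(2)], folded n'(2)]
    note U' = U(4)[folded n_def] and V' = V(4)[folded n'(1)]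
    note Ua = mat_adjoint_carrier[OF U'] and Va = mat_adjoint_carrier[OF V']
    have "(V * U) * \<pi> g = \<sigma> g * (V * U)" for g
    proof -
      have "(V * U) * \<pi> g = V * (\<rho> g * U)"
        using U(6) by (simp only: assoc_mult_mat[OF V' U' carr(1)])
      also have "\<dots> = (\<sigma> g * V) * U"
        using V(6) by (simp only: assoc_mult_mat[OF V' carr(2) U', symmetric])
      also have "\<dots> = \<sigma> g * (V * U)" by (rule assoc_mult_mat[OF carr(3) V' U'])
      finally show ?thesis .
    qed
    moreover have "mat_adjoint (V * U) * (V * U) = 1\<^sub>m n"
    proof -
      have "mat_adjoint (V * U) * (V * U) = mat_adjoint U * (mat_adjoint V * (V * U))"
        unfolding mat_adjoint_mult[OF V' U'] by (rule assoc_mult_mat[OF Ua Va mult_carrier_mat[OF V' U']])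
      also have "\<dots> = mat_adjoint U * ((mat_adjoint V * V) * U)"
        by (simp only: assoc_mult_mat[OF Va V' U'])
      also have "\<dots> = 1\<^sub>m n"
        unfolding V(5)[folded n'(1)] left_mult_one_mat[OF U'] by (rule U(5)[folded n_def])
      finally show ?thesis .
    qed
    ultimately show "(\<pi>, \<sigma>) \<in> rep_equiv"
      unfolding rep_equiv_def using U(1) V(2) n' mult_carrier_mat[OF V' U']
      by (auto simp: n_def intro!: bexI[of _ "V * U"])
  qed
qed

lemma representative_mem:
  assumes "\<alpha> \<in> unitary_dual"
  shows "representative \<alpha> \<in> \<alpha>" "representative \<alpha> \<in> irreps"
proof -
  obtain \<pi> where \<pi>: "\<pi> \<in> irreps" "\<alpha> = rep_equiv `` {\<pi>}"
    using assms unfolding unitary_dual_def by (rule quotientE)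
  have "\<pi> \<in> \<alpha>" using equiv_class_self[OF rep_equiv_equiv \<pi>(1)] \<pi>(2) by simp
  then show 1: "representative \<alpha> \<in> \<alpha>" unfolding representative_def by (rule someI[of "\<lambda>\<pi>. \<pi> \<in> \<alpha>"])
  show "representative \<alpha> \<in> irreps" using 1 unfolding \<pi>(2) by (auto simp: rep_equiv_def)
qed

lemma representative_equiv:
  assumes \<alpha>: "\<alpha> \<in> unitary_dual" and \<beta>: "\<beta> \<in> unitary_dual"
    and "(representative \<alpha>, representative \<beta>) \<in> rep_equiv"
  shows "\<alpha> = \<beta>"
  using assms(3) quotient_eqI[OF rep_equiv_equiv, of \<alpha> \<beta>] \<alpha> \<beta> representative_mem(1)
  unfolding unitary_dual_def by blast

lemma irrep_class:
  assumes \<pi>: "\<pi> \<in> irreps"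
  obtains \<alpha> where "\<alpha> \<in> unitary_dual" "(\<pi>, representative \<alpha>) \<in> rep_equiv"
proof
  show 1: "rep_equiv `` {\<pi>} \<in> unitary_dual"
    unfolding unitary_dual_def by (rule quotientI[OF \<pi>])
  show "(\<pi>, representative (rep_equiv `` {\<pi>})) \<in> rep_equiv"
    using representative_mem(1)[OF 1] by simp
qed

context haar_group
begin

lemma cont_coef:
  assumes "unitary_rep n \<pi>" "i < n" "j < n"
  shows "cont (\<lambda>x. cnj (\<pi> x $$ (i, j)))" "cont (\<lambda>x. \<pi> x $$ (i, j))"
  using unitary_repD(4)[OF assms] by (auto intro: continuous_on_cnj)

text \<open>M is the average over g of \<rho>(g) E \<pi>(g)\<inverse> with E the matrix unit at (a,
  b), written in entries by means of unitarity. Left invariance of \<mu> makes the average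
  intertwine.\<close>

lemma averaged_intertwiner:
  assumes \<pi>: "unitary_rep n \<pi>" and \<rho>: "unitary_rep m \<rho>" and ab: "a < m" "b < n"
  defines "M \<equiv> mat m n (\<lambda>(i, j). \<integral>g. \<rho> g $$ (i, a) * cnj (\<pi> g $$ (j, b)) \<partial>\<mu>)"
  shows "M * \<pi> h = \<rho> h * M"
proof (rule eq_matI)
  have M: "M \<in> carrier_mat m n" by (simp add: M_def)
  have M_index: "M $$ (i, j) = (\<integral>g. \<rho> g $$ (i, a) * cnj (\<pi> g $$ (j, b)) \<partial>\<mu>)" if "i < m" "j < n" for i j
    using that by (simp add: M_def)
  have int: "integrable \<mu> (\<lambda>g. \<rho> g $$ (i, a) * cnj (\<pi> g $$ (j, b)))" if "i < m" "j < n" for i j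
    using that ab by (intro cont_integrable continuous_on_mult cont_coef[OF \<pi>] cont_coef[OF \<rho>])
  fix i k assume "i < dim_row (\<rho> h * M)" "k < dim_col (\<rho> h * M)"
  then have ik: "i < m" "k < n" using carrier_matD[OF unitary_repD(1)[OF \<rho>]] M by simp_all
  have eq: "(\<Sum>j<n. cnj (\<pi> g $$ (j, b)) * \<pi> h $$ (j, k)) = cnj (\<pi> (- h + g) $$ (k, b))" for g
  proof -
    have "(\<Sum>j<n. cnj (\<pi> g $$ (j, b)) * \<pi> h $$ (j, k)) = (\<Sum>j<n. \<pi> (- g) $$ (b, j) * \<pi> h $$ (j, k))"
      using ab by (intro sum.cong refl) (simp add: unitary_rep_uminus[OF \<pi>])
    also have "\<dots> = \<pi> (- g + h) $$ (b, k)" by (rule unitary_rep_add[OF \<pi> ab(2) ik(2), symmetric])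
    also have "- g + h = - (- h + g)" by (simp add: minus_add)
    finally show ?thesis by (simp only: unitary_rep_uminus[OF \<pi> ab(2) ik(2)])
  qed
  have "(M * \<pi> h) $$ (i, k) = (\<Sum>j<n. (\<integral>g. \<rho> g $$ (i, a) * cnj (\<pi> g $$ (j, b)) \<partial>\<mu>) * \<pi> h $$ (j, k))"
    unfolding mat_mult_index[OF M unitary_repD(1)[OF \<pi>] ik] by (simp add: M_index ik)
  also have "\<dots> = (\<Sum>j<n. \<integral>g. \<rho> g $$ (i, a) * cnj (\<pi> g $$ (j, b)) * \<pi> h $$ (j, k) \<partial>\<mu>)"
    by simp
  also have "\<dots> = (\<integral>g. (\<Sum>j<n. \<rho> g $$ (i, a) * cnj (\<pi> g $$ (j, b)) * \<pi> h $$ (j, k)) \<partial>\<mu>)"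
    by (rule Bochner_Integration.integral_sum[symmetric]) (use int ik in simp)
  also have "\<dots> = (\<integral>g. \<rho> g $$ (i, a) * cnj (\<pi> (- h + g) $$ (k, b)) \<partial>\<mu>)"
    by (simp only: eq[symmetric] sum_distrib_left mult.assoc)
  also have "\<dots> = (\<integral>g. \<rho> (h + g) $$ (i, a) * cnj (\<pi> g $$ (k, b)) \<partial>\<mu>)"
  proof -
    have "cont (\<lambda>g. \<rho> g $$ (i, a) * cnj (\<pi> (- h + g) $$ (k, b)))"
      using ik ab by (intro continuous_on_mult cont_coef[OF \<rho>] cont_translate(1)[OF cont_coef(1)[OF \<pi>]])
    from integral_translate(1)[OF cont_measurable[OF this], of h] show ?thesis
      by (simp add: add.assoc[symmetric])
  qed
  also have "\<dots> = (\<integral>g. (\<Sum>l<m. \<rho> h $$ (i, l) * (\<rho> g $$ (l, a) * cnj (\<pi> g $$ (k, b)))) \<partial>\<mu>)"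
    by (simp only: unitary_rep_add[OF \<rho> ik(1) ab(1)] sum_distrib_right mult.assoc)
  also have "\<dots> = (\<Sum>l<m. \<integral>g. \<rho> h $$ (i, l) * (\<rho> g $$ (l, a) * cnj (\<pi> g $$ (k, b))) \<partial>\<mu>)"
    by (rule Bochner_Integration.integral_sum) (use int ik in simp)
  also have "\<dots> = (\<Sum>l<m. \<rho> h $$ (i, l) * M $$ (l, k))" by (simp add: M_index ik)
  also have "\<dots> = (\<rho> h * M) $$ (i, k)"
    by (rule mat_mult_index[OF unitary_repD(1)[OF \<rho>] M ik, symmetric])
  finally show "(M * \<pi> h) $$ (i, k) = (\<rho> h * M) $$ (i, k)" .
qed (use carrier_matD[OF unitary_repD(1)[OF \<rho>]] carrier_matD[OF unitary_repD(1)[OF \<pi>]] in \<open>simp_all add: M_def\<close>)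

lemma schur_inequivalent:
  assumes \<pi>: "\<pi> \<in> irreps" and \<rho>: "\<rho> \<in> irreps" and "(\<pi>, \<rho>) \<notin> rep_equiv"
    and "i < rep_dim \<rho>" "a < rep_dim \<rho>" "j < rep_dim \<pi>" "b < rep_dim \<pi>"
  shows "(\<integral>g. \<rho> g $$ (i, a) * cnj (\<pi> g $$ (j, b)) \<partial>\<mu>) = 0"
proof (rule ccontr)
  let ?M = "mat (rep_dim \<rho>) (rep_dim \<pi>) (\<lambda>(i, j). \<integral>g. \<rho> g $$ (i, a) * cnj (\<pi> g $$ (j, b)) \<partial>\<mu>)"
  assume "(\<integral>g. \<rho> g $$ (i, a) * cnj (\<pi> g $$ (j, b)) \<partial>\<mu>) \<noteq> 0"
  then have "?M $$ (i, j) \<noteq> 0" using assms by simp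
  then have "(\<pi>, \<rho>) \<in> rep_equiv"
    using assms(4-7)
    by (intro intertwiner_equiv[OF \<pi> \<rho> refl refl _ averaged_intertwiner[OF irrepsD(2)[OF \<pi>] irrepsD(2)[OF \<rho>] assms(5,7)],
          of i j]) auto
  then show False using assms(3) by simp
qed

lemma schur_orthogonality:
  assumes \<pi>: "\<pi> \<in> irreps" and n: "n = rep_dim \<pi>" and "i < n" "a < n" "j < n" "b < n"
  shows "(\<integral>g. \<pi> g $$ (i, a) * cnj (\<pi> g $$ (j, b)) \<partial>\<mu>) = of_bool (i = j) * of_bool (a = b) / of_nat n"
proof -
  let ?M = "mat n n (\<lambda>(i, j). \<integral>g. \<pi> g $$ (i, a) * cnj (\<pi> g $$ (j, b)) \<partial>\<mu>)"
  note rep = irrepsD(2)[OF \<pi>, folded n]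
  obtain c where c: "?M = c \<cdot>\<^sub>m 1\<^sub>m n"
    by (rule commutant_scalar[OF \<pi> n mat_carrier averaged_intertwiner[OF rep rep assms(4,6)]])
  have M_index: "(\<integral>g. \<pi> g $$ (k, a) * cnj (\<pi> g $$ (l, b)) \<partial>\<mu>) = c * of_bool (k = l)" if "k < n" "l < n" for k l
    using arg_cong[OF c, of "\<lambda>M. M $$ (k, l)"] that by simp
  \<comment> \<open>The scalar c is found from the trace, because the columns of \<pi> g are
    orthonormal for every g.\<close>
  have "of_nat n * c = (\<Sum>k<n. \<integral>g. \<pi> g $$ (k, a) * cnj (\<pi> g $$ (k, b)) \<partial>\<mu>)"
    by (simp add: M_index)
  also have "\<dots> = (\<integral>g. (\<Sum>k<n. \<pi> g $$ (k, a) * cnj (\<pi> g $$ (k, b))) \<partial>\<mu>)"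
    using assms by (intro Bochner_Integration.integral_sum[symmetric] cont_integrable continuous_on_mult
        cont_coef[OF rep]) simp_all
  also have "\<dots> = (\<integral>g. of_bool (b = a) \<partial>\<mu>)"
    using unitary_rep_cols[OF rep assms(6,4)] by (simp add: mult.commute)
  also have "\<dots> = of_bool (a = b)" using prob_space by (simp add: eq_commute[of b a])
  finally show ?thesis
    using M_index[OF assms(3,5)] irrepsD(1)[OF \<pi>] n by (simp add: field_simps)
qed

section \<open>Matrix coefficients and trigonometric polynomials\<close>

text \<open>The conjugate makes the span of \<open>coef \<pi> j i\<close> with i fixed a copy of
  \<pi> under left translation, rather than of the conjugate representation.\<close>

definition coef :: "('g \<Rightarrow> complex mat) \<Rightarrow> nat \<Rightarrow> nat \<Rightarrow> 'g \<Rightarrow> complex" where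
  "coef \<pi> i j = (\<lambda>x. cnj (\<pi> x $$ (i, j)))"

lemma cont_coef': "unitary_rep n \<pi> \<Longrightarrow> i < n \<Longrightarrow> j < n \<Longrightarrow> cont (coef \<pi> i j)"
  unfolding coef_def by (rule cont_coef(1))

definition coef_space :: "('g \<Rightarrow> complex mat) \<Rightarrow> ('g \<Rightarrow> complex) set" where
  "coef_space \<pi> = {\<lambda>x. \<Sum>i<rep_dim \<pi>. \<Sum>j<rep_dim \<pi>. c i j * coef \<pi> i j x | c. True}"

lemma coef_spaceI: "(\<lambda>x. \<Sum>i<rep_dim \<pi>. \<Sum>j<rep_dim \<pi>. c i j * coef \<pi> i j x) \<in> coef_space \<pi>"
  unfolding coef_space_def mem_Collect_eq by (rule exI[of _ c]) simp

lemma coef_space_add: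
  assumes "f \<in> coef_space \<pi>" "g \<in> coef_space \<pi>"
  shows "(\<lambda>x. f x + g x) \<in> coef_space \<pi>"
proof -
  obtain c d where "f = (\<lambda>x. \<Sum>i<rep_dim \<pi>. \<Sum>j<rep_dim \<pi>. c i j * coef \<pi> i j x)"
    "g = (\<lambda>x. \<Sum>i<rep_dim \<pi>. \<Sum>j<rep_dim \<pi>. d i j * coef \<pi> i j x)"
    using assms unfolding coef_space_def mem_Collect_eq by (elim exE conjE)
  then show ?thesis
    using coef_spaceI[where \<pi>=\<pi> and c="\<lambda>i j. c i j + d i j"] by (simp add: distrib_right sum.distrib)
qed

lemma coef_space_scale:
  assumes "f \<in> coef_space \<pi>"
  shows "(\<lambda>x. a * f x) \<in> coef_space \<pi>"
proof -
  obtain c where "f = (\<lambda>x. \<Sum>i<rep_dim \<pi>. \<Sum>j<rep_dim \<pi>. c i j * coef \<pi> i j x)"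
    using assms unfolding coef_space_def mem_Collect_eq by (elim exE conjE)
  then show ?thesis
    using coef_spaceI[where \<pi>=\<pi> and c="\<lambda>i j. a * c i j"] by (simp add: sum_distrib_left mult.assoc)
qed

lemma coef_space_0: "(\<lambda>x. 0) \<in> coef_space \<pi>"
  using coef_spaceI[where \<pi>=\<pi> and c="\<lambda>i j. 0"] by simp

lemma coef_space_sum: "(\<And>i. i \<in> I \<Longrightarrow> f i \<in> coef_space \<pi>) \<Longrightarrow> (\<lambda>x. \<Sum>i\<in>I. f i x) \<in> coef_space \<pi>"
  by (induction I rule: infinite_finite_induct) (simp_all add: coef_space_0 coef_space_add)

lemma coef_space_double_sum:
  fixes n m :: nat
  assumes "\<And>i j. i < n \<Longrightarrow> j < m \<Longrightarrow> f i j \<in> coef_space \<pi>"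
  shows "(\<lambda>x. \<Sum>i<n. \<Sum>j<m. c i j * f i j x) \<in> coef_space \<pi>"
  by (intro coef_space_sum coef_space_scale assms) simp_all

lemma coef_in_coef_space:
  assumes "a < rep_dim \<pi>" "b < rep_dim \<pi>"
  shows "coef \<pi> a b \<in> coef_space \<pi>"
proof -
  have "(\<Sum>i<rep_dim \<pi>. \<Sum>j<rep_dim \<pi>. of_bool (i = a) * of_bool (j = b) * coef \<pi> i j x) = coef \<pi> a b x" for x
    by (simp add: mult.assoc sum_distrib_left[symmetric] delta_sum(3)[OF assms(1)] delta_sum(3)[OF assms(2)])
  then show ?thesis
    using coef_spaceI[where \<pi>=\<pi> and c="\<lambda>i j. of_bool (i = a) * of_bool (j = b)"] by simp
qed

lemma coef_space_cont:
  assumes \<pi>: "\<pi> \<in> irreps" and "f \<in> coef_space \<pi>"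
  shows "cont f"
proof -
  obtain c where c: "f = (\<lambda>x. \<Sum>i<rep_dim \<pi>. \<Sum>j<rep_dim \<pi>. c i j * coef \<pi> i j x)"
    using assms unfolding coef_space_def mem_Collect_eq by (elim exE conjE)
  show ?thesis
    unfolding c
    by (intro continuous_on_sum continuous_on_mult continuous_on_const cont_coef'[OF irrepsD(2)[OF \<pi>]]) simp_all
qed

text \<open>Conjugation by U expresses each entry of \<pi> through entries of \<rho>. It allows the
  coefficients of any irreducible representation to be counted among those of the chosen
  representative of its class.\<close>

lemma coef_space_equiv:
  assumes "(\<pi>, \<rho>) \<in> rep_equiv"
  shows "coef_space \<pi> \<subseteq> coef_space \<rho>"
proof
  fix f assume "f \<in> coef_space \<pi>"
  obtain U where U: "\<pi> \<in> irreps" "\<rho> \<in> irreps" "rep_dim \<pi> = rep_dim \<rho>"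
    "U \<in> carrier_mat (rep_dim \<pi>) (rep_dim \<pi>)" "mat_adjoint U * U = 1\<^sub>m (rep_dim \<pi>)"
    "\<forall>g. U * \<pi> g = \<rho> g * U" using assms by (rule rep_equivD)
  define n where "n = rep_dim \<pi>"
  have n': "n = rep_dim \<rho>" using U(3) by (simp add: n_def)
  note carr = unitary_repD(1)[OF irrepsD(2)[OF U(1)], folded n_def] unitary_repD(1)[OF irrepsD(2)[OF U(2)], folded n']
  note U' = U(4)[folded n_def] and Ua = mat_adjoint_carrier[OF U(4)[folded n_def]]
  have "\<pi> x = mat_adjoint U * (\<rho> x * U)" for x
  proof -
    have "\<pi> x = (mat_adjoint U * U) * \<pi> x"
      unfolding U(5)[folded n_def] by (rule left_mult_one_mat[OF carr(1), symmetric])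
    also have "\<dots> = mat_adjoint U * (U * \<pi> x)" by (rule assoc_mult_mat[OF Ua U' carr(1)])
    finally show ?thesis using U(6) by simp
  qed
  then have entry: "\<pi> x $$ (i, j) = (\<Sum>k<n. cnj (U $$ (k, i)) * (\<Sum>l<n. \<rho> x $$ (k, l) * U $$ (l, j)))"
    if "i < n" "j < n" for x i j
    using that mat_mult_index[OF Ua mult_carrier_mat[OF carr(2) U'] that] carrier_matD[OF U']
    by (simp add: mat_mult_index[OF carr(2) U'] mat_adjoint_index del: index_mult_mat(1))
  have "coef \<pi> i j \<in> coef_space \<rho>" if ij: "i < n" "j < n" for i j
  proof -
    have "coef \<pi> i j = (\<lambda>x. \<Sum>k<rep_dim \<rho>. \<Sum>l<rep_dim \<rho>. (U $$ (k, i) * cnj (U $$ (l, j))) * coef \<rho> k l x)"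
      by (simp add: coef_def entry[OF ij] n'[symmetric] sum_distrib_left mult_ac)
    then show ?thesis using coef_spaceI by simp
  qed
  moreover obtain c where "f = (\<lambda>x. \<Sum>i<n. \<Sum>j<n. c i j * coef \<pi> i j x)"
    using \<open>f \<in> coef_space \<pi>\<close> unfolding coef_space_def mem_Collect_eq n_def by (elim exE conjE)
  ultimately show "f \<in> coef_space \<rho>"
    using coef_space_double_sum[of n n "coef \<pi>" \<rho> c] by simp
qed

text \<open>\<open>coef \<pi> i j (y + x)\<close> is a sum of products over a middle index.
  Convolution from the left mixes first indices and convolution from the right second ones, so
  coefficients form a two-sided ideal.\<close>

lemma conv_coef:
  assumes \<pi>: "unitary_rep n \<pi>" and ij: "i < n" "j < n" and f: "cont f"
  shows "conv f (coef \<pi> i j) = (\<lambda>x. \<Sum>k<n. (\<integral>y. f y * coef \<pi> i k (- y) \<partial>\<mu>) * coef \<pi> k j x)"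
    and "conv (coef \<pi> i j) f = (\<lambda>x. \<Sum>k<n. (\<integral>y. coef \<pi> k j y * f (- y) \<partial>\<mu>) * coef \<pi> i k x)"
proof -
  have add: "coef \<pi> i j (y + x) = (\<Sum>k<n. coef \<pi> i k y * coef \<pi> k j x)" for x y
    by (simp add: coef_def unitary_rep_add[OF \<pi> ij])
  have int1: "integrable \<mu> (\<lambda>y. f y * coef \<pi> i k (- y))" if "k < n" for k
    by (intro cont_integrable continuous_on_mult f cont_translate(3) cont_coef'[OF \<pi> ij(1) that])
  have int2: "integrable \<mu> (\<lambda>y. coef \<pi> k j y * f (- y))" if "k < n" for k
    by (intro cont_integrable continuous_on_mult cont_translate(3) f cont_coef'[OF \<pi> that ij(2)])
  show "conv f (coef \<pi> i j) = (\<lambda>x. \<Sum>k<n. (\<integral>y. f y * coef \<pi> i k (- y) \<partial>\<mu>) * coef \<pi> k j x)"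
  proof
    fix x
    have "conv f (coef \<pi> i j) x = (\<integral>y. (\<Sum>k<n. f y * coef \<pi> i k (- y) * coef \<pi> k j x) \<partial>\<mu>)"
      by (simp add: conv_def add sum_distrib_left mult.assoc)
    also have "\<dots> = (\<Sum>k<n. \<integral>y. f y * coef \<pi> i k (- y) * coef \<pi> k j x \<partial>\<mu>)"
      by (rule Bochner_Integration.integral_sum) (use int1 in simp)
    finally show "conv f (coef \<pi> i j) x = (\<Sum>k<n. (\<integral>y. f y * coef \<pi> i k (- y) \<partial>\<mu>) * coef \<pi> k j x)"
      by simp
  qed
  show "conv (coef \<pi> i j) f = (\<lambda>x. \<Sum>k<n. (\<integral>y. coef \<pi> k j y * f (- y) \<partial>\<mu>) * coef \<pi> i k x)"
  proof
    fix x
    have "cont (\<lambda>y. coef \<pi> i j y * f (- y + x))"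
      by (intro continuous_on_mult cont_translate f cont_coef'[OF \<pi> ij])
    from integral_translate(1)[OF cont_measurable[OF this], of x]
    have "conv (coef \<pi> i j) f x = (\<integral>y. coef \<pi> i j (x + y) * f (- y) \<partial>\<mu>)"
      by (simp add: conv_def minus_add add.assoc)
    also have "\<dots> = (\<integral>y. (\<Sum>k<n. coef \<pi> i k x * (coef \<pi> k j y * f (- y))) \<partial>\<mu>)"
      by (simp add: add sum_distrib_right mult.assoc)
    also have "\<dots> = (\<Sum>k<n. \<integral>y. coef \<pi> i k x * (coef \<pi> k j y * f (- y)) \<partial>\<mu>)"
      by (rule Bochner_Integration.integral_sum) (use int2 in simp)
    finally show "conv (coef \<pi> i j) f x = (\<Sum>k<n. (\<integral>y. coef \<pi> k j y * f (- y) \<partial>\<mu>) * coef \<pi> i k x)"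
      by (simp add: mult.commute)
  qed
qed

lemma conv_sum:
  assumes "\<And>i. i \<in> I \<Longrightarrow> cont (f i)" "cont g"
  shows "conv (\<lambda>x. \<Sum>i\<in>I. f i x) g = (\<lambda>x. \<Sum>i\<in>I. conv (f i) g x)"
    and "conv g (\<lambda>x. \<Sum>i\<in>I. f i x) = (\<lambda>x. \<Sum>i\<in>I. conv g (f i) x)"
proof -
  show "conv (\<lambda>x. \<Sum>i\<in>I. f i x) g = (\<lambda>x. \<Sum>i\<in>I. conv (f i) g x)"
    unfolding conv_def sum_distrib_right
    by (intro ext Bochner_Integration.integral_sum conv_integrable cont_L2 assms)
  show "conv g (\<lambda>x. \<Sum>i\<in>I. f i x) = (\<lambda>x. \<Sum>i\<in>I. conv g (f i) x)"
    unfolding conv_def sum_distrib_left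
    by (intro ext Bochner_Integration.integral_sum conv_integrable cont_L2 assms)
qed

lemma conv_coef_space:
  assumes \<pi>: "\<pi> \<in> irreps" and h: "h \<in> coef_space \<pi>" and f: "cont f"
  shows "conv f h \<in> coef_space \<pi>" "conv h f \<in> coef_space \<pi>"
proof -
  obtain c where c: "h = (\<lambda>x. \<Sum>i<rep_dim \<pi>. \<Sum>j<rep_dim \<pi>. c i j * coef \<pi> i j x)"
    using h unfolding coef_space_def mem_Collect_eq by (elim exE conjE)
  note rep = irrepsD(2)[OF \<pi>]
  have mem: "conv f (coef \<pi> i j) \<in> coef_space \<pi>" "conv (coef \<pi> i j) f \<in> coef_space \<pi>"
    if "i < rep_dim \<pi>" "j < rep_dim \<pi>" for i j
    unfolding conv_coef[OF rep that f] using that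
    by (intro coef_space_sum coef_space_scale coef_in_coef_space; simp)+
  have cont1: "cont (\<lambda>x. c i j * coef \<pi> i j x)" if "i < rep_dim \<pi>" "j < rep_dim \<pi>" for i j
    by (intro continuous_on_mult continuous_on_const cont_coef'[OF rep] that)
  have cont2: "cont (\<lambda>x. \<Sum>j<rep_dim \<pi>. c i j * coef \<pi> i j x)" if "i < rep_dim \<pi>" for i
    by (intro continuous_on_sum cont1) (use that in simp_all)
  have inner1: "conv f (\<lambda>x. \<Sum>j<rep_dim \<pi>. c i j * coef \<pi> i j x)
      = (\<lambda>x. \<Sum>j<rep_dim \<pi>. c i j * conv f (coef \<pi> i j) x)" if i: "i < rep_dim \<pi>" for i
    by (subst conv_sum(2)) (use cont1[OF i] f in \<open>simp_all add: conv_scale\<close>)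
  have inner2: "conv (\<lambda>x. \<Sum>j<rep_dim \<pi>. c i j * coef \<pi> i j x) f
      = (\<lambda>x. \<Sum>j<rep_dim \<pi>. c i j * conv (coef \<pi> i j) f x)" if i: "i < rep_dim \<pi>" for i
    by (subst conv_sum(1)) (use cont1[OF i] f in \<open>simp_all add: conv_scale\<close>)
  have "conv f h = (\<lambda>x. \<Sum>i<rep_dim \<pi>. conv f (\<lambda>x. \<Sum>j<rep_dim \<pi>. c i j * coef \<pi> i j x) x)"
    unfolding c by (rule conv_sum(2)) (use cont2 f in simp_all)
  also have "\<dots> = (\<lambda>x. \<Sum>i<rep_dim \<pi>. \<Sum>j<rep_dim \<pi>. c i j * conv f (coef \<pi> i j) x)"
    by (intro ext sum.cong refl) (simp add: inner1)
  finally show "conv f h \<in> coef_space \<pi>"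
    using coef_space_double_sum[OF mem(1)] by simp
  have "conv h f = (\<lambda>x. \<Sum>i<rep_dim \<pi>. conv (\<lambda>x. \<Sum>j<rep_dim \<pi>. c i j * coef \<pi> i j x) f x)"
    unfolding c by (rule conv_sum(1)) (use cont2 f in simp_all)
  also have "\<dots> = (\<lambda>x. \<Sum>i<rep_dim \<pi>. \<Sum>j<rep_dim \<pi>. c i j * conv (coef \<pi> i j) f x)"
    by (intro ext sum.cong refl) (simp add: inner2)
  finally show "conv h f \<in> coef_space \<pi>"
    using coef_space_double_sum[OF mem(2)] by simp
qed

text \<open>Sorted by classes, so that each element comes with a finite set of \<alpha>; that set is
  the threshold in the net of partial sums.\<close>

definition trig_polys :: "('g \<Rightarrow> complex) set" where
  "trig_polys = {\<lambda>x. \<Sum>\<alpha>\<in>F. h \<alpha> x | F h. finite F \<and> F \<subseteq> unitary_dual \<and>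
     (\<forall>\<alpha>\<in>F. h \<alpha> \<in> coef_space (representative \<alpha>))}"

lemma trig_polysE:
  assumes "f \<in> trig_polys"
  obtains F h where "f = (\<lambda>x. \<Sum>\<alpha>\<in>F. h \<alpha> x)" "finite F" "F \<subseteq> unitary_dual"
    "\<forall>\<alpha>\<in>F. h \<alpha> \<in> coef_space (representative \<alpha>)"
  using assms unfolding trig_polys_def mem_Collect_eq by (elim exE conjE)

lemma trig_polysI:
  assumes "finite F" "F \<subseteq> unitary_dual" "\<And>\<alpha>. \<alpha> \<in> F \<Longrightarrow> h \<alpha> \<in> coef_space (representative \<alpha>)"
  shows "(\<lambda>x. \<Sum>\<alpha>\<in>F. h \<alpha> x) \<in> trig_polys"
  unfolding trig_polys_def mem_Collect_eq using assms by (intro exI[of _ F] exI[of _ h]) simp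

lemma trig_polys_add:
  assumes "f \<in> trig_polys" "g \<in> trig_polys"
  shows "(\<lambda>x. f x + g x) \<in> trig_polys"
proof -
  obtain F h where f: "f = (\<lambda>x. \<Sum>\<alpha>\<in>F. h \<alpha> x)" "finite F" "F \<subseteq> unitary_dual"
    "\<forall>\<alpha>\<in>F. h \<alpha> \<in> coef_space (representative \<alpha>)" using assms(1) by (rule trig_polysE)
  obtain G k where g: "g = (\<lambda>x. \<Sum>\<alpha>\<in>G. k \<alpha> x)" "finite G" "G \<subseteq> unitary_dual"
    "\<forall>\<alpha>\<in>G. k \<alpha> \<in> coef_space (representative \<alpha>)" using assms(2) by (rule trig_polysE)
  define h' where "h' \<alpha> = (if \<alpha> \<in> F then h \<alpha> else (\<lambda>x. 0))" for \<alpha>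
  define k' where "k' \<alpha> = (if \<alpha> \<in> G then k \<alpha> else (\<lambda>x. 0))" for \<alpha>
  have f': "f x = (\<Sum>\<alpha>\<in>F \<union> G. h' \<alpha> x)" for x
    unfolding f(1) using f(2) g(2) by (intro sum.mono_neutral_cong_left) (auto simp: h'_def)
  have g': "g x = (\<Sum>\<alpha>\<in>F \<union> G. k' \<alpha> x)" for x
    unfolding g(1) using f(2) g(2) by (intro sum.mono_neutral_cong_left) (auto simp: k'_def)
  have "(\<lambda>x. \<Sum>\<alpha>\<in>F \<union> G. h' \<alpha> x + k' \<alpha> x) \<in> trig_polys"
    by (rule trig_polysI) (use f g in \<open>auto simp: h'_def k'_def intro!: coef_space_add coef_space_0\<close>)
  then show ?thesis by (simp add: f' g' sum.distrib)
qed

lemma trig_polys_0: "(\<lambda>x. 0) \<in> trig_polys"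
  using trig_polysI[of "{}" "\<lambda>_ _. 0"] by simp

lemma trig_polys_cont:
  assumes "f \<in> trig_polys"
  shows "cont f"
proof -
  obtain F h where f: "f = (\<lambda>x. \<Sum>\<alpha>\<in>F. h \<alpha> x)" "finite F" "F \<subseteq> unitary_dual"
    "\<forall>\<alpha>\<in>F. h \<alpha> \<in> coef_space (representative \<alpha>)" using assms(1) by (rule trig_polysE)
  show ?thesis
    unfolding f(1)
  proof (rule continuous_on_sum)
    fix \<alpha> assume "\<alpha> \<in> F"
    then show "cont (h \<alpha>)"
      using f(3,4) by (intro coef_space_cont[of "representative \<alpha>"] representative_mem(2)) auto
  qed
qed

lemma trig_polys_conv:
  assumes f: "f \<in> trig_polys" and g: "cont g"
  shows "conv g f \<in> trig_polys" "conv f g \<in> trig_polys"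
proof -
  obtain F h where f: "f = (\<lambda>x. \<Sum>\<alpha>\<in>F. h \<alpha> x)" "finite F" "F \<subseteq> unitary_dual"
    "\<forall>\<alpha>\<in>F. h \<alpha> \<in> coef_space (representative \<alpha>)" using f by (rule trig_polysE)
  have irr: "representative \<alpha> \<in> irreps" if "\<alpha> \<in> F" for \<alpha>
    using that f(3) by (intro representative_mem(2)) auto
  have h_cont: "cont (h \<alpha>)" if "\<alpha> \<in> F" for \<alpha>
    using f(4) that by (intro coef_space_cont[OF irr[OF that]]) simp
  have "conv g f = (\<lambda>x. \<Sum>\<alpha>\<in>F. conv g (h \<alpha>) x)" "conv f g = (\<lambda>x. \<Sum>\<alpha>\<in>F. conv (h \<alpha>) g x)"
    unfolding f(1) by (rule conv_sum[OF h_cont g], assumption)+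
  then show "conv g f \<in> trig_polys" "conv f g \<in> trig_polys"
    using trig_polysI[OF f(2,3), of "\<lambda>\<alpha>. conv g (h \<alpha>)"] trig_polysI[OF f(2,3), of "\<lambda>\<alpha>. conv (h \<alpha>) g"]
      conv_coef_space[OF irr _ g] f(4) by simp_all
qed

lemma coef_space_trig_polys:
  assumes \<pi>: "\<pi> \<in> irreps" and f: "f \<in> coef_space \<pi>"
  shows "f \<in> trig_polys"
proof -
  obtain \<alpha> where \<alpha>: "\<alpha> \<in> unitary_dual" "(\<pi>, representative \<alpha>) \<in> rep_equiv"
    using irrep_class[OF \<pi>] .
  have "f \<in> coef_space (representative \<alpha>)" using coef_space_equiv[OF \<alpha>(2)] f by auto
  then show ?thesis using trig_polysI[of "{\<alpha>}" "\<lambda>_. f"] \<alpha>(1) by simp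
qed

end

section \<open>Density of the matrix coefficients\<close>

context haar_group
begin

text \<open>What is approximated is k * k and not k: a small \<Lambda> controls the norm of r * r,
  while r itself may remain large.\<close>

lemma conv_trig_approx:
  assumes k: "cont k" "star k = k" and e: "0 < e"
  obtains h where "h \<in> trig_polys" "L2_norm \<mu> (\<lambda>x. conv k k x - h x) \<le> e"
proof -
  define S where "S = {r. cont r \<and> star r = r \<and> (\<lambda>x. k x - r x) \<in> trig_polys}"
  define I where "I = (INF r\<in>S. (L2_norm \<mu> r)\<^sup>2)"
  define K where "K = (L2_norm \<mu> k)\<^sup>2"
  \<comment> \<open>The bound 1 keeps the squared norm of r below K + 1. Then \<Lambda> < d makes
    that of r * r at most d (K + 1), hence at most the square of e.\<close>
  define d where "d = min 1 (e\<^sup>2 / (K + 1))"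
  have K: "0 \<le> K" by (simp add: K_def)
  have d: "0 < d" "d \<le> 1" "d * (K + 1) \<le> e\<^sup>2"
  proof -
    show "0 < d" "d \<le> 1" using e K by (simp_all add: d_def)
    have "d * (K + 1) \<le> e\<^sup>2 / (K + 1) * (K + 1)"
      using K by (intro mult_right_mono) (simp_all add: d_def)
    then show "d * (K + 1) \<le> e\<^sup>2" using K by simp
  qed
  have k_S: "k \<in> S" using k trig_polys_0 by (simp add: S_def)
  have bdd: "bdd_below ((\<lambda>r. (L2_norm \<mu> r)\<^sup>2) ` S)" by (rule bdd_belowI[of _ 0]) auto
  have I_le: "I \<le> (L2_norm \<mu> r)\<^sup>2" if "r \<in> S" for r
    unfolding I_def by (rule cINF_lower[OF bdd that])
  have "\<exists>r\<in>S. (L2_norm \<mu> r)\<^sup>2 < I + d"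
    using cINF_less_iff[of S "\<lambda>r. (L2_norm \<mu> r)\<^sup>2" "I + d"] k_S bdd d(1) by (auto simp: I_def[symmetric])
  then obtain r where r_S: "r \<in> S" and r_less: "(L2_norm \<mu> r)\<^sup>2 < I + d" by blast
  have r: "cont r" "star r = r" "(\<lambda>x. k x - r x) \<in> trig_polys" using r_S by (simp_all add: S_def)
  have small: "(L2_norm \<mu> (conv r r))\<^sup>2 \<le> e\<^sup>2"
  proof (cases "L2_norm \<mu> r = 0")
    case True
    then have "L2_norm \<mu> (conv r r) = 0"
      using L2_norm_conv[OF cont_L2[OF r(1)] r(1)] L2_norm_nonneg[of "conv r r"] by simp
    then show ?thesis by simp
  next
    case False
    obtain p \<Lambda> where \<Lambda>: "0 < \<Lambda>" and p: "cont p" "star p = p" "conv p p = p"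
      "conv (conv r r) p = (\<lambda>x. of_real \<Lambda> * p x)" "1 \<le> L2_norm \<mu> p"
      and rr: "(L2_norm \<mu> (conv r r))\<^sup>2 \<le> \<Lambda> * (L2_norm \<mu> r)\<^sup>2"
      by (rule top_idempotent[OF r(1,2) False])
    have "p \<noteq> (\<lambda>x. 0)"
    proof
      assume "p = (\<lambda>x. 0)"
      then show False using p(5) by (simp add: L2_norm_def)
    qed
    then obtain n \<pi> q c where \<pi>: "\<pi> \<in> irreps" "unitary_rep n \<pi>"
      and q_eq: "q = (\<lambda>x. \<Sum>i<n. \<Sum>j<n. c i j * cnj (\<pi> x $$ (i, j)))"
      and q: "cont q" "star q = q" "conv q q = q" "conv q p = q" "1 \<le> L2_norm \<mu> q"
      by (rule irreducible_projector[OF p(1-3)])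
    have "q \<in> coef_space \<pi>"
      using coef_spaceI[where \<pi>=\<pi> and c=c] by (simp add: q_eq coef_def unitary_rep_dim[OF \<pi>(2)])
    then have q_trig: "q \<in> trig_polys" by (rule coef_space_trig_polys[OF \<pi>(1)])
    have pq: "conv p q = q"
      using star_conv[OF q(1) p(1)] unfolding q(4) q(2) p(2) by (rule sym)
    \<comment> \<open>By \<open>pq\<close> the eigenvalue equation of p passes to q.\<close>
    have rrq: "conv (conv r r) q = (\<lambda>x. of_real \<Lambda> * q x)"
    proof -
      have "conv (conv r r) q = conv (conv r r) (conv p q)" by (simp add: pq)
      also have "\<dots> = conv (conv (conv r r) p) q"
        by (rule conv_assoc[symmetric]) (intro cont_conv r p q)+
      finally show ?thesis by (simp add: p(4) conv_scale pq)
    qed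
    \<comment> \<open>In operator notation s is r (1 - q) and r' is (1 - q) r (1 - q). Both
      compressions are orthogonal projections and cannot raise the norm; the second restores
      self-adjointness, which membership in \<open>S\<close> requires.\<close>
    define s where "s = (\<lambda>x. r x - conv r q x)"
    define r' where "r' = (\<lambda>x. s x - conv q s x)"
    have rq: "cont (conv r q)" by (intro cont_conv r q)
    have s: "cont s" unfolding s_def by (intro continuous_on_diff r rq)
    have qs: "cont (conv q s)" by (intro cont_conv q s)
    have r'_eq: "r' = (\<lambda>x. r x - conv r q x - (conv q r x - conv q (conv r q) x))"
      unfolding r'_def by (simp add: s_def conv_diff(2)[OF r(1) rq q(1)])
    have "star r' = r'"
    proof -
      have eq: "star (conv q (conv r q)) = conv q (conv r q)"
        by (simp add: star_conv q r rq conv_assoc)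
      have "star r' x = r' x" for x
      proof -
        have "star r' x = star r x - star (conv r q) x - (star (conv q r) x - star (conv q (conv r q)) x)"
          unfolding r'_eq by (simp add: star_def)
        also have "\<dots> = r x - conv q r x - (conv r q x - conv q (conv r q) x)"
          unfolding eq star_conv[OF r(1) q(1)] star_conv[OF q(1) r(1)] r(2) q(2) ..
        also have "\<dots> = r' x" unfolding r'_eq by simp
        finally show ?thesis .
      qed
      then show ?thesis ..
    qed
    moreover have "cont r'" unfolding r'_def by (intro continuous_on_diff s qs)
    moreover have "(\<lambda>x. k x - r' x) \<in> trig_polys"
    proof -
      have 1: "conv r q \<in> trig_polys" by (rule trig_polys_conv(1)[OF q_trig r(1)])
      have 2: "conv q s \<in> trig_polys" by (rule trig_polys_conv(2)[OF q_trig s])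
      have "(\<lambda>x. (k x - r x) + (conv r q x + conv q s x)) \<in> trig_polys"
        by (intro trig_polys_add r(3) 1 2)
      moreover have "(\<lambda>x. (k x - r x) + (conv r q x + conv q s x)) = (\<lambda>x. k x - r' x)"
        by (simp add: r'_def s_def fun_eq_iff)
      ultimately show ?thesis by simp
    qed
    ultimately have "r' \<in> S" by (simp add: S_def)
    then have "I \<le> (L2_norm \<mu> r')\<^sup>2" by (rule I_le)
    also have "\<dots> \<le> (L2_norm \<mu> s)\<^sup>2"
    proof -
      have "L2_inner \<mu> (conv q s) (conv q s) = L2_inner \<mu> s (conv (star q) (conv q s))"
        by (rule L2_inner_conv_left[OF q(1) s qs])
      also have "conv (star q) (conv q s) = conv q s"
        by (simp add: q conv_assoc[symmetric] s)
      finally have "complex_of_real ((L2_norm \<mu> (conv q s))\<^sup>2) = L2_inner \<mu> s (conv q s)"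
        unfolding L2_inner_self .
      from arg_cong[OF this[symmetric], of Re]
      have "Re (L2_inner \<mu> s (conv q s)) = (L2_norm \<mu> (conv q s))\<^sup>2" by (simp only: Re_complex_of_real)
      then show ?thesis
        unfolding r'_def L2_norm_diff_square[OF cont_L2[OF s] cont_L2[OF qs]] by simp
    qed
    also have "(L2_norm \<mu> s)\<^sup>2 = (L2_norm \<mu> r)\<^sup>2 - (L2_norm \<mu> (conv r q))\<^sup>2"
    proof -
      have "L2_inner \<mu> (conv r q) (conv r q) = L2_inner \<mu> r (conv (conv r q) (star q))"
        by (rule L2_inner_conv_right[OF r(1) q(1) rq])
      also have "conv (conv r q) (star q) = conv r q"
        by (simp add: q conv_assoc r)
      finally have "complex_of_real ((L2_norm \<mu> (conv r q))\<^sup>2) = L2_inner \<mu> r (conv r q)"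
        unfolding L2_inner_self .
      from arg_cong[OF this[symmetric], of Re]
      have "Re (L2_inner \<mu> r (conv r q)) = (L2_norm \<mu> (conv r q))\<^sup>2" by (simp only: Re_complex_of_real)
      then show ?thesis
        unfolding s_def L2_norm_diff_square[OF cont_L2[OF r(1)] cont_L2[OF rq]] by simp
    qed
    \<comment> \<open>Moving one factor r across the inner product leaves r * r acting on q, where
      it is multiplication by \<Lambda>.\<close>
    also have "(L2_norm \<mu> (conv r q))\<^sup>2 = \<Lambda> * (L2_norm \<mu> q)\<^sup>2"
    proof -
      have "L2_inner \<mu> (conv r q) (conv r q) = L2_inner \<mu> q (conv (star r) (conv r q))"
        by (rule L2_inner_conv_left[OF r(1) q(1) rq])
      also have "conv (star r) (conv r q) = (\<lambda>x. of_real \<Lambda> * q x)"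
        by (simp add: r q conv_assoc[symmetric] rrq)
      finally have "complex_of_real ((L2_norm \<mu> (conv r q))\<^sup>2) = of_real (\<Lambda> * (L2_norm \<mu> q)\<^sup>2)"
        by (simp add: L2_inner_self L2_inner_scale)
      then show ?thesis by (simp only: of_real_eq_iff)
    qed
    finally have "\<Lambda> * (L2_norm \<mu> q)\<^sup>2 < d" using r_less by linarith
    moreover have "1 \<le> (L2_norm \<mu> q)\<^sup>2" using power_mono[OF q(5), of 2] by simp
    ultimately have "\<Lambda> < d"
      using mult_left_mono[of 1 "(L2_norm \<mu> q)\<^sup>2" \<Lambda>] \<Lambda> by linarith
    have "(L2_norm \<mu> r)\<^sup>2 \<le> K + 1"
      using r_less I_le[OF k_S] d(2) by (simp add: K_def)
    then have "\<Lambda> * (L2_norm \<mu> r)\<^sup>2 \<le> d * (K + 1)"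
      using \<open>\<Lambda> < d\<close> d(1) by (intro mult_mono) simp_all
    then show ?thesis using rr d(3) by linarith
  qed
  \<comment> \<open>From k k - r r = (k - r) k + r (k - r), where k - r is a trigonometric
    polynomial.\<close>
  define h where "h = (\<lambda>x. conv (\<lambda>x. k x - r x) k x + conv r (\<lambda>x. k x - r x) x)"
  have kr: "cont (\<lambda>x. k x - r x)" by (intro continuous_on_diff k r)
  have "h \<in> trig_polys"
    unfolding h_def by (intro trig_polys_add trig_polys_conv r k)
  moreover have "conv k k x - h x = conv r r x" for x
    unfolding h_def by (simp add: conv_diff(1)[OF k(1) r(1) k(1)] conv_diff(2)[OF k(1) r(1) r(1)])
  moreover have "L2_norm \<mu> (conv r r) \<le> e"
    by (rule power2_le_imp_le[OF small]) (use e in simp)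
  ultimately show ?thesis by (intro that[of h]) simp_all
qed

section \<open>Continuous cutoffs and approximate identities\<close>

lemma urysohn:
  assumes "closed S" "closed T" "S \<inter> T = {}"
  obtains f :: "'g \<Rightarrow> real" where "continuous_on UNIV f" "\<And>x. 0 \<le> f x" "\<And>x. f x \<le> 1"
    "\<And>x. x \<in> S \<Longrightarrow> f x = 0" "\<And>x. x \<in> T \<Longrightarrow> f x = 1"
proof -
  have "compact_space (euclidean :: 'g topology)"
    using compact_UNIV by (simp add: compact_space_def compactin_euclidean_iff)
  moreover have "Hausdorff_space (euclidean :: 'g topology)"
    unfolding Hausdorff_space_def using hausdorff by (auto simp: disjnt_def)
  ultimately have "normal_space (euclidean :: 'g topology)"
    by (intro compact_Hausdorff_or_regular_imp_normal_space disjI1)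
  then obtain f :: "'g \<Rightarrow> real" where f: "continuous_map euclidean (top_of_set {0..1}) f"
    "f ` S \<subseteq> {0}" "f ` T \<subseteq> {1}"
    by (rule Urysohn_lemma[of _ S T 0 1]) (use assms in \<open>auto simp: disjnt_def\<close>)
  have "continuous_on UNIV f" "f \<in> UNIV \<rightarrow> {0..1}"
    using f(1) by (simp_all add: continuous_map_in_subtopology image_subset_iff_funcset)
  then show ?thesis
    using f(2,3) by (intro that[of f]) (auto simp: Pi_iff)
qed

text \<open>A normalized bump function near the identity, real and even so that it is self-adjoint.
  It is applied twice, as k * k, because that is the form which \<open>conv_trig_approx\<close> can
  treat.\<close>

lemma approximate_identity:
  assumes f: "cont f" and e: "0 < e"
  obtains k where "cont k" "star k = k" "\<And>x. cmod (f x - conv f (conv k k) x) \<le> e"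
proof -
  have e2: "0 < e / 2" using e by simp
  obtain U where U: "open U" "0 \<in> U" "\<And>u x. u \<in> U \<Longrightarrow> cmod (f (x + u) - f x) < e / 2"
    by (rule uniformly_continuous_right[OF f e2], rule that, assumption+)
  \<comment> \<open>A symmetric neighbourhood, so that \<phi> and its reflection both vanish outside
    U.\<close>
  define V where "V = U \<inter> uminus -` U"
  have V: "open V" "0 \<in> V"
    unfolding V_def using U by (auto intro!: open_Int open_vimage continuous_intros)
  obtain \<phi> :: "'g \<Rightarrow> real" where \<phi>: "continuous_on UNIV \<phi>" "\<And>x. 0 \<le> \<phi> x" "\<And>x. \<phi> x \<le> 1"
    "\<And>x. x \<in> - V \<Longrightarrow> \<phi> x = 0" "\<And>x. x \<in> {0} \<Longrightarrow> \<phi> x = 1"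
    by (rule urysohn[of "- V" "{0}"]) (use V in auto)
  define k0 where "k0 x = \<phi> x + \<phi> (- x)" for x
  have k0_cont: "continuous_on UNIV k0"
    unfolding k0_def by (intro continuous_on_add \<phi>(1) continuous_on_compose2[OF \<phi>(1)] continuous_intros) auto
  have k0_meas [measurable]: "k0 \<in> borel_measurable borel" by (rule borel_measurable_continuous_onI[OF k0_cont])
  have k0_nonneg: "0 \<le> k0 x" for x by (simp add: k0_def \<phi>)
  have k0_bound: "norm (k0 x) \<le> 2" for x using \<phi>(3)[of x] \<phi>(3)[of "- x"] k0_nonneg[of x] by (simp add: k0_def)
  have k0_int: "integrable \<mu> k0"
    by (rule integrable_const_bound[of _ 2]) (use k0_bound in auto)
  have "0 < (\<integral>x. k0 x \<partial>\<mu>)"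
  proof (rule ccontr)
    assume "\<not> 0 < (\<integral>x. k0 x \<partial>\<mu>)"
    moreover have "0 \<le> (\<integral>x. k0 x \<partial>\<mu>)" using k0_nonneg by simp
    ultimately have "(\<integral>x. k0 x \<partial>\<mu>) = 0" by simp
    then have "AE x in \<mu>. k0 x = 0"
      using integral_nonneg_eq_0_iff_AE[OF k0_int] k0_nonneg by simp
    moreover have "{x. k0 x \<noteq> 0} \<in> sets borel" by measurable
    ultimately have "emeasure \<mu> {x. k0 x \<noteq> 0} = 0"
      by (subst (asm) AE_iff_measurable[of "{x. k0 x \<noteq> 0}"]) auto
    moreover have "open {x. k0 x \<noteq> 0}" by (intro open_Collect_neq k0_cont continuous_on_const)
    moreover have "0 \<in> {x. k0 x \<noteq> 0}" by (simp add: k0_def \<phi>)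
    ultimately show False using emeasure_open_pos[of "{x. k0 x \<noteq> 0}" 0] by simp
  qed
  define J where "J = (\<integral>x. k0 x \<partial>\<mu>)"
  have J: "0 < J" using \<open>0 < (\<integral>x. k0 x \<partial>\<mu>)\<close> by (simp add: J_def)
  define \<kappa> where "\<kappa> x = k0 x / J" for x
  have \<kappa>_nonneg: "0 \<le> \<kappa> x" for x using J k0_nonneg by (simp add: \<kappa>_def)
  have \<kappa>_even: "\<kappa> (- x) = \<kappa> x" for x by (simp add: \<kappa>_def k0_def add.commute)
  have \<kappa>_supp: "\<kappa> x = 0" if "x \<notin> U" for x
    using that \<phi>(4)[of x] \<phi>(4)[of "- x"] by (simp add: \<kappa>_def k0_def V_def)
  have \<kappa>_int: "integrable \<mu> \<kappa>" "(\<integral>x. \<kappa> x \<partial>\<mu>) = 1"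
    using k0_int J by (simp_all add: \<kappa>_def[abs_def] J_def)
  have \<kappa>_meas [measurable]: "\<kappa> \<in> borel_measurable borel" unfolding \<kappa>_def by measurable
  define k where "k x = complex_of_real (\<kappa> x)" for x
  have k: "cont k"
    unfolding k_def \<kappa>_def by (intro continuous_on_of_real continuous_on_divide k0_cont continuous_on_const) (use J in simp)
  have k_star: "star k = k" by (simp add: star_def k_def \<kappa>_even fun_eq_iff)
  \<comment> \<open>Integration against k is an average over U, so a bound for g on U carries
    over.\<close>
  have weighted: "cmod (\<integral>y. g y * k y \<partial>\<mu>) \<le> b" if g: "cont g" and b: "\<And>y. y \<in> U \<Longrightarrow> cmod (g y) \<le> b" for g b
  proof -
    have "cmod (\<integral>y. g y * k y \<partial>\<mu>) \<le> (\<integral>y. b * \<kappa> y \<partial>\<mu>)"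
    proof (rule order_trans[OF integral_norm_bound], rule Bochner_Integration.integral_mono)
      show "integrable \<mu> (\<lambda>y. cmod (g y * k y))"
        by (intro integrable_norm cont_integrable continuous_on_mult g k)
      show "integrable \<mu> (\<lambda>y. b * \<kappa> y)" using \<kappa>_int by simp
      fix y
      show "cmod (g y * k y) \<le> b * \<kappa> y"
        using b[of y] \<kappa>_nonneg[of y] \<kappa>_supp[of y]
        by (cases "y \<in> U") (simp_all add: norm_mult k_def mult_right_mono)
    qed
    then show ?thesis using \<kappa>_int by simp
  qed
  have int_k: "(\<integral>y. k y \<partial>\<mu>) = 1" using \<kappa>_int by (simp add: k_def)
  have conv_k: "conv g k x = (\<integral>u. g (x + u) * k u \<partial>\<mu>)" if g: "cont g" for g x
  proof -
    have "cont (\<lambda>y. g y * k (- y + x))" by (intro continuous_on_mult g cont_translate k)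
    from integral_translate(1)[OF cont_measurable[OF this], of x]
    show ?thesis by (simp add: conv_def minus_add add.assoc k_def \<kappa>_even)
  qed
  have fk: "cmod (f x - conv f k x) \<le> e / 2" for x
  proof -
    have "f x - conv f k x = (\<integral>u. (f x - f (x + u)) * k u \<partial>\<mu>)"
      using int_k by (simp add: conv_k[OF f] left_diff_distrib cont_integrable continuous_on_mult
          cont_translate f k)
    also have "cmod \<dots> \<le> e / 2"
      using U(3)[of _ x]
      by (intro weighted continuous_on_diff continuous_on_const cont_translate f)
        (simp add: norm_minus_commute less_imp_le)
    finally show ?thesis .
  qed
  have "cmod (f x - conv f (conv k k) x) \<le> e" for x
  proof -
    have fk_cont: "cont (conv f k)" by (intro cont_conv f k)
    have d_cont: "cont (\<lambda>x. f x - conv f k x)" by (intro continuous_on_diff f fk_cont)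
    \<comment> \<open>The error of k * k is the error of k plus that error convolved with k, an
      average that adds at most e / 2 again.\<close>
    have "f x - conv f (conv k k) x = (f x - conv f k x) + conv (\<lambda>x. f x - conv f k x) k x"
      by (simp add: conv_diff(1)[OF f fk_cont k] conv_assoc[OF f k k])
    also have "cmod \<dots> \<le> e / 2 + e / 2"
    proof (rule order_trans[OF norm_triangle_ineq], rule add_mono[OF fk])
      show "cmod (conv (\<lambda>x. f x - conv f k x) k x) \<le> e / 2"
        unfolding conv_k[OF d_cont] using fk by (intro weighted cont_translate(1)[OF d_cont]) simp
    qed
    finally show ?thesis by simp
  qed
  with k k_star show ?thesis by (rule that)
qed

section \<open>Density of continuous functions and of trigonometric polynomials in L2\<close>

definition approximable :: "('g \<Rightarrow> complex) \<Rightarrow> bool" where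
  "approximable f \<longleftrightarrow> f \<in> L2 \<mu> \<and> (\<forall>e>0. \<exists>g. cont g \<and> L2_norm \<mu> (\<lambda>x. f x - g x) < e)"

lemma approximableD:
  assumes "approximable f" "0 < e"
  obtains g where "cont g" "L2_norm \<mu> (\<lambda>x. f x - g x) < e"
proof -
  have "\<exists>g. cont g \<and> L2_norm \<mu> (\<lambda>x. f x - g x) < e"
    using assms by (simp add: approximable_def)
  then show ?thesis by (elim exE conjE) (rule that)
qed

lemma approximable_add:
  assumes "approximable f" "approximable g"
  shows "approximable (\<lambda>x. f x + g x)"
  unfolding approximable_def
proof (intro conjI allI impI)
  have f: "f \<in> L2 \<mu>" and g: "g \<in> L2 \<mu>" using assms by (simp_all add: approximable_def)
  show "(\<lambda>x. f x + g x) \<in> L2 \<mu>" by (rule L2_add[OF f g])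
  fix e :: real assume "0 < e"
  then have e2: "0 < e / 2" by simp
  obtain f' where f': "cont f'" "L2_norm \<mu> (\<lambda>x. f x - f' x) < e / 2"
    by (rule approximableD[OF assms(1) e2])
  obtain g' where g': "cont g'" "L2_norm \<mu> (\<lambda>x. g x - g' x) < e / 2"
    by (rule approximableD[OF assms(2) e2])
  have "L2_norm \<mu> (\<lambda>x. (f x - f' x) - (g' x - g x)) \<le> L2_norm \<mu> (\<lambda>x. f x - f' x) + L2_norm \<mu> (\<lambda>x. g' x - g x)"
    by (intro L2_norm_triangle L2_diff f g cont_L2 f' g')
  moreover have "L2_norm \<mu> (\<lambda>x. g' x - g x) = L2_norm \<mu> (\<lambda>x. g x - g' x)"
    using L2_norm_uminus[of "\<lambda>x. g x - g' x"] by simp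
  moreover have "(\<lambda>x. (f x - f' x) - (g' x - g x)) = (\<lambda>x. f x + g x - (f' x + g' x))"
    by (simp add: fun_eq_iff)
  ultimately have "L2_norm \<mu> (\<lambda>x. f x + g x - (f' x + g' x)) < e" using f'(2) g'(2) by simp
  then show "\<exists>h. cont h \<and> L2_norm \<mu> (\<lambda>x. f x + g x - h x) < e"
    using f'(1) g'(1) by (intro exI[of _ "\<lambda>x. f' x + g' x"]) (simp add: continuous_on_add)
qed

lemma approximable_scale:
  assumes "approximable f"
  shows "approximable (\<lambda>x. c * f x)"
  unfolding approximable_def
proof (intro conjI allI impI)
  show "(\<lambda>x. c * f x) \<in> L2 \<mu>" using assms by (simp add: approximable_def L2_scale)
  fix e :: real assume e: "0 < e"
  define d where "d = e / (cmod c + 1)"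
  have pos: "0 < cmod c + 1" by (simp add: add_nonneg_pos)
  then have d: "0 < d" using e by (simp add: d_def)
  obtain g where g: "cont g" "L2_norm \<mu> (\<lambda>x. f x - g x) < d"
    by (rule approximableD[OF assms d])
  have "L2_norm \<mu> (\<lambda>x. c * f x - c * g x) = cmod c * L2_norm \<mu> (\<lambda>x. f x - g x)"
    by (simp add: right_diff_distrib[symmetric] L2_norm_scale)
  also have "\<dots> \<le> cmod c * d" using g(2) by (intro mult_left_mono) simp_all
  also have "\<dots> < (cmod c + 1) * d" using d by simp
  also have "\<dots> = e" using pos by (simp add: d_def)
  finally show "\<exists>g. cont g \<and> L2_norm \<mu> (\<lambda>x. c * f x - g x) < e"
    using g(1) by (intro exI[of _ "\<lambda>x. c * g x"]) (simp add: continuous_on_mult continuous_on_const)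
qed

lemma approximable_sum:
  "finite I \<Longrightarrow> (\<And>i. i \<in> I \<Longrightarrow> approximable (f i)) \<Longrightarrow> approximable (\<lambda>x. \<Sum>i\<in>I. f i x)"
proof (induction I rule: finite_induct)
  case empty
  have "cont (\<lambda>x. 0) \<and> L2_norm \<mu> (\<lambda>x. 0 - 0) < e" if "0 < e" for e
    using that by (simp add: L2_norm_def continuous_on_const)
  then show ?case unfolding approximable_def
    by (auto simp: L2_const intro!: exI[of _ "\<lambda>x. 0"])
next
  case (insert i I)
  then show ?case using approximable_add[of "f i" "\<lambda>x. \<Sum>i\<in>I. f i x"] by simp
qed

lemma outer_regular_less:
  assumes A: "A \<in> sets borel" and d: "0 < d"
  obtains U where "open U" "A \<subseteq> U" "measure \<mu> U < measure \<mu> A + d"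
proof -
  have "\<forall>A\<in>sets borel. emeasure \<mu> A = (INF U\<in>{U. open U \<and> A \<subseteq> U}. emeasure \<mu> U)"
    using haar[unfolded normalized_haar_def] by (elim conjE)
  then have "emeasure \<mu> A = (INF U\<in>{U. open U \<and> A \<subseteq> U}. emeasure \<mu> U)" using A by simp
  moreover have "emeasure \<mu> A < ennreal (measure \<mu> A + d)"
    using d by (simp add: emeasure_eq_measure ennreal_less_iff)
  ultimately have "(INF U\<in>{U. open U \<and> A \<subseteq> U}. emeasure \<mu> U) < ennreal (measure \<mu> A + d)" by simp
  then obtain U where U: "open U" "A \<subseteq> U" "emeasure \<mu> U < ennreal (measure \<mu> A + d)"
    by (auto simp: INF_less_iff)
  then show ?thesis using d by (intro that[of U]) (simp_all add: emeasure_eq_measure ennreal_less_iff del: ennreal_plus)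
qed

text \<open>Outer regularity of A and of its complement gives open sets U and U' whose overlap has
  measure less than 2 d. A Urysohn function that is 0 off U and 1 off U' can differ from the
  indicator only on the overlap.\<close>

lemma approximable_indicator:
  assumes A: "A \<in> sets borel"
  shows "approximable (\<lambda>x. indicator A x)"
  unfolding approximable_def
proof (intro conjI allI impI)
  have ind_meas: "(\<lambda>x. indicator A x :: complex) \<in> borel_measurable borel" using A by simp
  show ind_L2: "(\<lambda>x. indicator A x) \<in> L2 \<mu>"
    by (rule L2_bounded[OF ind_meas, of 1]) (simp add: indicator_def)
  fix e :: real assume e: "0 < e"
  define d where "d = e\<^sup>2 / 4"
  have d: "0 < d" using e by (simp add: d_def)
  obtain U where U: "open U" "A \<subseteq> U" "measure \<mu> U < measure \<mu> A + d"
    by (rule outer_regular_less[OF A d])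
  obtain U' where U': "open U'" "- A \<subseteq> U'" "measure \<mu> U' < measure \<mu> (- A) + d"
    by (rule outer_regular_less[OF borel_comp[OF A] d])
  have sets: "U \<in> sets \<mu>" "U' \<in> sets \<mu>" "A \<in> sets \<mu>" "- A \<in> sets \<mu>" using U U' A by auto
  obtain \<phi> :: "'g \<Rightarrow> real" where \<phi>: "continuous_on UNIV \<phi>" "\<And>x. 0 \<le> \<phi> x" "\<And>x. \<phi> x \<le> 1"
    "\<And>x. x \<in> - U \<Longrightarrow> \<phi> x = 0" "\<And>x. x \<in> - U' \<Longrightarrow> \<phi> x = 1"
    by (rule urysohn[of "- U" "- U'"]) (use U U' in auto)
  define g where "g x = complex_of_real (\<phi> x)" for x
  have g: "cont g" unfolding g_def by (intro continuous_on_of_real \<phi>(1))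
  have pointwise: "(cmod (indicator A x - g x))\<^sup>2 \<le> indicator (U \<inter> U') x" for x
  proof (cases "x \<in> U \<inter> U'")
    case True
    have "indicator A x - g x = of_real (indicator A x - \<phi> x)"
      by (cases "x \<in> A") (simp_all add: g_def)
    then have "cmod (indicator A x - g x) = \<bar>indicator A x - \<phi> x\<bar>" by (simp only: norm_of_real)
    also have "\<dots> \<le> 1" using \<phi>(2,3)[of x] by (cases "x \<in> A") simp_all
    finally have "cmod (indicator A x - g x) \<le> 1" .
    then have "(cmod (indicator A x - g x))\<^sup>2 \<le> 1" by (simp add: power_le_one)
    then show ?thesis using True by simp
  next
    case False
    then have "indicator A x = g x"
      using U(2) U'(2) \<phi>(4,5)[of x] by (cases "x \<in> A") (auto simp: g_def)
    then show ?thesis by simp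
  qed
  have "(L2_norm \<mu> (\<lambda>x. indicator A x - g x))\<^sup>2 \<le> (\<integral>x. indicator (U \<inter> U') x \<partial>\<mu>)"
    unfolding L2_norm_square
  proof (rule Bochner_Integration.integral_mono)
    show "integrable \<mu> (\<lambda>x. (cmod (indicator A x - g x))\<^sup>2)"
      by (intro L2_norm_square_integrable L2_diff ind_L2 cont_L2 g)
    show "integrable \<mu> (indicat_real (U \<inter> U'))"
      using sets by (simp add: emeasure_eq_measure)
  qed (rule pointwise)
  also have "\<dots> = measure \<mu> (U \<inter> U')" using sets by simp
  also have "\<dots> = measure \<mu> ((U - A) \<union> (U' - (- A)))" using U(2) U'(2) by (intro arg_cong[where f="measure \<mu>"]) auto
  also have "\<dots> \<le> measure \<mu> (U - A) + measure \<mu> (U' - (- A))"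
    using sets by (intro measure_Un_le) auto
  also have "\<dots> = (measure \<mu> U - measure \<mu> A) + (measure \<mu> U' - measure \<mu> (- A))"
    by (simp only: finite_measure_Diff[OF sets(1,3) U(2)] finite_measure_Diff[OF sets(2,4) U'(2)])
  also have "\<dots> < 2 * d" using U(3) U'(3) by simp
  also have "\<dots> < e\<^sup>2" using e by (simp add: d_def)
  finally have "L2_norm \<mu> (\<lambda>x. indicator A x - g x) < e"
    by (rule power2_less_imp_less) (use e in simp)
  with g show "\<exists>g. cont g \<and> L2_norm \<mu> (\<lambda>x. indicator A x - g x) < e" by (intro exI[of _ g] conjI)
qed

lemma cont_dense:
  assumes f: "f \<in> L2 \<mu>" and e: "0 < e"
  obtains g where "cont g" "L2_norm \<mu> (\<lambda>x. f x - g x) < e"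
proof -
  have "f \<in> borel_measurable \<mu>" using L2_measurable[OF f] by simp
  from borel_measurable_implies_sequence_metric[OF this, of 0]
  obtain F where F': "\<forall>i. simple_function \<mu> (F i)" "\<forall>x\<in>space \<mu>. (\<lambda>i. F i x) \<longlonglongrightarrow> f x"
    "\<forall>i. \<forall>x\<in>space \<mu>. dist (F i x) 0 \<le> 2 * dist (f x) 0"
    by (elim exE conjE)
  have F: "\<And>i. simple_function \<mu> (F i)" "\<And>x. (\<lambda>i. F i x) \<longlonglongrightarrow> f x"
    "\<And>i x. dist (F i x) 0 \<le> 2 * dist (f x) 0"
    using F' by simp_all
  have F_meas: "F i \<in> borel_measurable borel" for i
    using borel_measurable_simple_function[OF F(1)] by simp
  have F_approx: "approximable (F i)" for i
  proof -
    have fin: "finite (range (F i))" using simple_functionD(1)[OF F(1)] by simp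
    have F_eq: "F i = (\<lambda>x. \<Sum>y\<in>range (F i). y * indicator (F i -` {y}) x)"
    proof
      fix x
      have "(\<Sum>y\<in>range (F i). y * indicator (F i -` {y}) x) = (\<Sum>y\<in>{F i x}. y * indicator (F i -` {y}) x)"
        using fin by (intro sum.mono_neutral_right) (auto simp: indicator_def)
      then show "F i x = (\<Sum>y\<in>range (F i). y * indicator (F i -` {y}) x)" by simp
    qed
    have "F i -` {y} \<in> sets borel" for y
      using measurable_sets[OF F_meas, of "{y}" i] by simp
    then have "approximable (\<lambda>x. \<Sum>y\<in>range (F i). y * indicator (F i -` {y}) x)"
      by (intro approximable_sum fin approximable_scale approximable_indicator)
    from back_subst[of approximable, OF this F_eq[symmetric]] show ?thesis .
  qed
  have "(\<lambda>i. \<integral>x. (cmod (f x - F i x))\<^sup>2 \<partial>\<mu>) \<longlonglongrightarrow> (\<integral>x. 0 \<partial>\<mu>)"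
  proof (rule integral_dominated_convergence)
    \<comment> \<open>The simple functions are bounded by twice |f|, so the difference is at most
      three times |f|, and its square brings in the factor 9.\<close>
    show "integrable \<mu> (\<lambda>x. 9 * (cmod (f x))\<^sup>2)" using L2_norm_square_integrable[OF f] by simp
    show "(\<lambda>x. (cmod (f x - F i x))\<^sup>2) \<in> borel_measurable \<mu>" for i
      using F_meas[of i] L2_measurable[OF f] by measurable
    have "(\<lambda>i. (cmod (f x - F i x))\<^sup>2) \<longlonglongrightarrow> (cmod (f x - f x))\<^sup>2" for x
      by (intro tendsto_intros F(2))
    then show "AE x in \<mu>. (\<lambda>i. (cmod (f x - F i x))\<^sup>2) \<longlonglongrightarrow> 0" by simp
    have "(cmod (f x - F i x))\<^sup>2 \<le> 9 * (cmod (f x))\<^sup>2" for x i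
    proof -
      have "cmod (f x - F i x) \<le> 3 * cmod (f x)"
        using norm_triangle_ineq4[of "f x" "F i x"] F(3)[of i x] by simp
      from power_mono[OF this, of 2] show ?thesis by (simp add: power_mult_distrib)
    qed
    then show "AE x in \<mu>. norm ((cmod (f x - F i x))\<^sup>2) \<le> 9 * (cmod (f x))\<^sup>2" for i by simp
  qed simp
  then have "(\<lambda>i. (L2_norm \<mu> (\<lambda>x. f x - F i x))\<^sup>2) \<longlonglongrightarrow> 0" by (simp add: L2_norm_square)
  moreover have "0 < (e / 2)\<^sup>2" using e by simp
  ultimately have "\<forall>\<^sub>F i in sequentially. (L2_norm \<mu> (\<lambda>x. f x - F i x))\<^sup>2 < (e / 2)\<^sup>2"
    by (rule order_tendstoD(2))
  then have "\<exists>i. (L2_norm \<mu> (\<lambda>x. f x - F i x))\<^sup>2 < (e / 2)\<^sup>2"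
    by (auto simp: eventually_sequentially)
  then obtain i where "(L2_norm \<mu> (\<lambda>x. f x - F i x))\<^sup>2 < (e / 2)\<^sup>2" ..
  then have 1: "L2_norm \<mu> (\<lambda>x. f x - F i x) < e / 2"
    by (rule power2_less_imp_less) (use e in simp)
  have e2: "0 < e / 2" using e by simp
  obtain g where g: "cont g" "L2_norm \<mu> (\<lambda>x. F i x - g x) < e / 2"
    by (rule approximableD[OF F_approx e2])
  have "L2_norm \<mu> (\<lambda>x. f x - g x) \<le> L2_norm \<mu> (\<lambda>x. f x - F i x) + L2_norm \<mu> (\<lambda>x. F i x - g x)"
    using F_approx[of i] by (intro L2_norm_triangle3[OF f _ cont_L2[OF g(1)]]) (simp add: approximable_def)
  then show ?thesis using 1 g by (intro that[of g]) simp_all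
qed

text \<open>The chain f, g, g * (k * k), g * h, with an error of e / 3 for each link: g is
  continuous, k is an approximate identity for g, and h approximates k * k. The last term is a
  trigonometric polynomial by the ideal property.\<close>

theorem trig_polys_dense:
  assumes f: "f \<in> L2 \<mu>" and e: "0 < e"
  obtains h where "h \<in> trig_polys" "L2_norm \<mu> (\<lambda>x. f x - h x) < e"
proof -
  have e3: "0 < e / 3" using e by simp
  obtain g where g: "cont g" "L2_norm \<mu> (\<lambda>x. f x - g x) < e / 3"
    by (rule cont_dense[OF f e3])
  obtain k where k: "cont k" "star k = k" "\<And>x. cmod (g x - conv g (conv k k) x) \<le> e / 3"
    by (rule approximate_identity[OF g(1) e3], rule that, assumption+)
  \<comment> \<open>Convolution with g multiplies the error by at most the norm of g; the summand 1
    covers g = 0.\<close>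
  define d where "d = e / (3 * (L2_norm \<mu> g + 1))"
  have pos: "0 < L2_norm \<mu> g + 1" by (simp add: add_nonneg_pos)
  have d: "0 < d" using e pos by (simp add: d_def)
  obtain h where h: "h \<in> trig_polys" "L2_norm \<mu> (\<lambda>x. conv k k x - h x) \<le> d"
    by (rule conv_trig_approx[OF k(1,2) d])
  have kk: "cont (conv k k)" by (intro cont_conv k)
  have h_cont: "cont h" by (rule trig_polys_cont[OF h(1)])
  have 1: "L2_norm \<mu> (\<lambda>x. g x - conv g (conv k k) x) \<le> e / 3"
    using k(3) e by (intro L2_norm_bounded cont_measurable continuous_on_diff g cont_conv k) simp_all
  have "L2_norm \<mu> (\<lambda>x. conv g (conv k k) x - conv g h x) = L2_norm \<mu> (conv g (\<lambda>x. conv k k x - h x))"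
    by (simp add: conv_diff(2)[OF kk h_cont g(1)])
  also have "\<dots> \<le> L2_norm \<mu> g * L2_norm \<mu> (\<lambda>x. conv k k x - h x)"
    by (intro L2_norm_conv cont_L2 g continuous_on_diff kk h_cont)
  also have "\<dots> \<le> L2_norm \<mu> g * d" by (intro mult_left_mono h) simp
  also have "\<dots> < (L2_norm \<mu> g + 1) * d" using d by simp
  also have "\<dots> = e / 3"
  proof -
    have *: "a * (e / (3 * a)) = e / 3" if "a \<noteq> 0" for a :: real using that by simp
    show ?thesis unfolding d_def by (rule *) (use pos in linarith)
  qed
  finally have 2: "L2_norm \<mu> (\<lambda>x. conv g (conv k k) x - conv g h x) < e / 3" .
  have gkk: "conv g (conv k k) \<in> L2 \<mu>" by (intro cont_L2 cont_conv g k)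
  have gh: "conv g h \<in> trig_polys" by (rule trig_polys_conv(1)[OF h(1) g(1)])
  have "L2_norm \<mu> (\<lambda>x. f x - conv g h x) < e"
    using L2_norm_triangle3[OF f cont_L2[OF g(1)] cont_L2[OF trig_polys_cont[OF gh]]]
      L2_norm_triangle3[OF cont_L2[OF g(1)] gkk cont_L2[OF trig_polys_cont[OF gh]]] 1 2 g(2) by linarith
  then show ?thesis using gh by (intro that)
qed

end

section \<open>Isotypic projections\<close>

context haar_group
begin

section \<open>Orthogonal projection onto a coefficient space\<close>

lemma coef_inner_same:
  assumes \<pi>: "\<pi> \<in> irreps" and "i < rep_dim \<pi>" "j < rep_dim \<pi>" "k < rep_dim \<pi>" "l < rep_dim \<pi>"
  shows "L2_inner \<mu> (coef \<pi> i j) (coef \<pi> k l) = of_bool (i = k) * of_bool (j = l) / of_nat (rep_dim \<pi>)"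
proof -
  have "L2_inner \<mu> (coef \<pi> i j) (coef \<pi> k l) = (\<integral>g. \<pi> g $$ (k, l) * cnj (\<pi> g $$ (i, j)) \<partial>\<mu>)"
    by (simp add: L2_inner_def coef_def mult.commute)
  also have "\<dots> = of_bool (k = i) * of_bool (l = j) / of_nat (rep_dim \<pi>)"
    by (rule schur_orthogonality[OF \<pi> refl assms(4,5,2,3)])
  finally show ?thesis by (simp only: eq_commute[of k i] eq_commute[of l j])
qed

lemma coef_L2: "\<pi> \<in> irreps \<Longrightarrow> i < rep_dim \<pi> \<Longrightarrow> j < rep_dim \<pi> \<Longrightarrow> coef \<pi> i j \<in> L2 \<mu>"
  by (rule cont_L2[OF cont_coef'[OF irrepsD(2)]])

lemma inner_coef_space_0:
  assumes \<pi>: "\<pi> \<in> irreps" and f: "f \<in> L2 \<mu>" and h: "h \<in> coef_space \<pi>"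
    and zero: "\<And>i j. i < rep_dim \<pi> \<Longrightarrow> j < rep_dim \<pi> \<Longrightarrow> L2_inner \<mu> f (coef \<pi> i j) = 0"
  shows "L2_inner \<mu> f h = 0"
proof -
  obtain c where c: "h = (\<lambda>x. \<Sum>i<rep_dim \<pi>. \<Sum>j<rep_dim \<pi>. c i j * coef \<pi> i j x)"
    using h unfolding coef_space_def mem_Collect_eq by (elim exE conjE)
  have "L2_inner \<mu> f (\<lambda>x. \<Sum>j<rep_dim \<pi>. c i j * coef \<pi> i j x) = 0" if i: "i < rep_dim \<pi>" for i
    by (subst L2_inner_sum(2)) (use i f zero in \<open>simp_all add: L2_scale coef_L2[OF \<pi>] L2_inner_scale\<close>)
  then show ?thesis
    unfolding c by (subst L2_inner_sum(2)) (use f in \<open>auto intro!: L2_sum L2_scale coef_L2[OF \<pi>]\<close>)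
qed

lemma inner_coef_spaces_0:
  assumes \<pi>: "\<pi> \<in> irreps" and \<rho>: "\<rho> \<in> irreps" and neq: "(\<pi>, \<rho>) \<notin> rep_equiv"
    and h: "h \<in> coef_space \<pi>" and k: "k \<in> coef_space \<rho>"
  shows "L2_inner \<mu> h k = 0"
proof (rule inner_coef_space_0[OF \<rho> cont_L2[OF coef_space_cont[OF \<pi> h]] k])
  fix i j assume ij: "i < rep_dim \<rho>" "j < rep_dim \<rho>"
  have "L2_inner \<mu> (coef \<rho> i j) h = 0"
  proof (rule inner_coef_space_0[OF \<pi> coef_L2[OF \<rho> ij] h])
    fix a b assume ab: "a < rep_dim \<pi>" "b < rep_dim \<pi>"
    have "L2_inner \<mu> (coef \<pi> a b) (coef \<rho> i j) = (\<integral>g. \<rho> g $$ (i, j) * cnj (\<pi> g $$ (a, b)) \<partial>\<mu>)"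
      by (simp add: L2_inner_def coef_def mult.commute)
    also have "\<dots> = 0" by (rule schur_inequivalent[OF \<pi> \<rho> neq ij ab])
    finally show "L2_inner \<mu> (coef \<rho> i j) (coef \<pi> a b) = 0"
      by (subst L2_inner_commute) simp
  qed
  then show "L2_inner \<mu> h (coef \<rho> i j) = 0" by (subst L2_inner_commute) simp
qed

text \<open>By the orthogonality relations distinct coefficients are orthogonal, each with squared
  norm 1 / \<open>rep_dim \<pi>\<close>, which accounts for the factor in this Fourier sum.\<close>

definition coef_proj :: "('g \<Rightarrow> complex mat) \<Rightarrow> ('g \<Rightarrow> complex) \<Rightarrow> 'g \<Rightarrow> complex" where
  "coef_proj \<pi> f = (\<lambda>x. \<Sum>i<rep_dim \<pi>. \<Sum>j<rep_dim \<pi>.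
     (of_nat (rep_dim \<pi>) * L2_inner \<mu> f (coef \<pi> i j)) * coef \<pi> i j x)"

lemma coef_proj_mem: "coef_proj \<pi> f \<in> coef_space \<pi>"
  unfolding coef_proj_def by (rule coef_spaceI)

lemma coef_proj_cont: "\<pi> \<in> irreps \<Longrightarrow> cont (coef_proj \<pi> f)"
  by (rule coef_space_cont[OF _ coef_proj_mem])

lemma coef_proj_residual:
  assumes \<pi>: "\<pi> \<in> irreps" and f: "f \<in> L2 \<mu>" and h: "h \<in> coef_space \<pi>"
  shows "L2_inner \<mu> (\<lambda>x. f x - coef_proj \<pi> f x) h = 0"
proof (rule inner_coef_space_0[OF \<pi> _ h])
  let ?d = "rep_dim \<pi>"
  have p: "coef_proj \<pi> f \<in> L2 \<mu>" by (rule cont_L2[OF coef_proj_cont[OF \<pi>]])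
  show "(\<lambda>x. f x - coef_proj \<pi> f x) \<in> L2 \<mu>" by (rule L2_diff[OF f p])
  fix k l assume kl: "k < ?d" "l < ?d"
  let ?c = "\<lambda>i j. of_nat ?d * L2_inner \<mu> f (coef \<pi> i j)"
  have d: "0 < ?d" by (rule irrepsD(1)[OF \<pi>])
  have "L2_inner \<mu> (coef_proj \<pi> f) (coef \<pi> k l)
      = (\<Sum>i<?d. L2_inner \<mu> (\<lambda>x. \<Sum>j<?d. ?c i j * coef \<pi> i j x) (coef \<pi> k l))"
    unfolding coef_proj_def
    by (rule L2_inner_sum(1)) (auto intro!: L2_sum L2_scale coef_L2[OF \<pi>] kl)
  also have "\<dots> = (\<Sum>i<?d. \<Sum>j<?d. ?c i j * (of_bool (i = k) * of_bool (j = l) / of_nat ?d))"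
  proof (rule sum.cong[OF refl])
    fix i assume "i \<in> {..<?d}"
    then have i: "i < ?d" by simp
    have "L2_inner \<mu> (\<lambda>x. \<Sum>j<?d. ?c i j * coef \<pi> i j x) (coef \<pi> k l)
        = (\<Sum>j<?d. L2_inner \<mu> (\<lambda>x. ?c i j * coef \<pi> i j x) (coef \<pi> k l))"
      by (rule L2_inner_sum(1)) (auto intro!: L2_scale coef_L2[OF \<pi>] kl i)
    then show "L2_inner \<mu> (\<lambda>x. \<Sum>j<?d. ?c i j * coef \<pi> i j x) (coef \<pi> k l)
        = (\<Sum>j<?d. ?c i j * (of_bool (i = k) * of_bool (j = l) / of_nat ?d))"
      by (simp only: L2_inner_scale(1)) (intro sum.cong refl, simp add: coef_inner_same[OF \<pi> i _ kl])
  qed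
  also have "\<dots> = (\<Sum>i<?d. (L2_inner \<mu> f (coef \<pi> i l)) * of_bool (i = k))"
  proof (rule sum.cong[OF refl])
    fix i
    have "(\<Sum>j<?d. ?c i j * (of_bool (i = k) * of_bool (j = l) / of_nat ?d))
        = (\<Sum>j<?d. (L2_inner \<mu> f (coef \<pi> i j) * of_bool (i = k)) * of_bool (j = l))"
      using d by (intro sum.cong refl) simp
    also have "\<dots> = L2_inner \<mu> f (coef \<pi> i l) * of_bool (i = k)" by (rule delta_sum(1)[OF kl(2)])
    finally show "(\<Sum>j<?d. ?c i j * (of_bool (i = k) * of_bool (j = l) / of_nat ?d))
        = L2_inner \<mu> f (coef \<pi> i l) * of_bool (i = k)" .
  qed
  also have "\<dots> = L2_inner \<mu> f (coef \<pi> k l)" by (rule delta_sum(1)[OF kl(1)])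
  finally show "L2_inner \<mu> (\<lambda>x. f x - coef_proj \<pi> f x) (coef \<pi> k l) = 0"
    by (simp add: L2_inner_diff(1)[OF f p coef_L2[OF \<pi> kl]])
qed

section \<open>Embeddings into the regular representation and isotypic components\<close>

lemma regular_embeddingD:
  assumes "regular_embedding \<mu> \<pi> T"
  shows "v \<in> carrier_vec (rep_dim \<pi>) \<Longrightarrow> T v \<in> L2 \<mu>"
    "u \<in> carrier_vec (rep_dim \<pi>) \<Longrightarrow> v \<in> carrier_vec (rep_dim \<pi>) \<Longrightarrow> AE y in \<mu>. T (u + v) y = T u y + T v y"
    "v \<in> carrier_vec (rep_dim \<pi>) \<Longrightarrow> AE y in \<mu>. T (c \<cdot>\<^sub>v v) y = c * T v y"
    "v \<in> carrier_vec (rep_dim \<pi>) \<Longrightarrow> AE y in \<mu>. T (\<pi> g *\<^sub>v v) y = left_regular g (T v) y"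
  using assms unfolding regular_embedding_def Let_def by simp_all

text \<open>An embedding is linear only up to null sets that depend on the vectors. Adding one
  coordinate at a time involves finitely many of them.\<close>

lemma embedding_expansion:
  assumes T: "regular_embedding \<mu> \<pi> T" and v: "v \<in> carrier_vec (rep_dim \<pi>)"
  shows "AE y in \<mu>. T v y = (\<Sum>i<rep_dim \<pi>. v $ i * T (unit_vec (rep_dim \<pi>) i) y)"
proof -
  let ?d = "rep_dim \<pi>"
  let ?w = "\<lambda>k. vec ?d (\<lambda>i. if i < k then v $ i else 0)"
  have "k \<le> ?d \<Longrightarrow> AE y in \<mu>. T (?w k) y = (\<Sum>i<k. v $ i * T (unit_vec ?d i) y)" for k
  proof (induction k)
    case 0
    have "?w 0 = 0 \<cdot>\<^sub>v 0\<^sub>v ?d" by (rule eq_vecI) simp_all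
    then show ?case using regular_embeddingD(3)[OF T zero_carrier_vec, of 0] by simp
  next
    case (Suc k)
    then have k: "k < ?d" by simp
    have "?w (Suc k) = ?w k + v $ k \<cdot>\<^sub>v unit_vec ?d k"
      using k by (intro eq_vecI) (auto simp: less_Suc_eq)
    then have 1: "AE y in \<mu>. T (?w (Suc k)) y = T (?w k) y + T (v $ k \<cdot>\<^sub>v unit_vec ?d k) y"
      using regular_embeddingD(2)[OF T, of "?w k" "v $ k \<cdot>\<^sub>v unit_vec ?d k"] by simp
    have 2: "AE y in \<mu>. T (v $ k \<cdot>\<^sub>v unit_vec ?d k) y = v $ k * T (unit_vec ?d k) y"
      by (rule regular_embeddingD(3)[OF T unit_vec_carrier])
    have 3: "AE y in \<mu>. T (?w k) y = (\<Sum>i<k. v $ i * T (unit_vec ?d i) y)"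
      using Suc by simp
    show ?case using 1 2 3 by eventually_elim simp
  qed
  from this[of ?d] show ?thesis
  proof -
    have "?w ?d = v" by (rule eq_vecI) (use v in simp_all)
    then show ?thesis using \<open>?d \<le> ?d \<Longrightarrow> AE y in \<mu>. T (?w ?d) y = (\<Sum>i<?d. v $ i * T (unit_vec ?d i) y)\<close> by simp
  qed
qed

text \<open>By Fubini the covariance relation of the embedding holds, for almost every \<open>y\<close>, for almost all
  group elements at once; reading it off at one such \<open>y\<close> exhibits the functions as matrix
  coefficients.\<close>

lemma embedding_coef:
  assumes \<pi>: "\<pi> \<in> irreps" and T: "regular_embedding \<mu> \<pi> T" and v: "v \<in> carrier_vec (rep_dim \<pi>)"
  obtains h where "h \<in> coef_space \<pi>" "AE y in \<mu>. T v y = h y"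
proof -
  define d where "d = rep_dim \<pi>"
  note rep = irrepsD(2)[OF \<pi>, folded d_def]
  define t where "t i = T (unit_vec d i)" for i
  have t_L2: "t i \<in> L2 \<mu>" for i
    unfolding t_def by (rule regular_embeddingD(1)[OF T]) (simp add: d_def)
  have t_meas: "t i \<in> borel_measurable borel" for i by (rule L2_measurable[OF t_L2])
  define P where "P j z \<longleftrightarrow> t j (- fst z + snd z) = (\<Sum>i<d. \<pi> (fst z) $$ (i, j) * t i (snd z))" for j z
  have P_meas: "Measurable.pred borel (P j)" if j: "j < d" for j
  proof -
    have diff: "(\<lambda>z::'g \<times> 'g. - fst z + snd z) \<in> measurable borel borel"
      by (intro borel_measurable_continuous_onI continuous_intros)
    have fst': "(fst :: 'g \<times> 'g \<Rightarrow> 'g) \<in> measurable borel borel" "(snd :: 'g \<times> 'g \<Rightarrow> 'g) \<in> measurable borel borel"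
      by (intro borel_measurable_continuous_onI continuous_intros)+
    have 1: "(\<lambda>z. t j (- fst z + snd z)) \<in> borel_measurable (borel :: ('g \<times> 'g) measure)"
      by (rule measurable_compose[OF diff t_meas])
    have 2: "(\<lambda>z. t i (snd z)) \<in> borel_measurable (borel :: ('g \<times> 'g) measure)" for i
      by (rule measurable_compose[OF fst'(2) t_meas])
    have 3: "(\<lambda>z. \<pi> (fst z) $$ (i, j)) \<in> borel_measurable (borel :: ('g \<times> 'g) measure)" if "i < d" for i
      by (rule measurable_compose[OF fst'(1) cont_measurable[OF cont_coef(2)[OF rep that j]]])
    have 4: "(\<lambda>z. \<Sum>i<d. \<pi> (fst z) $$ (i, j) * t i (snd z)) \<in> borel_measurable (borel :: ('g \<times> 'g) measure)"
      by (intro borel_measurable_sum borel_measurable_times 2 3) simp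
    have "Measurable.pred borel (\<lambda>z. t j (- fst z + snd z) - (\<Sum>i<d. \<pi> (fst z) $$ (i, j) * t i (snd z)) = 0)"
      by (rule pred_eq_const1[OF borel_measurable_diff[OF 1 4]]) simp
    then show ?thesis by (simp add: P_def[abs_def])
  qed
  have cov: "AE y in \<mu>. P j (g, y)" if j: "j < d" for g j
  proof -
    have u: "unit_vec d j \<in> carrier_vec d" by simp
    have carr: "\<pi> g *\<^sub>v unit_vec d j \<in> carrier_vec d"
      by (rule mult_mat_vec_carrier[OF unitary_repD(1)[OF rep] u])
    have entry: "(\<pi> g *\<^sub>v unit_vec d j) $ i = \<pi> g $$ (i, j)" if "i < d" for i
      using that j unitary_repD(1)[OF rep, of g] by (auto simp: scalar_prod_right_unit)
    have 1: "AE y in \<mu>. T (\<pi> g *\<^sub>v unit_vec d j) y = (\<Sum>i<d. (\<pi> g *\<^sub>v unit_vec d j) $ i * t i y)"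
      using embedding_expansion[OF T] carr by (simp add: d_def t_def)
    have 2: "AE y in \<mu>. T (\<pi> g *\<^sub>v unit_vec d j) y = t j (- g + y)"
      using regular_embeddingD(4)[OF T, of "unit_vec d j" g] by (simp add: d_def t_def left_regular_def)
    show ?thesis
      using 1 2
    proof eventually_elim
      case (elim y)
      then show ?case by (simp add: P_def entry)
    qed
  qed
  have "AE y in \<mu>. AE g in \<mu>. P j (g, y)" if j: "j < d" for j
    using Fubini_AE[OF P_meas[OF j]] cov[OF j] by simp
  then have "AE y in \<mu>. \<forall>j\<in>{..<d}. AE g in \<mu>. P j (g, y)"
    by (intro AE_finite_allI) simp_all
  then have "\<exists>y. \<forall>j\<in>{..<d}. AE g in \<mu>. P j (g, y)"
    using AE_contr[of "\<lambda>y. \<not> (\<forall>j\<in>{..<d}. AE g in \<mu>. P j (g, y))"] by fastforce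
  then obtain y where y: "\<And>j. j < d \<Longrightarrow> AE g in \<mu>. P j (g, y)" by auto
  have t_eq: "AE x in \<mu>. t j x = (\<Sum>a<d. (\<Sum>i<d. \<pi> y $$ (i, a) * t i y) * coef \<pi> j a x)" if j: "j < d" for j
  proof -
    have pair: "(\<lambda>g. (g, y)) \<in> measurable borel (borel :: ('g \<times> 'g) measure)"
      by (intro borel_measurable_continuous_onI continuous_intros)
    have Pm: "Measurable.pred borel (\<lambda>g. P j (g, y))"
      by (rule measurable_compose[OF pair P_meas[OF j]])
    have Pm': "Measurable.pred borel (\<lambda>x. P j (y + x, y))"
      by (rule measurable_compose[OF measurable_translate(1) Pm])
    \<comment> \<open>Put g = y x\<inverse>, so that g\<inverse> y = x. Invariance under translation
      and inversion keeps the exceptional set null.\<close>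
    have "AE x in \<mu>. P j (y + - x, y)"
      by (rule AE_translate(2)[OF Pm' AE_translate(1)[OF Pm y[OF j]]])
    then show ?thesis
    proof eventually_elim
      case (elim x)
      have "t j x = (\<Sum>i<d. \<pi> (y + - x) $$ (i, j) * t i y)"
        using elim by (simp add: P_def minus_add add.assoc)
      also have "\<dots> = (\<Sum>i<d. \<Sum>a<d. \<pi> y $$ (i, a) * coef \<pi> j a x * t i y)"
        using j by (intro sum.cong refl)
          (simp add: unitary_rep_add[OF rep _ j, of _ y "- x", unfolded] unitary_rep_uminus[OF rep _ j] coef_def sum_distrib_right
            del: add_uminus_conv_diff)
      also have "\<dots> = (\<Sum>a<d. \<Sum>i<d. \<pi> y $$ (i, a) * coef \<pi> j a x * t i y)" by (rule sum.swap)
      also have "\<dots> = (\<Sum>a<d. (\<Sum>i<d. \<pi> y $$ (i, a) * t i y) * coef \<pi> j a x)"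
        by (simp add: sum_distrib_left sum_distrib_right mult_ac)
      finally show ?case .
    qed
  qed
  define h where "h x = (\<Sum>j<d. \<Sum>a<d. (v $ j * (\<Sum>i<d. \<pi> y $$ (i, a) * t i y)) * coef \<pi> j a x)" for x
  have "h \<in> coef_space \<pi>" unfolding h_def d_def by (rule coef_spaceI)
  moreover have "AE x in \<mu>. T v x = h x"
  proof -
    have "AE x in \<mu>. \<forall>j\<in>{..<d}. t j x = (\<Sum>a<d. (\<Sum>i<d. \<pi> y $$ (i, a) * t i y) * coef \<pi> j a x)"
      using t_eq by (intro AE_finite_allI) simp_all
    moreover have "AE x in \<mu>. T v x = (\<Sum>j<d. v $ j * t j x)"
      using embedding_expansion[OF T v] by (simp add: d_def t_def)
    ultimately show ?thesis
    proof eventually_elim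
      case (elim x)
      have "T v x = (\<Sum>j<d. v $ j * (\<Sum>a<d. (\<Sum>i<d. \<pi> y $$ (i, a) * t i y) * coef \<pi> j a x))"
        using elim by simp
      also have "\<dots> = h x" unfolding h_def
        by (intro sum.cong refl, subst sum_distrib_left, intro sum.cong refl, rule mult.assoc[symmetric])
      finally show ?case .
    qed
  qed
  ultimately show ?thesis by (rule that)
qed

text \<open>Left translation by g acts on column i of the coefficients through \<pi> g. The square
  root of the dimension offsets the squared norm 1 / \<open>rep_dim \<pi>\<close> of a coefficient
  and makes the map isometric.\<close>

lemma coef_embedding:
  assumes \<pi>: "\<pi> \<in> irreps" and i: "i < rep_dim \<pi>"
  shows "regular_embedding \<mu> \<pi> (\<lambda>v y. \<Sum>j<rep_dim \<pi>. of_real (sqrt (rep_dim \<pi>)) * v $ j * coef \<pi> j i y)"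
proof -
  define d where "d = rep_dim \<pi>"
  note rep = irrepsD(2)[OF \<pi>, folded d_def]
  have d: "0 < d" "i < d" using irrepsD(1)[OF \<pi>] i by (simp_all add: d_def)
  define r where "r = complex_of_real (sqrt d)"
  have r: "r * cnj r = of_nat d"
    unfolding r_def complex_cnj_complex_of_real of_real_mult[symmetric] by simp
  define T where "T v = (\<lambda>y. \<Sum>j<d. r * v $ j * coef \<pi> j i y)" for v
  have c_L2: "coef \<pi> j i \<in> L2 \<mu>" if "j < d" for j using coef_L2[OF \<pi>] that d by (simp add: d_def)
  have "regular_embedding \<mu> \<pi> T"
    unfolding regular_embedding_def Let_def d_def[symmetric]
  proof (intro conjI ballI allI)
    fix v :: "complex vec"
    show "T v \<in> L2 \<mu>" unfolding T_def by (intro L2_sum L2_scale c_L2) simp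
  next
    fix u v :: "complex vec" assume uv: "u \<in> carrier_vec d" "v \<in> carrier_vec d"
    have "T (u + v) y = T u y + T v y" for y
      using uv by (simp add: T_def distrib_left distrib_right sum.distrib)
    then show "AE y in \<mu>. T (u + v) y = T u y + T v y" by simp
  next
    fix c and v :: "complex vec" assume v: "v \<in> carrier_vec d"
    have "T (c \<cdot>\<^sub>v v) y = c * T v y" for y
      using v by (simp add: T_def sum_distrib_left mult_ac)
    then show "AE y in \<mu>. T (c \<cdot>\<^sub>v v) y = c * T v y" by simp
  next
    fix u v :: "complex vec" assume uv: "u \<in> carrier_vec d" "v \<in> carrier_vec d"
    have inner: "L2_inner \<mu> (coef \<pi> j i) (T v) = cnj r * cnj (v $ j) / of_nat d" if j: "j < d" for j
    proof -
      have "L2_inner \<mu> (coef \<pi> j i) (T v) = (\<Sum>k<d. L2_inner \<mu> (coef \<pi> j i) (\<lambda>y. r * v $ k * coef \<pi> k i y))"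
        unfolding T_def by (rule L2_inner_sum(2)) (auto intro!: L2_scale c_L2 j)
      also have "\<dots> = (\<Sum>k<d. (cnj r * cnj (v $ k) / of_nat d) * of_bool (j = k))"
        unfolding L2_inner_scale using j d
        by (intro sum.cong refl) (simp add: coef_inner_same[OF \<pi>, folded d_def])
      also have "\<dots> = cnj r * cnj (v $ j) / of_nat d" by (rule delta_sum(2)[OF j])
      finally show ?thesis .
    qed
    have Tv: "T v \<in> L2 \<mu>" unfolding T_def by (intro L2_sum L2_scale c_L2) simp
    have "L2_inner \<mu> (T u) (T v) = (\<Sum>j<d. L2_inner \<mu> (\<lambda>y. r * u $ j * coef \<pi> j i y) (T v))"
      unfolding T_def[of u] by (rule L2_inner_sum(1)) (auto intro!: L2_scale c_L2 Tv)
    also have "\<dots> = (\<Sum>j<d. u $ j * cnj (v $ j))"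
    proof (rule sum.cong[OF refl])
      fix j assume "j \<in> {..<d}"
      then have j: "j < d" by simp
      have "L2_inner \<mu> (\<lambda>y. r * u $ j * coef \<pi> j i y) (T v) = (r * cnj r) * (u $ j * cnj (v $ j)) / of_nat d"
        by (simp add: L2_inner_scale(1) inner[OF j])
      then show "L2_inner \<mu> (\<lambda>y. r * u $ j * coef \<pi> j i y) (T v) = u $ j * cnj (v $ j)"
        using d by (simp add: r)
    qed
    also have "\<dots> = u \<bullet>c v"
      using uv by (simp add: scalar_prod_def conjugate_complex_def atLeast0LessThan)
    finally show "L2_inner \<mu> (T u) (T v) = u \<bullet>c v" .
  next
    fix g and v :: "complex vec" assume v: "v \<in> carrier_vec d"
    have entry: "(\<pi> g *\<^sub>v v) $ j = (\<Sum>k<d. \<pi> g $$ (j, k) * v $ k)" if "j < d" for j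
      using that v carrier_matD[OF unitary_repD(1)[OF rep, of g]] by (simp add: scalar_prod_def atLeast0LessThan)
    have "T (\<pi> g *\<^sub>v v) y = left_regular g (T v) y" for y
    proof -
      have "left_regular g (T v) y = (\<Sum>k<d. r * v $ k * (\<Sum>j<d. \<pi> g $$ (j, k) * coef \<pi> j i y))"
        unfolding left_regular_def T_def
        by (intro sum.cong refl)
          (simp add: coef_def unitary_rep_add[OF rep _ d(2)] unitary_rep_uminus[OF rep])
      also have "\<dots> = (\<Sum>k<d. \<Sum>j<d. r * (\<pi> g $$ (j, k) * v $ k) * coef \<pi> j i y)"
        by (simp add: sum_distrib_left mult_ac)
      also have "\<dots> = (\<Sum>j<d. \<Sum>k<d. r * (\<pi> g $$ (j, k) * v $ k) * coef \<pi> j i y)" by (rule sum.swap)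
      also have "\<dots> = T (\<pi> g *\<^sub>v v) y"
        unfolding T_def by (intro sum.cong refl) (simp add: entry sum_distrib_left sum_distrib_right mult_ac)
      finally show ?thesis by simp
    qed
    then show "AE y in \<mu>. T (\<pi> g *\<^sub>v v) y = left_regular g (T v) y" by simp
  qed
  then show ?thesis unfolding T_def r_def d_def .
qed

lemma isotypic_sum_coef:
  assumes \<alpha>: "\<alpha> \<in> unitary_dual" and h: "h \<in> isotypic_sum \<mu> \<alpha>"
  obtains k where "k \<in> coef_space (representative \<alpha>)" "AE y in \<mu>. h y = k y" "h \<in> L2 \<mu>"
proof -
  let ?\<pi> = "representative \<alpha>"
  have \<pi>: "?\<pi> \<in> irreps" by (rule representative_mem(2)[OF \<alpha>])
  obtain m :: nat and T v where h_eq: "h = (\<lambda>y. \<Sum>k<m. T k (v k) y)"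
    and T: "\<forall>k<m. regular_embedding \<mu> ?\<pi> (T k) \<and> v k \<in> carrier_vec (dual_dim \<alpha>)"
    using h unfolding isotypic_sum_def mem_Collect_eq by (elim exE conjE)
  have "\<exists>c. k < m \<longrightarrow> c \<in> coef_space ?\<pi> \<and> (AE y in \<mu>. T k (v k) y = c y)" for k
  proof (cases "k < m")
    case True
    then have "regular_embedding \<mu> ?\<pi> (T k)" "v k \<in> carrier_vec (rep_dim ?\<pi>)"
      using T by (simp_all add: dual_dim_def)
    from embedding_coef[OF \<pi> this] obtain c where "c \<in> coef_space ?\<pi>" "AE y in \<mu>. T k (v k) y = c y" .
    then show ?thesis by (intro exI[of _ c]) simp
  qed simp
  then have "\<exists>c. \<forall>k. k < m \<longrightarrow> c k \<in> coef_space ?\<pi> \<and> (AE y in \<mu>. T k (v k) y = c k y)"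
    by (rule choice[OF allI])
  then obtain c where c: "\<And>k. k < m \<Longrightarrow> c k \<in> coef_space ?\<pi>" "\<And>k. k < m \<Longrightarrow> AE y in \<mu>. T k (v k) y = c k y"
    by auto
  have "(\<lambda>y. \<Sum>k<m. c k y) \<in> coef_space ?\<pi>" by (rule coef_space_sum) (simp add: c)
  moreover have "AE y in \<mu>. \<forall>k\<in>{..<m}. T k (v k) y = c k y"
    using c(2) by (intro AE_finite_allI) simp_all
  then have "AE y in \<mu>. h y = (\<Sum>k<m. c k y)"
    by eventually_elim (simp add: h_eq)
  moreover have "h \<in> L2 \<mu>"
    unfolding h_eq
  proof (rule L2_sum)
    fix k assume "k \<in> {..<m}"
    then show "T k (v k) \<in> L2 \<mu>"
      using T by (intro regular_embeddingD(1)[of ?\<pi>]) (simp_all add: dual_dim_def)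
  qed
  ultimately show ?thesis by (rule that)
qed

text \<open>Splitting a coefficient function by its second index gives one embedded copy of \<pi>
  per column, so it already lies in the algebraic sum.\<close>

lemma coef_space_isotypic:
  assumes \<alpha>: "\<alpha> \<in> unitary_dual" and h: "h \<in> coef_space (representative \<alpha>)"
  shows "h \<in> isotypic_component \<mu> \<alpha>"
proof -
  let ?\<pi> = "representative \<alpha>"
  have \<pi>: "?\<pi> \<in> irreps" by (rule representative_mem(2)[OF \<alpha>])
  define d where "d = rep_dim ?\<pi>"
  have d: "0 < d" using irrepsD(1)[OF \<pi>] by (simp add: d_def)
  define r where "r = complex_of_real (sqrt d)"
  have r: "r \<noteq> 0" using d by (simp add: r_def)
  obtain c where c: "h = (\<lambda>x. \<Sum>i<d. \<Sum>j<d. c i j * coef ?\<pi> i j x)"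
    using h unfolding coef_space_def mem_Collect_eq d_def by (elim exE conjE)
  define T where "T i v = (\<lambda>y. \<Sum>j<d. r * v $ j * coef ?\<pi> j i y)" for i and v :: "complex vec"
  \<comment> \<open>Division by r undoes the normalization of the isometric embedding.\<close>
  define v where "v i = vec d (\<lambda>j. c j i / r)" for i
  have h_eq: "h = (\<lambda>y. \<Sum>i<d. T i (v i) y)"
  proof
    fix y
    have "h y = (\<Sum>j<d. \<Sum>i<d. c i j * coef ?\<pi> i j y)" unfolding c by (rule sum.swap)
    also have "\<dots> = (\<Sum>i<d. T i (v i) y)"
      unfolding T_def by (intro sum.cong refl) (simp add: v_def r)
    finally show "h y = (\<Sum>i<d. T i (v i) y)" .
  qed
  have "regular_embedding \<mu> ?\<pi> (T i)" if "i < d" for i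
    using coef_embedding[OF \<pi>, of i] that unfolding T_def r_def d_def .
  then have "h \<in> isotypic_sum \<mu> \<alpha>"
    unfolding isotypic_sum_def mem_Collect_eq
    by (intro exI[of _ T] exI[of _ v] exI[of _ d] conjI h_eq allI impI)
      (simp_all add: v_def d_def dual_dim_def)
  moreover have "L2_norm \<mu> (\<lambda>y. h y - h y) = 0" by (simp add: L2_norm_def)
  ultimately show ?thesis
    unfolding isotypic_component_def using cont_L2[OF coef_space_cont[OF \<pi> h]]
    by (auto intro!: bexI[of _ h])
qed

text \<open>Elements of the algebraic sum agree almost everywhere with coefficient functions, to
  which the residual is orthogonal. Cauchy-Schwarz carries this over to the L2 closure.\<close>

lemma isotypic_component_orthogonal:
  assumes \<alpha>: "\<alpha> \<in> unitary_dual" and f: "f \<in> L2 \<mu>" and h: "h \<in> isotypic_component \<mu> \<alpha>"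
  shows "L2_inner \<mu> (\<lambda>x. f x - coef_proj (representative \<alpha>) f x) h = 0"
proof -
  let ?\<pi> = "representative \<alpha>"
  have \<pi>: "?\<pi> \<in> irreps" by (rule representative_mem(2)[OF \<alpha>])
  define R where "R = (\<lambda>x. f x - coef_proj ?\<pi> f x)"
  have R: "R \<in> L2 \<mu>" unfolding R_def by (intro L2_diff f cont_L2 coef_proj_cont \<pi>)
  have h_L2: "h \<in> L2 \<mu>" and h_approx: "\<forall>e>0. \<exists>k\<in>isotypic_sum \<mu> \<alpha>. L2_norm \<mu> (\<lambda>y. h y - k y) < e"
    using h unfolding isotypic_component_def by simp_all
  have "cmod (L2_inner \<mu> R h) \<le> e" if e: "0 < e" for e
  proof -
    define b where "b = e / (L2_norm \<mu> R + 1)"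
    have pos: "0 < L2_norm \<mu> R + 1" by (simp add: add_nonneg_pos)
    have "0 < b" using e pos by (simp add: b_def)
    then have "\<exists>k\<in>isotypic_sum \<mu> \<alpha>. L2_norm \<mu> (\<lambda>y. h y - k y) < b" using h_approx by simp
    then obtain k where k: "k \<in> isotypic_sum \<mu> \<alpha>" "L2_norm \<mu> (\<lambda>y. h y - k y) < b" ..
    obtain k' where k': "k' \<in> coef_space ?\<pi>" "AE y in \<mu>. k y = k' y" "k \<in> L2 \<mu>"
      by (rule isotypic_sum_coef[OF \<alpha> k(1)])
    have "L2_inner \<mu> R k = L2_inner \<mu> R k'"
      using k' cont_measurable[OF coef_space_cont[OF \<pi> k'(1)]] L2_measurable[OF R] L2_measurable[OF k'(3)]
      by (intro L2_inner_cong_AE) simp_all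
    also have "\<dots> = 0" unfolding R_def by (rule coef_proj_residual[OF \<pi> f k'(1)])
    finally have "L2_inner \<mu> R h = L2_inner \<mu> R (\<lambda>y. h y - k y)"
      by (simp add: L2_inner_diff(2)[OF h_L2 k'(3) R])
    also have "cmod \<dots> \<le> L2_norm \<mu> R * L2_norm \<mu> (\<lambda>y. h y - k y)"
      by (intro L2_Cauchy_Schwarz R L2_diff h_L2 k')
    also have "\<dots> \<le> (L2_norm \<mu> R + 1) * b"
      using k(2) by (intro mult_mono) (simp_all add: less_imp_le)
    also have "\<dots> = e" using pos by (simp add: b_def)
    finally show ?thesis .
  qed
  then have "cmod (L2_inner \<mu> R h) \<le> 0" by (rule field_le_epsilon[of _ 0, simplified])
  then show ?thesis by (simp add: R_def)
qed

text \<open>The projection is an arbitrary choice among functions with the defining property.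
  \<open>coef_proj\<close> shows that such a function exists, and two of them differ by an element
  of zero norm, so agreement is only almost everywhere.\<close>

lemma isotypic_projection_eq:
  assumes \<alpha>: "\<alpha> \<in> unitary_dual" and f: "f \<in> L2 \<mu>"
  shows "isotypic_projection \<mu> \<alpha> f \<in> L2 \<mu>"
    and "AE y in \<mu>. isotypic_projection \<mu> \<alpha> f y = coef_proj (representative \<alpha>) f y"
proof -
  let ?\<pi> = "representative \<alpha>" and ?S = "isotypic_component \<mu> \<alpha>"
  have \<pi>: "?\<pi> \<in> irreps" by (rule representative_mem(2)[OF \<alpha>])
  define p where "p = isotypic_projection \<mu> \<alpha> f"
  define p' where "p' = coef_proj ?\<pi> f"
  have p'_S: "p' \<in> ?S" unfolding p'_def by (rule coef_space_isotypic[OF \<alpha> coef_proj_mem])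
  have p'_orth: "L2_inner \<mu> (\<lambda>x. f x - p' x) h = 0" if "h \<in> ?S" for h
    unfolding p'_def by (rule isotypic_component_orthogonal[OF \<alpha> f that])
  have "p \<in> ?S \<and> (\<forall>h\<in>?S. L2_inner \<mu> (\<lambda>x. f x - p x) h = 0)"
    unfolding p_def isotypic_projection_def orthogonal_projection_def
    by (rule someI[of "\<lambda>p. p \<in> ?S \<and> (\<forall>h\<in>?S. L2_inner \<mu> (\<lambda>x. f x - p x) h = 0)" p'])
      (use p'_S p'_orth in simp)
  then have p: "p \<in> ?S" "\<And>h. h \<in> ?S \<Longrightarrow> L2_inner \<mu> (\<lambda>x. f x - p x) h = 0" by simp_all
  have p_L2: "p \<in> L2 \<mu>" using p(1) by (simp add: isotypic_component_def)
  have p'_L2: "p' \<in> L2 \<mu>" unfolding p'_def by (intro cont_L2 coef_proj_cont \<pi>)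
  have *: "L2_inner \<mu> p h = L2_inner \<mu> f h" "L2_inner \<mu> p' h = L2_inner \<mu> f h" if "h \<in> ?S" for h
  proof -
    have "h \<in> L2 \<mu>" using that by (simp add: isotypic_component_def)
    then show "L2_inner \<mu> p h = L2_inner \<mu> f h" "L2_inner \<mu> p' h = L2_inner \<mu> f h"
      using p(2)[OF that] p'_orth[OF that] by (simp_all add: L2_inner_diff(1) f p_L2 p'_L2)
  qed
  have "L2_inner \<mu> (\<lambda>x. p x - p' x) (\<lambda>x. p x - p' x) = 0"
    by (simp add: L2_inner_diff p_L2 p'_L2 L2_diff *[OF p(1)] *[OF p'_S])
  then have "L2_norm \<mu> (\<lambda>x. p x - p' x) = 0" unfolding L2_inner_self by simp
  from L2_norm_eq_0[OF L2_diff[OF p_L2 p'_L2] this]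
  show "AE y in \<mu>. isotypic_projection \<mu> \<alpha> f y = coef_proj ?\<pi> f y"
    by (simp add: p_def p'_def)
  show "isotypic_projection \<mu> \<alpha> f \<in> L2 \<mu>" using p_L2 by (simp add: p_def)
qed

section \<open>The class operator\<close>

lemma conj_shift: "- (x + g0 - x) + y = x + - g0 + - x + (y :: 'g)"
  by (simp add: minus_add add.assoc diff_conv_add_uminus del: add_uminus_conv_diff)

lemma class_operator_eq: "class_operator \<mu> g0 f y = (\<integral>x. f (x + - g0 + - x + y) \<partial>\<mu>)"
  unfolding class_operator_def left_regular_def conj_shift ..

lemma cont_conj: "continuous_on UNIV (\<lambda>x::'g. x + a + - x + y)"
  by (intro continuous_intros)

lemma class_integrable:
  assumes "cont f"
  shows "integrable \<mu> (\<lambda>x. f (x + - g0 + - x + y))"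
  by (rule cont_integrable[OF continuous_on_compose2[OF assms cont_conj]]) simp

lemma class_operator_sum:
  assumes "\<And>i. i \<in> I \<Longrightarrow> cont (f i)"
  shows "class_operator \<mu> g0 (\<lambda>y. \<Sum>i\<in>I. f i y) = (\<lambda>y. \<Sum>i\<in>I. class_operator \<mu> g0 (f i) y)"
  unfolding class_operator_eq
  by (intro ext Bochner_Integration.integral_sum class_integrable assms)

lemma class_operator_scale:
  "class_operator \<mu> g0 (\<lambda>y. c * f y) = (\<lambda>y. c * class_operator \<mu> g0 f y)"
  unfolding class_operator_eq by simp

definition rep_character :: "('g \<Rightarrow> complex mat) \<Rightarrow> 'g \<Rightarrow> complex" where
  "rep_character \<pi> g = (\<Sum>i<rep_dim \<pi>. \<pi> g $$ (i, i))"

text \<open>Expand the entry at x g0\<inverse> x\<inverse> y; after integration over x the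
  orthogonality relations leave the diagonal entries of \<pi> at g0. The two conjugations, from
  \<open>coef\<close> and from the inverse of g0, cancel, so the character appears at g0 itself and
  unconjugated.\<close>

lemma class_operator_coef:
  assumes \<pi>: "\<pi> \<in> irreps" and ij: "i < rep_dim \<pi>" "j < rep_dim \<pi>"
  shows "class_operator \<mu> g0 (coef \<pi> i j) =
    (\<lambda>y. rep_character \<pi> g0 / of_nat (rep_dim \<pi>) * coef \<pi> i j y)"
proof
  fix y
  let ?d = "rep_dim \<pi>"
  note rep = irrepsD(2)[OF \<pi>]
  have expand: "coef \<pi> i j (x + - g0 + - x + y)
      = (\<Sum>a<?d. \<Sum>c<?d. \<Sum>b<?d. (\<pi> g0 $$ (c, b) * coef \<pi> a j y) * (\<pi> x $$ (a, c) * cnj (\<pi> x $$ (i, b))))" for x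
  proof -
    have 1: "cnj (\<pi> (x + - g0 + - x) $$ (i, a))
        = (\<Sum>c<?d. \<Sum>b<?d. \<pi> g0 $$ (c, b) * (\<pi> x $$ (a, c) * cnj (\<pi> x $$ (i, b))))" if a: "a < ?d" for a
    proof -
      have "cnj (\<pi> (x + - g0 + - x) $$ (i, a)) = (\<Sum>c<?d. cnj (\<pi> (x + - g0) $$ (i, c)) * \<pi> x $$ (a, c))"
        unfolding unitary_rep_add[OF rep ij(1) a] cnj_sum
        by (intro sum.cong refl) (simp add: unitary_rep_uminus[OF rep _ a])
      also have "\<dots> = (\<Sum>c<?d. (\<Sum>b<?d. cnj (\<pi> x $$ (i, b)) * \<pi> g0 $$ (c, b)) * \<pi> x $$ (a, c))"
      proof (rule sum.cong[OF refl])
        fix c assume "c \<in> {..<?d}"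
        then have c: "c < ?d" by simp
        have "cnj (\<pi> (x + - g0) $$ (i, c)) = (\<Sum>b<?d. cnj (\<pi> x $$ (i, b)) * \<pi> g0 $$ (c, b))"
          unfolding unitary_rep_add[OF rep ij(1) c] cnj_sum
          by (intro sum.cong refl) (simp add: unitary_rep_uminus[OF rep _ c])
        then show "cnj (\<pi> (x + - g0) $$ (i, c)) * \<pi> x $$ (a, c)
            = (\<Sum>b<?d. cnj (\<pi> x $$ (i, b)) * \<pi> g0 $$ (c, b)) * \<pi> x $$ (a, c)" by simp
      qed
      also have "\<dots> = (\<Sum>c<?d. \<Sum>b<?d. \<pi> g0 $$ (c, b) * (\<pi> x $$ (a, c) * cnj (\<pi> x $$ (i, b))))"
        unfolding sum_distrib_right by (intro sum.cong refl) (simp only: mult_ac)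
      finally show ?thesis .
    qed
    have "coef \<pi> i j (x + - g0 + - x + y) = (\<Sum>a<?d. cnj (\<pi> (x + - g0 + - x) $$ (i, a)) * coef \<pi> a j y)"
      unfolding coef_def unitary_rep_add[OF rep ij, of "x + - g0 + - x" y] cnj_sum by (simp only: complex_cnj_mult)
    also have "\<dots> = (\<Sum>a<?d. \<Sum>c<?d. \<Sum>b<?d. (\<pi> g0 $$ (c, b) * coef \<pi> a j y) * (\<pi> x $$ (a, c) * cnj (\<pi> x $$ (i, b))))"
    proof (rule sum.cong[OF refl])
      fix a assume "a \<in> {..<?d}"
      then have a: "a < ?d" by simp
      show "cnj (\<pi> (x + - g0 + - x) $$ (i, a)) * coef \<pi> a j y
          = (\<Sum>c<?d. \<Sum>b<?d. (\<pi> g0 $$ (c, b) * coef \<pi> a j y) * (\<pi> x $$ (a, c) * cnj (\<pi> x $$ (i, b))))"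
        unfolding 1[OF a] sum_distrib_right by (intro sum.cong refl) (simp only: mult_ac)
    qed
    finally show ?thesis .
  qed
  have int: "integrable \<mu> (\<lambda>x. (\<pi> g0 $$ (c, b) * coef \<pi> a j y) * (\<pi> x $$ (a, c) * cnj (\<pi> x $$ (i, b))))"
    if "a < ?d" "b < ?d" "c < ?d" for a b c
    by (intro cont_integrable continuous_on_mult continuous_on_const cont_coef[OF rep] that ij)
  have "class_operator \<mu> g0 (coef \<pi> i j) y = (\<Sum>a<?d. \<Sum>c<?d. \<Sum>b<?d.
      \<integral>x. (\<pi> g0 $$ (c, b) * coef \<pi> a j y) * (\<pi> x $$ (a, c) * cnj (\<pi> x $$ (i, b))) \<partial>\<mu>)"
    unfolding class_operator_eq expand
    by (subst Bochner_Integration.integral_sum, intro Bochner_Integration.integrable_sum int, simp_all,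
        intro sum.cong refl, subst Bochner_Integration.integral_sum, intro Bochner_Integration.integrable_sum int, simp_all,
        intro sum.cong refl, subst Bochner_Integration.integral_sum, intro int, simp_all)
  also have "\<dots> = (\<Sum>a<?d. \<Sum>c<?d. \<Sum>b<?d. (\<pi> g0 $$ (c, b) * coef \<pi> a j y / of_nat ?d * of_bool (a = i)) * of_bool (c = b))"
    using ij by (intro sum.cong refl) (simp add: schur_orthogonality[OF \<pi> refl])
  also have "\<dots> = (\<Sum>a<?d. \<Sum>c<?d. \<pi> g0 $$ (c, c) * coef \<pi> a j y / of_nat ?d * of_bool (a = i))"
    by (intro sum.cong refl delta_sum(2)) simp
  also have "\<dots> = (\<Sum>a<?d. (rep_character \<pi> g0 * coef \<pi> a j y / of_nat ?d) * of_bool (a = i))"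
    unfolding rep_character_def by (simp only: sum_distrib_right sum_divide_distrib)
  also have "\<dots> = rep_character \<pi> g0 * coef \<pi> i j y / of_nat ?d" by (rule delta_sum(1)[OF ij(1)])
  finally show "class_operator \<mu> g0 (coef \<pi> i j) y = rep_character \<pi> g0 / of_nat ?d * coef \<pi> i j y"
    by simp
qed

lemma class_operator_coef_space:
  assumes \<pi>: "\<pi> \<in> irreps" and h: "h \<in> coef_space \<pi>"
  shows "class_operator \<mu> g0 h = (\<lambda>y. rep_character \<pi> g0 / of_nat (rep_dim \<pi>) * h y)"
proof -
  let ?d = "rep_dim \<pi>" and ?s = "rep_character \<pi> g0 / of_nat (rep_dim \<pi>)"
  obtain c where c: "h = (\<lambda>x. \<Sum>i<?d. \<Sum>j<?d. c i j * coef \<pi> i j x)"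
    using h unfolding coef_space_def mem_Collect_eq by (elim exE conjE)
  have cont1: "cont (\<lambda>x. c i j * coef \<pi> i j x)" if "i < ?d" "j < ?d" for i j
    by (intro continuous_on_mult continuous_on_const cont_coef'[OF irrepsD(2)[OF \<pi>]] that)
  have cont2: "cont (\<lambda>x. \<Sum>j<?d. c i j * coef \<pi> i j x)" if "i < ?d" for i
    by (intro continuous_on_sum cont1) (use that in simp_all)
  have row: "class_operator \<mu> g0 (\<lambda>x. \<Sum>j<?d. c i j * coef \<pi> i j x) = (\<lambda>x. \<Sum>j<?d. ?s * (c i j * coef \<pi> i j x))"
    if i: "i < ?d" for i
  proof -
    have "class_operator \<mu> g0 (\<lambda>x. \<Sum>j<?d. c i j * coef \<pi> i j x)
        = (\<lambda>x. \<Sum>j<?d. class_operator \<mu> g0 (\<lambda>x. c i j * coef \<pi> i j x) x)"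
      by (rule class_operator_sum) (use cont1 i in simp)
    also have "\<dots> = (\<lambda>x. \<Sum>j<?d. ?s * (c i j * coef \<pi> i j x))"
      by (intro ext sum.cong refl) (simp add: class_operator_scale class_operator_coef[OF \<pi> i])
    finally show ?thesis .
  qed
  have "class_operator \<mu> g0 h = (\<lambda>x. \<Sum>i<?d. class_operator \<mu> g0 (\<lambda>x. \<Sum>j<?d. c i j * coef \<pi> i j x) x)"
    unfolding c by (rule class_operator_sum) (use cont2 in simp)
  also have "\<dots> = (\<lambda>x. \<Sum>i<?d. \<Sum>j<?d. ?s * (c i j * coef \<pi> i j x))"
    by (intro ext sum.cong refl) (simp add: row)
  also have "\<dots> = (\<lambda>x. ?s * h x)" unfolding c sum_distrib_left ..
  finally show ?thesis .
qed

text \<open>Invariance of the trace under conjugation makes the character constant on the class; the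
  class contains g0, so the common value is unique.\<close>

lemma dual_character_class:
  assumes \<alpha>: "\<alpha> \<in> unitary_dual"
  shows "dual_character_on \<alpha> (conj_class g0) = rep_character (representative \<alpha>) g0"
proof -
  let ?\<pi> = "representative \<alpha>"
  let ?d = "rep_dim ?\<pi>"
  note rep = irrepsD(2)[OF representative_mem(2)[OF \<alpha>]]
  have char: "dual_character \<alpha> g = rep_character ?\<pi> g" for g
    by (simp add: dual_character_def rep_character_def dual_dim_def)
  have invariant: "rep_character ?\<pi> (x + (g0 + - x)) = rep_character ?\<pi> g0" for x
  proof -
    have "rep_character ?\<pi> (x + (g0 + - x)) = (\<Sum>i<?d. \<Sum>j<?d. ?\<pi> x $$ (i, j) * ?\<pi> (g0 + - x) $$ (j, i))"
      unfolding rep_character_def by (intro sum.cong refl unitary_rep_add[OF rep]) simp_all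
    also have "\<dots> = (\<Sum>j<?d. \<Sum>i<?d. ?\<pi> (g0 + - x) $$ (j, i) * ?\<pi> x $$ (i, j))"
      by (subst sum.swap) (simp only: mult.commute)
    also have "\<dots> = (\<Sum>j<?d. ?\<pi> (g0 + - x + x) $$ (j, j))"
      by (intro sum.cong refl unitary_rep_add[OF rep, symmetric]) simp_all
    finally show ?thesis by (simp add: rep_character_def add.assoc)
  qed
  show ?thesis
    unfolding dual_character_on_def
  proof (rule the_equality)
    show "\<forall>g\<in>conj_class g0. dual_character \<alpha> g = rep_character ?\<pi> g0"
      unfolding conj_class_def char using invariant by (auto simp: add.assoc diff_conv_add_uminus simp del: add_uminus_conv_diff)
    fix c assume c: "\<forall>g\<in>conj_class g0. dual_character \<alpha> g = c"
    have "0 + g0 - 0 \<in> conj_class g0" unfolding conj_class_def by (intro CollectI exI[of _ 0]) simp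
    then show "c = rep_character ?\<pi> g0" using c by (simp add: char)
  qed
qed

section \<open>The class operator as a contraction\<close>

text \<open>For fixed x the integral over y is the squared norm of f by left invariance, and Fubini
  exchanges the order. Hence for almost every y the integrand of the class operator is square
  integrable in x; at the remaining y its integral may be a default value.\<close>

lemma class_square_integral:
  assumes f: "f \<in> L2 \<mu>"
  shows "(\<integral>\<^sup>+y. \<integral>\<^sup>+x. ennreal ((cmod (f (x + - g0 + - x + y)))\<^sup>2) \<partial>\<mu> \<partial>\<mu>) = ennreal ((L2_norm \<mu> f)\<^sup>2)"
    and "AE y in \<mu>. (\<lambda>x. f (x + - g0 + - x + y)) \<in> L2 \<mu>"
    and "(\<lambda>y. class_operator \<mu> g0 f y) \<in> borel_measurable borel"
proof -
  note [measurable] = L2_measurable[OF f]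
  have shift: "(\<lambda>z::'g \<times> 'g. fst z + - g0 + - fst z + snd z) \<in> measurable borel borel"
    by (intro borel_measurable_continuous_onI continuous_intros)
  have F: "(\<lambda>z. f (fst z + - g0 + - fst z + snd z)) \<in> borel_measurable (borel :: ('g \<times> 'g) measure)"
    by (rule measurable_compose[OF shift L2_measurable[OF f]])
  define G where "G z = ennreal ((cmod (f (fst z + - g0 + - fst z + snd z)))\<^sup>2)" for z
  have G: "G \<in> borel_measurable borel"
    unfolding G_def
    by (rule measurable_compose[OF borel_measurable_power[OF measurable_compose[OF F borel_measurable_norm]] measurable_ennreal])
  have inner: "(\<integral>\<^sup>+y. G (x, y) \<partial>\<mu>) = ennreal ((L2_norm \<mu> f)\<^sup>2)" for x
  proof -
    have "(\<integral>\<^sup>+y. G (x, y) \<partial>\<mu>) = (\<integral>\<^sup>+y. ennreal ((cmod (f y))\<^sup>2) \<partial>\<mu>)"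
      unfolding G_def fst_conv snd_conv by (rule nn_integral_left) simp
    then show ?thesis
      using nn_integral_eq_integral[OF L2_norm_square_integrable[OF f]] by (simp add: L2_norm_square)
  qed
  have eq: "(\<integral>\<^sup>+y. \<integral>\<^sup>+x. G (x, y) \<partial>\<mu> \<partial>\<mu>) = ennreal ((L2_norm \<mu> f)\<^sup>2)"
    using Fubini_nn_integral[OF G] emeasure_space_1 by (simp add: inner)
  then show "(\<integral>\<^sup>+y. \<integral>\<^sup>+x. ennreal ((cmod (f (x + - g0 + - x + y)))\<^sup>2) \<partial>\<mu> \<partial>\<mu>) = ennreal ((L2_norm \<mu> f)\<^sup>2)"
    by (simp only: G_def fst_conv snd_conv)
  have "AE y in \<mu>. (\<integral>\<^sup>+x. G (x, y) \<partial>\<mu>) \<noteq> \<infinity>"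
    by (rule nn_integral_PInf_AE[OF measurable_nn_integral_section(2)[OF G]]) (simp add: eq)
  then show "AE y in \<mu>. (\<lambda>x. f (x + - g0 + - x + y)) \<in> L2 \<mu>"
  proof eventually_elim
    case (elim y)
    have meas: "(\<lambda>x. f (x + - g0 + - x + y)) \<in> borel_measurable borel"
      by (rule measurable_compose[OF borel_measurable_continuous_onI[OF cont_conj] L2_measurable[OF f]])
    have "integrable \<mu> (\<lambda>x. (cmod (f (x + - g0 + - x + y)))\<^sup>2)"
    proof (rule integrableI_bounded)
      show "(\<lambda>x. (cmod (f (x + - g0 + - x + y)))\<^sup>2) \<in> borel_measurable \<mu>" using meas by simp
      show "(\<integral>\<^sup>+x. ennreal (norm ((cmod (f (x + - g0 + - x + y)))\<^sup>2)) \<partial>\<mu>) < \<infinity>"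
        using elim by (simp add: G_def less_top)
    qed
    then show ?case using meas by (simp add: L2_def)
  qed
  show "(\<lambda>y. class_operator \<mu> g0 f y) \<in> borel_measurable borel"
    using measurable_integral_section(2)[OF F] by (simp add: class_operator_eq)
qed

text \<open>For almost every y, \<open>L2_norm_integral\<close> bounds the squared modulus at y by
  the integral of the squares over x; integration over y then gives the squared norm of f.\<close>

lemma class_operator_L2:
  assumes f: "f \<in> L2 \<mu>"
  shows "class_operator \<mu> g0 f \<in> L2 \<mu>" and "L2_norm \<mu> (class_operator \<mu> g0 f) \<le> L2_norm \<mu> f"
proof -
  note meas = class_square_integral(3)[OF f]
  have "AE y in \<mu>. ennreal ((cmod (class_operator \<mu> g0 f y))\<^sup>2)
      \<le> (\<integral>\<^sup>+x. ennreal ((cmod (f (x + - g0 + - x + y)))\<^sup>2) \<partial>\<mu>)"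
    using class_square_integral(2)[OF f, of g0]
  proof eventually_elim
    case (elim y)
    let ?F = "\<lambda>x. f (x + - g0 + - x + y)"
    have "cmod (class_operator \<mu> g0 f y) \<le> L2_norm \<mu> ?F"
      unfolding class_operator_eq
      by (rule order_trans[OF integral_norm_bound L2_norm_integral[OF elim]])
    then have "(cmod (class_operator \<mu> g0 f y))\<^sup>2 \<le> (\<integral>x. (cmod (?F x))\<^sup>2 \<partial>\<mu>)"
      unfolding L2_norm_square[symmetric] by (intro power_mono) simp_all
    then show ?case
      using nn_integral_eq_integral[OF L2_norm_square_integrable[OF elim]] by (simp add: ennreal_leI)
  qed
  from nn_integral_mono_AE[OF this]
  have le: "(\<integral>\<^sup>+y. ennreal ((cmod (class_operator \<mu> g0 f y))\<^sup>2) \<partial>\<mu>) \<le> ennreal ((L2_norm \<mu> f)\<^sup>2)"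
    by (simp only: class_square_integral(1)[OF f])
  have int: "integrable \<mu> (\<lambda>y. (cmod (class_operator \<mu> g0 f y))\<^sup>2)"
  proof (rule integrableI_bounded)
    show "(\<lambda>y. (cmod (class_operator \<mu> g0 f y))\<^sup>2) \<in> borel_measurable \<mu>" using meas by simp
    show "(\<integral>\<^sup>+y. ennreal (norm ((cmod (class_operator \<mu> g0 f y))\<^sup>2)) \<partial>\<mu>) < \<infinity>"
      using le_less_trans[OF le ennreal_less_top] by simp
  qed
  then show "class_operator \<mu> g0 f \<in> L2 \<mu>" using meas by (simp add: L2_def)
  have "ennreal ((L2_norm \<mu> (class_operator \<mu> g0 f))\<^sup>2) \<le> ennreal ((L2_norm \<mu> f)\<^sup>2)"
    using le nn_integral_eq_integral[OF int] by (simp add: L2_norm_square)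
  then have "(L2_norm \<mu> (class_operator \<mu> g0 f))\<^sup>2 \<le> (L2_norm \<mu> f)\<^sup>2" by simp
  then show "L2_norm \<mu> (class_operator \<mu> g0 f) \<le> L2_norm \<mu> f"
    by (rule power2_le_imp_le) simp
qed

text \<open>Additivity can fail where one of the two integrals does not exist, hence the exceptional
  null set.\<close>

lemma class_operator_diff:
  assumes f: "f \<in> L2 \<mu>" and g: "g \<in> L2 \<mu>"
  shows "AE y in \<mu>. class_operator \<mu> g0 (\<lambda>x. f x - g x) y = class_operator \<mu> g0 f y - class_operator \<mu> g0 g y"
  using class_square_integral(2)[OF f, of g0] class_square_integral(2)[OF g, of g0]
  by eventually_elim (simp add: class_operator_eq L2_integrable)

section \<open>Partial sums and strong convergence\<close>

text \<open>Coefficient spaces of distinct classes are orthogonal, so the residual is orthogonal to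
  each of them in F and Pythagoras applies. This turns density of trigonometric polynomials into
  convergence of the partial sums over all large F.\<close>

lemma best_approximation:
  assumes f: "f \<in> L2 \<mu>" and F: "finite F" "F \<subseteq> unitary_dual"
    and h: "\<And>\<alpha>. \<alpha> \<in> F \<Longrightarrow> h \<alpha> \<in> coef_space (representative \<alpha>)"
  shows "L2_norm \<mu> (\<lambda>x. f x - (\<Sum>\<alpha>\<in>F. coef_proj (representative \<alpha>) f x)) \<le> L2_norm \<mu> (\<lambda>x. f x - (\<Sum>\<alpha>\<in>F. h \<alpha> x))"
proof -
  have irr: "representative \<alpha> \<in> irreps" if "\<alpha> \<in> F" for \<alpha>
    using that F(2) by (intro representative_mem(2)) auto
  define p where "p \<alpha> = coef_proj (representative \<alpha>) f" for \<alpha>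
  have p_L2: "p \<alpha> \<in> L2 \<mu>" if "\<alpha> \<in> F" for \<alpha>
    unfolding p_def by (intro cont_L2 coef_proj_cont irr that)
  define R where "R = (\<lambda>x. f x - (\<Sum>\<alpha>\<in>F. p \<alpha> x))"
  have R: "R \<in> L2 \<mu>" unfolding R_def by (intro L2_diff f L2_sum p_L2)
  have orth: "L2_inner \<mu> R k = 0" if \<beta>: "\<beta> \<in> F" and k: "k \<in> coef_space (representative \<beta>)" for \<beta> k
  proof -
    have k_L2: "k \<in> L2 \<mu>" by (rule cont_L2[OF coef_space_cont[OF irr[OF \<beta>] k]])
    have "L2_inner \<mu> (p \<alpha>) k = (if \<alpha> = \<beta> then L2_inner \<mu> f k else 0)" if \<alpha>: "\<alpha> \<in> F" for \<alpha>
    proof (cases "\<alpha> = \<beta>")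
      case True
      then show ?thesis
        using coef_proj_residual[OF irr[OF \<beta>] f k] L2_inner_diff(1)[OF f p_L2[OF \<beta>] k_L2] by (simp add: p_def)
    next
      case False
      have "\<alpha> \<in> unitary_dual" "\<beta> \<in> unitary_dual" using \<alpha> \<beta> F(2) by auto
      then have "(representative \<alpha>, representative \<beta>) \<notin> rep_equiv"
        using representative_equiv False by auto
      then show ?thesis
        using inner_coef_spaces_0[OF irr[OF \<alpha>] irr[OF \<beta>] _ coef_proj_mem k] False by (simp add: p_def)
    qed
    then have "L2_inner \<mu> (\<lambda>x. \<Sum>\<alpha>\<in>F. p \<alpha> x) k = L2_inner \<mu> f k"
      using F(1) \<beta> p_L2 k_L2 by (simp add: L2_inner_sum(1) sum.delta)
    then show ?thesis
      unfolding R_def using p_L2 by (simp add: L2_inner_diff(1)[OF f L2_sum k_L2])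
  qed
  define D where "D = (\<lambda>x. \<Sum>\<alpha>\<in>F. h \<alpha> x - p \<alpha> x)"
  have h_L2: "h \<alpha> \<in> L2 \<mu>" if "\<alpha> \<in> F" for \<alpha> using cont_L2[OF coef_space_cont[OF irr[OF that] h[OF that]]] .
  have D_L2: "D \<in> L2 \<mu>" unfolding D_def by (intro L2_sum L2_diff h_L2 p_L2)
  have "L2_inner \<mu> R D = (\<Sum>\<alpha>\<in>F. L2_inner \<mu> R (\<lambda>x. h \<alpha> x - p \<alpha> x))"
    unfolding D_def by (rule L2_inner_sum(2)) (auto intro!: L2_diff h_L2 p_L2 R)
  also have "\<dots> = 0"
    using orth[OF _ h] orth[OF _ coef_proj_mem] R h_L2 p_L2
    by (intro sum.neutral ballI) (simp add: L2_inner_diff(2) p_def)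
  finally have RD: "L2_inner \<mu> R D = 0" .
  have "(\<lambda>x. f x - (\<Sum>\<alpha>\<in>F. h \<alpha> x)) = (\<lambda>x. R x - D x)"
    by (simp add: R_def D_def sum_subtractf fun_eq_iff)
  then have "(L2_norm \<mu> (\<lambda>x. f x - (\<Sum>\<alpha>\<in>F. h \<alpha> x)))\<^sup>2 = (L2_norm \<mu> R)\<^sup>2 + (L2_norm \<mu> D)\<^sup>2"
    by (simp only: L2_norm_diff_square[OF R D_L2] RD) simp
  then have "(L2_norm \<mu> R)\<^sup>2 \<le> (L2_norm \<mu> (\<lambda>x. f x - (\<Sum>\<alpha>\<in>F. h \<alpha> x)))\<^sup>2" by simp
  then have "L2_norm \<mu> R \<le> L2_norm \<mu> (\<lambda>x. f x - (\<Sum>\<alpha>\<in>F. h \<alpha> x))"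
    by (rule power2_le_imp_le) simp
  then show ?thesis by (simp add: R_def p_def)
qed

text \<open>The operator multiplies each \<alpha>-part by its scalar, so the sum over F is almost
  everywhere its value on the partial Fourier sum of f. The difference is the operator applied to
  the remainder, and the contraction property finishes.\<close>

lemma class_operator_partial_sum:
  fixes g0 :: 'g
  assumes f: "f \<in> L2 \<mu>" and F: "finite F" "F \<subseteq> unitary_dual"
  defines "A \<equiv> \<lambda>\<alpha> y. 1 / of_nat (dual_dim \<alpha>) * dual_character_on \<alpha> (conj_class g0) * isotypic_projection \<mu> \<alpha> f y"
  shows "L2_norm \<mu> (\<lambda>y. class_operator \<mu> g0 f y - (\<Sum>\<alpha>\<in>F. A \<alpha> y))
    \<le> L2_norm \<mu> (\<lambda>x. f x - (\<Sum>\<alpha>\<in>F. coef_proj (representative \<alpha>) f x))"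
proof -
  have irr: "representative \<alpha> \<in> irreps" if "\<alpha> \<in> F" for \<alpha>
    using that F(2) by (intro representative_mem(2)) auto
  define p where "p \<alpha> = coef_proj (representative \<alpha>) f" for \<alpha>
  have p_cont: "cont (p \<alpha>)" if "\<alpha> \<in> F" for \<alpha> unfolding p_def by (intro coef_proj_cont irr that)
  define P where "P = (\<lambda>x. \<Sum>\<alpha>\<in>F. p \<alpha> x)"
  have P_L2: "P \<in> L2 \<mu>" unfolding P_def by (intro L2_sum cont_L2 p_cont)
  have TP: "class_operator \<mu> g0 P = (\<lambda>y. \<Sum>\<alpha>\<in>F. 1 / of_nat (dual_dim \<alpha>) * dual_character_on \<alpha> (conj_class g0) * p \<alpha> y)"
  proof -
    have "class_operator \<mu> g0 P = (\<lambda>y. \<Sum>\<alpha>\<in>F. class_operator \<mu> g0 (p \<alpha>) y)"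
      unfolding P_def by (rule class_operator_sum[OF p_cont])
    also have "\<dots> = (\<lambda>y. \<Sum>\<alpha>\<in>F. 1 / of_nat (dual_dim \<alpha>) * dual_character_on \<alpha> (conj_class g0) * p \<alpha> y)"
    proof (intro ext sum.cong refl)
      fix y \<alpha> assume \<alpha>: "\<alpha> \<in> F"
      then have "\<alpha> \<in> unitary_dual" using F(2) by auto
      then show "class_operator \<mu> g0 (p \<alpha>) y = 1 / of_nat (dual_dim \<alpha>) * dual_character_on \<alpha> (conj_class g0) * p \<alpha> y"
        using class_operator_coef_space[OF irr[OF \<alpha>] coef_proj_mem]
        by (simp add: p_def dual_character_class dual_dim_def)
    qed
    finally show ?thesis .
  qed
  have proj: "isotypic_projection \<mu> \<alpha> f \<in> L2 \<mu>" "AE y in \<mu>. isotypic_projection \<mu> \<alpha> f y = p \<alpha> y"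
    if "\<alpha> \<in> F" for \<alpha>
    using isotypic_projection_eq[OF _ f, of \<alpha>] that F(2) by (auto simp: p_def)
  have A_L2: "A \<alpha> \<in> L2 \<mu>" if "\<alpha> \<in> F" for \<alpha> unfolding A_def by (intro L2_scale proj that)
  have "AE y in \<mu>. \<forall>\<alpha>\<in>F. isotypic_projection \<mu> \<alpha> f y = p \<alpha> y"
    using proj(2) by (intro AE_finite_allI F(1))
  then have "AE y in \<mu>. (\<Sum>\<alpha>\<in>F. A \<alpha> y) = class_operator \<mu> g0 P y"
    by eventually_elim (simp add: A_def TP)
  with class_operator_diff[OF f P_L2, of g0]
  have AE: "AE y in \<mu>. class_operator \<mu> g0 f y - (\<Sum>\<alpha>\<in>F. A \<alpha> y) = class_operator \<mu> g0 (\<lambda>x. f x - P x) y"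
    by eventually_elim simp
  have fP: "(\<lambda>x. f x - P x) \<in> L2 \<mu>" by (rule L2_diff[OF f P_L2])
  have "(\<lambda>y. class_operator \<mu> g0 f y - (\<Sum>\<alpha>\<in>F. A \<alpha> y)) \<in> L2 \<mu>"
    by (intro L2_diff class_operator_L2(1) f L2_sum A_L2)
  then have "L2_norm \<mu> (\<lambda>y. class_operator \<mu> g0 f y - (\<Sum>\<alpha>\<in>F. A \<alpha> y)) = L2_norm \<mu> (class_operator \<mu> g0 (\<lambda>x. f x - P x))"
    by (rule L2_norm_cong_AE[OF L2_measurable L2_measurable[OF class_operator_L2(1)[OF fP]] AE])
  also have "\<dots> \<le> L2_norm \<mu> (\<lambda>x. f x - P x)" by (rule class_operator_L2(2)[OF fP])
  finally show ?thesis by (simp add: P_def p_def)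
qed

lemma class_operator_expansion:
  "has_strong_operator_sum \<mu>
     (\<lambda>\<alpha> f y. 1 / of_nat (dual_dim \<alpha>) * dual_character_on \<alpha> (conj_class g0) * isotypic_projection \<mu> \<alpha> f y)
     unitary_dual (class_operator \<mu> g0)"
  unfolding has_strong_operator_sum_def
proof (intro ballI conjI)
  fix f assume f: "f \<in> L2 \<mu>"
  show "class_operator \<mu> g0 f \<in> L2 \<mu>" by (rule class_operator_L2(1)[OF f])
  show "(\<lambda>y. 1 / of_nat (dual_dim \<alpha>) * dual_character_on \<alpha> (conj_class g0) * isotypic_projection \<mu> \<alpha> f y) \<in> L2 \<mu>"
    if "\<alpha> \<in> unitary_dual" for \<alpha>
    by (rule L2_scale[OF isotypic_projection_eq(1)[OF that f]])
  let ?N = "\<lambda>F. L2_norm \<mu> (\<lambda>y. class_operator \<mu> g0 f y -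
    (\<Sum>\<alpha>\<in>F. 1 / of_nat (dual_dim \<alpha>) * dual_character_on \<alpha> (conj_class g0) * isotypic_projection \<mu> \<alpha> f y))"
  show "(?N \<longlongrightarrow> 0) (finite_subsets_at_top unitary_dual)"
  proof (rule tendstoI)
    fix e :: real assume e: "0 < e"
    obtain h where h: "h \<in> trig_polys" "L2_norm \<mu> (\<lambda>x. f x - h x) < e"
      by (rule trig_polys_dense[OF f e])
    obtain F0 k where F0: "h = (\<lambda>x. \<Sum>\<alpha>\<in>F0. k \<alpha> x)" "finite F0" "F0 \<subseteq> unitary_dual"
      "\<forall>\<alpha>\<in>F0. k \<alpha> \<in> coef_space (representative \<alpha>)" using h(1) by (rule trig_polysE)
    have "dist (?N F) 0 < e" if F: "finite F" "F0 \<subseteq> F" "F \<subseteq> unitary_dual" for F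
    proof -
      \<comment> \<open>Padding with zeros on F - F0 makes h admissible in
        \<open>best_approximation\<close> for every F above F0.\<close>
      define k' where "k' \<alpha> = (if \<alpha> \<in> F0 then k \<alpha> else (\<lambda>x. 0))" for \<alpha>
      have k': "k' \<alpha> \<in> coef_space (representative \<alpha>)" for \<alpha>
        using F0(4) by (simp add: k'_def coef_space_0)
      have h_eq: "h x = (\<Sum>\<alpha>\<in>F. k' \<alpha> x)" for x
        unfolding F0(1) using F by (intro sum.mono_neutral_cong_left) (auto simp: k'_def)
      have "?N F \<le> L2_norm \<mu> (\<lambda>x. f x - (\<Sum>\<alpha>\<in>F. coef_proj (representative \<alpha>) f x))"
        by (rule class_operator_partial_sum[OF f F(1,3)])
      also have "\<dots> \<le> L2_norm \<mu> (\<lambda>x. f x - h x)"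
        using best_approximation[OF f F(1,3), of k'] k' by (simp only: h_eq)
      finally show ?thesis using h(2) by simp
    qed
    then show "\<forall>\<^sub>F F in finite_subsets_at_top unitary_dual. dist (?N F) 0 < e"
      unfolding eventually_finite_subsets_at_top using F0(2,3) by (intro exI[of _ F0]) simp
  qed
qed

end

theorem proposition2:
  fixes \<mu> :: "'g::{topological_group_add, t2_space} measure" and g0 :: 'g
  assumes "compact (UNIV :: 'g set)" and "normalized_haar \<mu>"
  shows "has_strong_operator_sum \<mu>
           (\<lambda>\<alpha> f y. 1 / of_nat (dual_dim \<alpha>) * dual_character_on \<alpha> (conj_class g0)
                      * isotypic_projection \<mu> \<alpha> f y)
           unitary_dual (class_operator \<mu> g0)"
proof -
  interpret haar_group \<mu> by (rule haar_group.intro) (fact assms)+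
  show ?thesis by (rule class_operator_expansion)
qed

end
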